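(* Let $D\geq 2$ and $k\geq 1$. There exist positive constants $c$, $C'$, $C''$ depending only on $D$ and $k$ such that the following holds. Let $0<\varepsilon<c$ and set $\eta=\exp(-C'/\varepsilon)$ and $\delta=\exp(-C''/\varepsilon)$. Let $E\subset\mathbb R^D$ be finite with $\mathrm{card}(E)\leq k$, and let $\phi:E\to\mathbb R^D$ satisfy \[(1+\delta)^{-1}|x-y|\leq|\phi(x)-\phi(y)|\leq(1+\delta)|x-y|\quad\text{for all }x,y\in E.\] If $\phi$ has no negative $\eta$-block, then there exists a proper $\varepsilon$-distorted diffeomorphism $\Phi:\mathbb R^D\to\mathbb R^D$ such that $\Phi=\phi$ on $E$ and $\Phi$ agrees with a proper Euclidean motion on $\{x\in\mathbb R^D:\ \mathrm{dist}(x,E)\geq 10^4\,\mathrm{diam}(E)\}$.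
   Context: Work in $\mathbb R^D$, $D\ge 2$, with Euclidean norm $|\cdot|$. A Euclidean motion is a map $x\mapsto Tx+x_0$ with $T\in O(D)$, $x_0\in\mathbb R^D$; it is proper if $\det T=1$ and improper if $\det T=-1$. An affine map $x\mapsto Lx+b$ is proper if $\det L>0$ and improper if $\det L<0$. For $\varepsilon>0$, an $\varepsilon$-distorted diffeomorphism is a diffeomorphism $\Phi$ of $\mathbb R^D$ onto $\mathbb R^D$ with $(1+\varepsilon)^{-1}I\leq(\nabla\Phi(x))^T\nabla\Phi(x)\leq(1+\varepsilon)I$ as matrices for all $x$; it is proper if $\det\nabla\Phi>0$ everywhere and improper if $\det\nabla\Phi<0$ everywhere. For $z_0,\dots,z_D\in\mathbb R^D$, $V_D(z_0,\dots,z_D)$ is the $D$-dimensional volume of the simplex with these vertices. For finite $E$, $\phi:E\to\mathbb R^D$ and $0<\eta<1$, a positive (resp. negative) $\eta$-block for $\phi$ is a $(D+1)$-tuple $(x_0,\dots,x_D)$ of points of $E$ with $V_D(x_0,\dots,x_D)\geq\eta^D(\mathrm{diam}\{x_0,\dots,x_D\})^D$ such that the unique affine map $T$ with $T(x_i)=\phi(x_i)$, $i=0,\dots,D$, is proper (resp. improper). *)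

theory Defs
  imports "HOL-Analysis.Analysis"
begin

definition C1_with_jacobian :: "(real^'n \<Rightarrow> real^'n) \<Rightarrow> (real^'n \<Rightarrow> real^'n^'n) \<Rightarrow> bool" where
  "C1_with_jacobian f J \<longleftrightarrow>
     (\<forall>x. (f has_derivative (\<lambda>h. J x *v h)) (at x)) \<and> continuous_on UNIV J"

definition diffeo :: "(real^'n \<Rightarrow> real^'n) \<Rightarrow> bool" where
  "diffeo f \<longleftrightarrow> bij f \<and> (\<exists>J. C1_with_jacobian f J) \<and> (\<exists>K. C1_with_jacobian (inv f) K)"

text \<open>Proper epsilon-distorted diffeomorphism: J x is the Jacobian matrix of Phi at x;
  the matrix inequalities (1+e)^-1 I <= J^T J <= (1+e) I are written out via quadratic forms.\<close>
definition proper_distorted_diffeo :: "real \<Rightarrow> (real^'n \<Rightarrow> real^'n) \<Rightarrow> bool" where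
  "proper_distorted_diffeo \<epsilon> \<Phi> \<longleftrightarrow> diffeo \<Phi> \<and>
     (\<exists>J. C1_with_jacobian \<Phi> J \<and>
        (\<forall>x v. inverse (1 + \<epsilon>) * (v \<bullet> v) \<le> v \<bullet> ((transpose (J x) ** J x) *v v)
             \<and> v \<bullet> ((transpose (J x) ** J x) *v v) \<le> (1 + \<epsilon>) * (v \<bullet> v)) \<and>
        (\<forall>x. det (J x) > 0))"

definition simplex_vol :: "(nat \<Rightarrow> real^'n) \<Rightarrow> real" where
  "simplex_vol z = measure lebesgue (convex hull (z ` {0..CARD('n)}))"

text \<open>A negative eta-block for phi on E: a (D+1)-tuple of points of E with
  V_D >= eta^D diam^D, affinely nondegenerate (so the interpolating affine map is unique),
  such that the affine map interpolating phi at the points is improper.\<close>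
definition neg_block :: "real \<Rightarrow> (real^'n) set \<Rightarrow> (real^'n \<Rightarrow> real^'n) \<Rightarrow> (nat \<Rightarrow> real^'n) \<Rightarrow> bool" where
  "neg_block \<eta> E \<phi> z \<longleftrightarrow>
     (\<forall>i\<le>CARD('n). z i \<in> E) \<and>
     simplex_vol z \<ge> \<eta> ^ CARD('n) * (diameter (z ` {0..CARD('n)})) ^ CARD('n) \<and>
     simplex_vol z > 0 \<and>
     (\<exists>(L::real^'n^'n) b. det L < 0 \<and> (\<forall>i\<le>CARD('n). L *v z i + b = \<phi> (z i)))"

end

theory Submission
  imports Defs
begin

text \<open>
  Induction on the number of points. By pigeonhole over scales with ratio \<open>exp (- A / \<epsilon>)\<close>,
  \<open>E\<close> splits into clusters whose diameters are smaller than their mutual distances by this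
  factor, and each cluster has fewer points than \<open>E\<close>. A Gram--Schmidt argument with
  Householder reflections shows that \<open>\<phi>\<close> is very close to a Euclidean motion on \<open>E\<close>; the motion
  can be taken proper, because either \<open>E\<close> is close to a hyperplane, so that reflecting in it
  costs little, or \<open>E\<close> contains an \<open>\<eta>\<close>-block, whose sign determines the sign of the motion.
  Each cluster is extended by induction. The extension is a motion away from the cluster and is
  undone there by rotating slowly with \<open>ln |x|\<close> and then sliding, both of small distortion
  because of the ratio of the scales. A final slide moves the clusters to their places. The
  map is a composition of these diffeomorphisms, so distortions just multiply.
\<close>

section \<open>Composition of diffeomorphisms with bounded distortion\<close>

text \<open>The motion that extends a cluster need not be near the motion that approximates \<phi>
  on all of \<open>E\<close>: the error of the latter can exceed the diameter of the cluster, so the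
  two rotations may differ by any angle. They have to be joined across the empty shell around the
  cluster by a path of orthogonal maps, and no such path leads from determinant 1 to determinant -1.
  Hence negative blocks must be absent at every scale, and the absence has to pass to clusters.
  Turning by a bounded angle across a shell costs a distortion of order 1/ln(ratio of the radii).
  This forces the ratio exp(-A/\<epsilon>) between scales and the form of \<delta> and \<eta>: both
  are powers of that ratio, where one part of the exponent counts the scales among which the
  pigeonhole chooses, another the divisions made in Gram--Schmidt, and the rest serves the induction
  hypothesis at a smaller \<epsilon>.\<close>

lemma orthogonal_transformation_matrix_det:
  fixes f :: "real^'n \<Rightarrow> real^'n"
  assumes "orthogonal_transformation f"
  shows "orthogonal_matrix (matrix f)" "det (matrix f) = 1 \<or> det (matrix f) = -1"
    "f x = matrix f *v x"
  using assms orthogonal_transformation_matrix[of f] det_orthogonal_matrix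
  by (auto simp: orthogonal_transformation_linear matrix_works)

lemma matrix_det_compose:
  fixes f g :: "real^'n \<Rightarrow> real^'n"
  assumes "linear f" "linear g"
  shows "det (matrix (f \<circ> g)) = det (matrix f) * det (matrix g)"
  using assms by (simp add: matrix_compose det_mul)

lemma continuous_on_det [continuous_intros]:
  fixes A :: "'a::topological_space \<Rightarrow> real^'n^'n"
  assumes "continuous_on S A"
  shows "continuous_on S (\<lambda>x. det (A x))"
  unfolding det_def by (intro continuous_intros assms)

text \<open>The segment from the identity to \<open>M\<close> consists of invertible matrices.\<close>
lemma det_pos_near_id:
  fixes M :: "real^'n^'n"
  assumes "\<And>v. v \<noteq> 0 \<Longrightarrow> norm (M *v v - v) < norm v"
  shows "det M > 0"
proof (rule ccontr)
  assume neg: "\<not> det M > 0"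
  define p where "p t = det (mat 1 + t *\<^sub>R (M - mat 1))" for t :: real
  have "continuous_on {0..1} p"
    unfolding p_def by (intro continuous_intros)
  moreover have "p 0 = 1" "p 1 = det M" by (auto simp: p_def)
  ultimately obtain t where t: "0 \<le> t" "t \<le> 1" "p t = 0"
    using IVT2'[of p 1 0 0] neg by auto
  then have "\<not> invertible (mat 1 + t *\<^sub>R (M - mat 1))"
    by (simp add: p_def invertible_det_nz)
  then obtain v where v: "v \<noteq> 0" "(mat 1 + t *\<^sub>R (M - mat 1)) *v v = 0"
    by (metis invertible_left_inverse matrix_left_invertible_ker)
  then have "v = - (t *\<^sub>R (M *v v - v))"
    by (simp add: algebra_simps matrix_vector_mult_add_rdistrib
        matrix_vector_mult_diff_rdistrib scaleR_matrix_vector_assoc [symmetric] add_eq_0_iff)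
  then have "norm v = t * norm (M *v v - v)"
    using t by (metis abs_of_nonneg norm_minus_cancel norm_scaleR)
  also have "\<dots> \<le> 1 * norm (M *v v - v)"
    using t by (intro mult_right_mono) auto
  also have "\<dots> < norm v" using assms[OF v(1)] by simp
  finally show False by simp
qed

text \<open>The bound is symmetric in the two directions and linear in the norm, so constants
  multiply under composition; \<open>c\<close> corresponds to the square root of 1 + \<epsilon>.
  Smoothness of the inverse is left out because the inverse function theorem recovers it from the
  invertible Jacobian.\<close>

definition quasi_isometry :: "real \<Rightarrow> (real^'n \<Rightarrow> real^'n) \<Rightarrow> bool" where
  "quasi_isometry c f \<longleftrightarrow> bij f \<and> (\<exists>J. C1_with_jacobian f J \<and>
     (\<forall>x. det (J x) > 0) \<and>
     (\<forall>x v. norm v \<le> c * norm (J x *v v) \<and> norm (J x *v v) \<le> c * norm v))"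

lemma quasi_isometry_mono:
  assumes "quasi_isometry c f" "c \<le> d"
  shows "quasi_isometry d f"
proof -
  have "y \<le> c * norm v \<Longrightarrow> y \<le> d * norm v" for y and v :: "real^'n"
    using assms(2) by (meson mult_right_mono norm_ge_zero order_trans)
  then show ?thesis using assms(1) unfolding quasi_isometry_def by blast
qed

lemma continuous_on_matrix_mult:
  fixes A B :: "'a::topological_space \<Rightarrow> real^'n^'n"
  assumes "continuous_on S A" "continuous_on S B"
  shows "continuous_on S (\<lambda>x. A x ** B x)"
  unfolding matrix_matrix_mult_def by (intro continuous_intros assms)

lemma C1_with_jacobian_compose:
  assumes "C1_with_jacobian f J" "C1_with_jacobian g K"
  shows "C1_with_jacobian (f \<circ> g) (\<lambda>x. J (g x) ** K x)"
proof -
  have "continuous_on UNIV g"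
    using assms(2) unfolding C1_with_jacobian_def
    by (meson continuous_at_imp_continuous_on has_derivative_continuous)
  then have "continuous_on UNIV (\<lambda>x. J (g x))"
    using assms(1) unfolding C1_with_jacobian_def
    by (metis continuous_on_compose2 subset_UNIV)
  moreover have "((f \<circ> g) has_derivative (\<lambda>h. (J (g x) ** K x) *v h)) (at x)" for x
    using assms diff_chain_at[of g "\<lambda>h. K x *v h" x f "\<lambda>h. J (g x) *v h"]
    unfolding C1_with_jacobian_def by (simp add: o_def matrix_vector_mul_assoc)
  ultimately show ?thesis
    using assms unfolding C1_with_jacobian_def by (auto intro: continuous_on_matrix_mult)
qed

lemma quasi_isometry_compose:
  assumes f: "quasi_isometry c f" and g: "quasi_isometry d g" and "0 \<le> c" "0 \<le> d"
  shows "quasi_isometry (c * d) (f \<circ> g)"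
proof -
  obtain J where J: "C1_with_jacobian f J" "\<And>x. det (J x) > 0"
     "\<And>x v. norm v \<le> c * norm (J x *v v)" "\<And>x v. norm (J x *v v) \<le> c * norm v"
    using f unfolding quasi_isometry_def by blast
  obtain K where K: "C1_with_jacobian g K" "\<And>x. det (K x) > 0"
     "\<And>x v. norm v \<le> d * norm (K x *v v)" "\<And>x v. norm (K x *v v) \<le> d * norm v"
    using g unfolding quasi_isometry_def by blast
  have 1: "norm v \<le> c * d * norm (J (g x) *v (K x *v v))" for x v
  proof -
    have "norm v \<le> d * norm (K x *v v)" by (rule K)
    also have "\<dots> \<le> d * (c * norm (J (g x) *v (K x *v v)))"
      by (intro mult_left_mono J assms)
    finally show ?thesis by (simp add: mult_ac)
  qed
  have 2: "norm (J (g x) *v (K x *v v)) \<le> c * d * norm v" for x v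
  proof -
    have "norm (J (g x) *v (K x *v v)) \<le> c * norm (K x *v v)" by (rule J)
    also have "\<dots> \<le> c * (d * norm v)"
      by (intro mult_left_mono K assms)
    finally show ?thesis by (simp add: mult_ac)
  qed
  show ?thesis unfolding quasi_isometry_def
  proof (intro conjI exI[of _ "\<lambda>x. J (g x) ** K x"])
    show "bij (f \<circ> g)" using f g by (auto simp: quasi_isometry_def intro: bij_comp)
  qed (use C1_with_jacobian_compose[OF J(1) K(1)] J(2) K(2) 1 2 in
        \<open>auto simp: det_mul matrix_vector_mul_assoc [symmetric]\<close>)
qed

lemma quasi_isometry_motion:
  fixes T :: "real^'n^'n"
  assumes "orthogonal_matrix T" "det T = 1"
  shows "quasi_isometry 1 (\<lambda>x. T *v x + b)"
  unfolding quasi_isometry_def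
proof (intro conjI exI[of _ "\<lambda>_. T"])
  have ot: "orthogonal_transformation ((*v) T)"
    using assms by (simp add: orthogonal_transformation_matrix)
  have "bij ((+) b \<circ> (*v) T)"
    by (rule bij_comp[OF orthogonal_transformation_bij[OF ot]]) simp
  then show "bij (\<lambda>x. T *v x + b)" by (simp add: o_def add.commute)
  show "C1_with_jacobian (\<lambda>x. T *v x + b) (\<lambda>_. T)"
    unfolding C1_with_jacobian_def
    by (auto intro!: derivative_eq_intros bounded_linear_imp_has_derivative)
  show "\<forall>x v. norm v \<le> 1 * norm (T *v v) \<and> norm (T *v v) \<le> 1 * norm v"
    using orthogonal_transformation_norm[OF ot] by auto
qed (use assms in auto)

lemma matrix_mult_matrix_inv:
  fixes A :: "real^'n^'n"
  assumes "det A \<noteq> 0"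
  shows "A ** matrix_inv A = mat 1"
proof -
  have "\<exists>B. A ** B = mat 1 \<and> B ** A = mat 1"
    using assms by (simp add: invertible_det_nz [symmetric] invertible_def)
  then have "A ** matrix_inv A = mat 1 \<and> matrix_inv A ** A = mat 1"
    unfolding matrix_inv_def by (rule someI_ex)
  then show ?thesis ..
qed

text \<open>Cramer's rule writes each entry of the inverse as a quotient of determinants, which
  reduces the claim to continuity of \<open>det\<close>.\<close>

lemma continuous_on_matrix_inverse:
  fixes J :: "'a::topological_space \<Rightarrow> real^'n^'n"
  assumes "continuous_on S J" "\<And>x. x \<in> S \<Longrightarrow> det (J x) \<noteq> 0"
  shows "continuous_on S (\<lambda>x. matrix_inv (J x))"
proof -
  define C where "C x = (\<chi> k l. det (\<chi> i j. if j = k then axis l 1 $ i else J x $ i $ j) / det (J x))" for x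
  have "matrix_inv (J x) = C x" if "x \<in> S" for x
  proof -
    have "matrix_inv (J x) *v axis l 1 = C x *v axis l 1" for l
    proof -
      have "J x ** matrix_inv (J x) = mat 1"
        using assms(2)[OF that] by (rule matrix_mult_matrix_inv)
      then have "J x *v (matrix_inv (J x) *v axis l 1) = axis l 1"
        by (simp add: matrix_vector_mul_assoc)
      then have "matrix_inv (J x) *v axis l 1 =
          (\<chi> k. det (\<chi> i j. if j = k then axis l 1 $ i else J x $ i $ j) / det (J x))"
        using cramer[OF assms(2)[OF that]] by blast
      also have "\<dots> = C x *v axis l 1"
        by (simp add: C_def matrix_vector_mult_basis column_def)
      finally show ?thesis .
    qed
    then show ?thesis
      by (simp add: vec_eq_iff matrix_vector_mult_basis column_def)
  qed
  moreover have "continuous_on S (\<lambda>x. if j = k then axis l 1 $ i else J x $ i $ j)" for i j k l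
    by (cases "j = k") (auto intro!: continuous_intros assms)
  then have "continuous_on S C"
    unfolding C_def using assms(2) by (intro continuous_intros assms) auto
  ultimately show ?thesis by (simp cong: continuous_on_cong)
qed

lemma quasi_isometry_imp_distorted:
  assumes "quasi_isometry c f" "c > 0" "c\<^sup>2 \<le> 1 + \<epsilon>"
  shows "proper_distorted_diffeo \<epsilon> f"
proof -
  obtain J where J: "C1_with_jacobian f J" "\<And>x. det (J x) > 0"
     "\<And>x v. norm v \<le> c * norm (J x *v v)" "\<And>x v. norm (J x *v v) \<le> c * norm v"
    using assms(1) unfolding quasi_isometry_def by blast
  have b: "bij f" using assms(1) by (simp add: quasi_isometry_def)
  have df: "(f has_derivative (\<lambda>h. J x *v h)) (at x)" for x
    using J(1) by (simp add: C1_with_jacobian_def)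
  have contf: "continuous_on UNIV f"
    using df by (meson continuous_at_imp_continuous_on has_derivative_continuous)
  have "(inv f has_derivative (\<lambda>h. matrix_inv (J (inv f y)) *v h)) (at y)" for y
  proof -
    have "((*v) (J (inv f y))) \<circ> (*v) (matrix_inv (J (inv f y))) = id"
      using matrix_mult_matrix_inv[of "J (inv f y)"] J(2)[of "inv f y"]
      by (simp add: fun_eq_iff matrix_vector_mul_assoc)
    then have "(inv f has_derivative (\<lambda>h. matrix_inv (J (inv f y)) *v h)) (at (f (inv f y)))"
      by (intro has_derivative_inverse_strong[OF open_UNIV UNIV_I contf _ df])
        (simp_all add: b bij_is_inj)
    then show ?thesis using b by (simp add: bij_is_surj surj_f_inv_f)
  qed
  moreover from this have "continuous_on UNIV (inv f)"
    by (meson continuous_at_imp_continuous_on has_derivative_continuous)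
  then have "continuous_on UNIV (\<lambda>y. matrix_inv (J (inv f y)))"
    using J(1) J(2) unfolding C1_with_jacobian_def
    by (intro continuous_on_matrix_inverse)
       (auto intro: continuous_on_compose2 simp: less_imp_neq[THEN not_sym])
  ultimately have d: "diffeo f"
    using b J(1) unfolding diffeo_def C1_with_jacobian_def
    by (intro conjI exI[of _ J] exI[of _ "\<lambda>y. matrix_inv (J (inv f y))"]) simp_all
  have q: "v \<bullet> ((transpose (J x) ** J x) *v v) = (norm (J x *v v))\<^sup>2" for x v
    by (metis dot_lmul_matrix matrix_vector_mul_assoc power2_norm_eq_inner
        inner_commute vector_transpose_matrix transpose_transpose)
  have c: "0 < c\<^sup>2" using assms(2) by simp
  have 1: "(norm (J x *v v))\<^sup>2 \<le> (1 + \<epsilon>) * (v \<bullet> v)" for x v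
  proof -
    have "(norm (J x *v v))\<^sup>2 \<le> (c * norm v)\<^sup>2" by (intro power_mono J) auto
    also have "\<dots> \<le> (1 + \<epsilon>) * (norm v)\<^sup>2"
      unfolding power_mult_distrib by (intro mult_right_mono assms) auto
    finally show ?thesis by (simp add: power2_norm_eq_inner)
  qed
  have 2: "inverse (1 + \<epsilon>) * (v \<bullet> v) \<le> (norm (J x *v v))\<^sup>2" for x v
  proof -
    have "(norm v)\<^sup>2 \<le> (c * norm (J x *v v))\<^sup>2" by (intro power_mono J) auto
    also have "\<dots> \<le> (1 + \<epsilon>) * (norm (J x *v v))\<^sup>2"
      unfolding power_mult_distrib by (intro mult_right_mono assms) auto
    finally have "v \<bullet> v \<le> (1 + \<epsilon>) * (norm (J x *v v))\<^sup>2"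
      by (simp add: power2_norm_eq_inner)
    moreover have "0 < 1 + \<epsilon>" using c assms(3) by linarith
    ultimately show ?thesis by (simp add: divide_simps mult.commute)
  qed
  show ?thesis unfolding proper_distorted_diffeo_def
    by (intro conjI exI[of _ J] allI) (simp_all add: d J(1,2) 1 2 q del: power2_norm_eq_inner)
qed

text \<open>The comparison rotation \<open>R x\<close> may vary with the point, as a twist requires.
  Once it is divided out, the derivative lies within 1/2 of the identity, which settles the sign of
  the determinant; the constant comes from 1/(1 - \<epsilon>) \<le> 1 + 2\<epsilon> for \<epsilon>
  \<le> 1/2.\<close>

lemma quasi_isometryI:
  fixes f :: "real^'n \<Rightarrow> real^'n"
  assumes "bij f" "\<And>x. (f has_derivative D x) (at x)"
    and "\<And>v. continuous_on UNIV (\<lambda>x. D x v)"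
    and R: "\<And>x. orthogonal_transformation (R x)" "\<And>x. det (matrix (R x)) = 1"
    and near: "\<And>x v. norm (D x v - R x v) \<le> \<epsilon> * norm v" and \<epsilon>: "0 \<le> \<epsilon>" "\<epsilon> \<le> 1/2"
  shows "quasi_isometry (1 + 2 * \<epsilon>) f"
proof -
  define J where "J x = matrix (D x)" for x
  have lin: "linear (D x)" for x
    using assms(2) has_derivative_linear by blast
  have Jv: "J x *v v = D x v" for x v
    by (simp add: J_def lin matrix_works)
  have "continuous_on UNIV J"
    unfolding J_def matrix_def by (intro continuous_intros assms)
  then have C1: "C1_with_jacobian f J"
    using assms(2) unfolding C1_with_jacobian_def Jv by simp
  have nR: "norm (R x v) = norm v" for x v
    using R(1) by (rule orthogonal_transformation_norm)
  have up: "norm (D x v) \<le> (1 + 2 * \<epsilon>) * norm v" for x v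
  proof -
    have "norm (D x v) \<le> norm (R x v) + norm (D x v - R x v)"
      by (metis norm_triangle_sub)
    also have "\<dots> \<le> norm v + \<epsilon> * norm v" using near[of x v] nR by simp
    also have "\<dots> \<le> (1 + 2 * \<epsilon>) * norm v" using \<epsilon> by (simp add: algebra_simps)
    finally show ?thesis .
  qed
  have low: "norm v \<le> (1 + 2 * \<epsilon>) * norm (D x v)" for x v
  proof -
    have "norm (R x v) \<le> norm (D x v) + norm (D x v - R x v)"
      by (metis norm_minus_commute norm_triangle_sub)
    then have "(1 - \<epsilon>) * norm v \<le> norm (D x v)"
      using near[of x v] nR by (simp add: algebra_simps)
    then have "(1 + 2 * \<epsilon>) * ((1 - \<epsilon>) * norm v) \<le> (1 + 2 * \<epsilon>) * norm (D x v)"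
      using \<epsilon> by (intro mult_left_mono) auto
    moreover have "1 \<le> (1 + 2 * \<epsilon>) * (1 - \<epsilon>)"
      using \<epsilon> mult_left_mono[of \<epsilon> "1/2" \<epsilon>] by (simp add: algebra_simps)
    then have "1 * norm v \<le> (1 + 2 * \<epsilon>) * (1 - \<epsilon>) * norm v"
      by (intro mult_right_mono) auto
    ultimately show ?thesis by (simp add: mult_ac)
  qed
  have "det (J x) > 0" for x
  proof -
    have om: "orthogonal_matrix (matrix (R x))"
      by (rule orthogonal_transformation_matrix_det(1)[OF R(1)])
    have "det (transpose (matrix (R x)) ** J x) > 0"
    proof (rule det_pos_near_id)
      fix v :: "real^'n" assume "v \<noteq> 0"
      have "transpose (matrix (R x)) *v (R x v) = v"
        using om R(1) unfolding orthogonal_matrix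
        by (metis matrix_vector_mul_assoc matrix_vector_mul_lid orthogonal_transformation_matrix_det(3))
      then have "norm ((transpose (matrix (R x)) ** J x) *v v - v)
          = norm (transpose (matrix (R x)) *v (D x v - R x v))"
        by (simp add: matrix_vector_mult_diff_distrib matrix_vector_mul_assoc [symmetric] Jv)
      also have "\<dots> = norm (D x v - R x v)"
        using om by (intro orthogonal_transformation_norm)
          (simp only: orthogonal_transformation_matrix matrix_of_matrix_vector_mul
             matrix_vector_mul_linear orthogonal_matrix_transpose)
      also have "\<dots> \<le> 1/2 * norm v"
        using near[of x v] \<epsilon>(2) by (meson mult_right_mono norm_ge_zero order_trans)
      also have "\<dots> < norm v" using \<open>v \<noteq> 0\<close> by simp
      finally show "norm ((transpose (matrix (R x)) ** J x) *v v - v) < norm v" .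
    qed
    then show ?thesis using R(2) by (simp add: det_mul)
  qed
  then show ?thesis unfolding quasi_isometry_def
    using assms(1) C1 up low by (auto simp: Jv intro!: exI[of _ J])
qed

text \<open>By the mean value inequality \<open>h\<close> is a contraction with factor 1/2, so the
  equation x = y - h x has exactly one solution by Banach's fixed point theorem; this yields
  bijectivity.\<close>

lemma quasi_isometry_perturbation:
  fixes h :: "real^'n \<Rightarrow> real^'n"
  assumes dh: "\<And>x. (h has_derivative H x) (at x)"
    and "\<And>v. continuous_on UNIV (\<lambda>x. H x v)"
    and near: "\<And>x v. norm (H x v) \<le> \<epsilon> * norm v" and \<epsilon>: "0 \<le> \<epsilon>" "\<epsilon> \<le> 1/2"
  shows "quasi_isometry (1 + 2 * \<epsilon>) (\<lambda>x. x + h x)"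
proof (rule quasi_isometryI[where D = "\<lambda>x v. v + H x v" and R = "\<lambda>x v. v"])
  have lip: "norm (h x - h y) \<le> \<epsilon> * norm (x - y)" for x y
    using dh near by (intro differentiable_bound[of UNIV h H]) (auto intro!: onorm_le)
  have lip2: "norm (h x - h y) \<le> 1/2 * norm (x - y)" for x y
    using lip[of x y] \<epsilon>(2) by (meson mult_right_mono norm_ge_zero order_trans)
  have lip2': "norm (h y - h x) \<le> 1/2 * norm (x - y)" for x y
    using lip2[of x y] by (simp only: norm_minus_commute)
  show "bij (\<lambda>x. x + h x)"
    unfolding bij_def
  proof
    show "inj (\<lambda>x. x + h x)"
    proof (rule injI)
      fix x y assume "x + h x = y + h y"
      then have "x - y = h y - h x" by (simp add: algebra_simps)
      then have "norm (x - y) \<le> 1/2 * norm (x - y)"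
        using lip2[of y x] by (simp add: norm_minus_commute)
      then show "x = y" by simp
    qed
    have "\<exists>x. y = x + h x" for y
    proof -
      have "\<exists>!x. y - h x = x"
        by (rule banach_fix_type[where c = "1/2"])
          (use lip2' in \<open>simp_all add: dist_norm\<close>)
      then obtain x where "y - h x = x" by blast
      then show ?thesis by (intro exI[of _ x]) (simp add: algebra_simps)
    qed
    then show "surj (\<lambda>x. x + h x)" by (auto simp: surj_def)
  qed
  show "((\<lambda>x. x + h x) has_derivative (\<lambda>v. v + H x v)) (at x)" for x
    by (intro derivative_intros dh)
  show "continuous_on UNIV (\<lambda>x. v + H x v)" for v
    by (intro continuous_intros assms)
qed (use near \<epsilon> in \<open>auto simp: matrix_id_mat_1[unfolded id_def] \<close>)

section \<open>Vectors with almost equal Gram matrices\<close>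

text \<open>The Householder reflection along p - q. Since p - q vanishes in every coordinate in
  which p and q both vanish, such coordinates are untouched, which lets an induction over
  coordinates use it.\<close>

lemma orthogonal_transformation_swap:
  fixes p q :: "real^'n"
  assumes "norm p = norm q"
  obtains h where "orthogonal_transformation h" "h p = q" "h q = p" "\<And>x. h (h x) = x"
    "\<And>i x. p $ i = 0 \<Longrightarrow> q $ i = 0 \<Longrightarrow> h x $ i = x $ i"
proof (cases "p = q")
  case True
  then show ?thesis by (intro that[of "\<lambda>x. x"]) auto
next
  case False
  define n where "n = p - q"
  have n0: "n \<bullet> n \<noteq> 0" using False by (simp add: n_def)
  have pq: "p \<bullet> p = q \<bullet> q" using assms by (simp add: norm_eq)
  define h where "h x = x - (2 * (n \<bullet> x) / (n \<bullet> n)) *\<^sub>R n" for x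
  have 1: "2 * (n \<bullet> p) = n \<bullet> n" "2 * (n \<bullet> q) = - (n \<bullet> n)"
    using pq by (auto simp: n_def algebra_simps inner_commute)
  have "linear h"
    by (rule linearI) (auto simp: h_def algebra_simps add_divide_distrib)
  moreover have "h v \<bullet> h w = v \<bullet> w" for v w
    using n0 by (simp add: h_def inner_diff_left inner_diff_right inner_commute[of v n]
        field_simps power2_eq_square)
  ultimately have "orthogonal_transformation h"
    by (simp add: orthogonal_transformation_def)
  moreover have "h (h x) = x" for x
    using n0 by (simp add: h_def inner_diff_right scaleR_left_distrib [symmetric] field_simps)
  moreover have "h p = q" "h q = p"
    using n0 unfolding h_def 1 by (auto simp: n_def)
  moreover have "h x $ i = x $ i" if "p $ i = 0" "q $ i = 0" for i x
    using that by (simp add: h_def n_def)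
  ultimately show ?thesis using that by blast
qed

text \<open>The image of the axis vector is a unit vector whose coordinate \<open>i\<close> equals
  1, which leaves no room for other coordinates.\<close>

lemma orthogonal_transformation_fixes_axis:
  fixes f :: "real^'n \<Rightarrow> real^'n"
  assumes "orthogonal_transformation f" "\<And>x. f x $ i = x $ i"
  shows "f (axis i 1) = axis i 1"
proof -
  have "f (axis i 1) \<bullet> axis i 1 = 1"
    using assms(2)[of "axis i 1"] by (simp add: cart_eq_inner_axis)
  moreover have "f (axis i 1) \<bullet> f (axis i 1) = 1"
    using assms(1) by (simp add: orthogonal_transformation_def inner_axis)
  ultimately have "(f (axis i 1) - axis i 1) \<bullet> (f (axis i 1) - axis i 1) = 0"
    by (simp add: inner_diff_left inner_diff_right inner_commute inner_axis)
  then show ?thesis by simp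
qed

definition flip_axis :: "'n \<Rightarrow> real^'n \<Rightarrow> real^'n" where
  "flip_axis r x = (\<chi> i. if i = r then - x $ i else x $ i)"

lemma flip_axis:
  fixes r :: "'n::finite"
  shows "orthogonal_transformation (flip_axis r)" "det (matrix (flip_axis r)) = -1"
proof -
  have "linear (flip_axis r)"
    by (rule linearI) (auto simp: flip_axis_def vec_eq_iff)
  moreover have "flip_axis r v \<bullet> flip_axis r w = v \<bullet> w" for v w
    unfolding inner_vec_def by (intro sum.cong) (auto simp: flip_axis_def)
  ultimately show "orthogonal_transformation (flip_axis r)"
    by (simp add: orthogonal_transformation_def)
  have "det (matrix (flip_axis r)) = (\<Prod>i\<in>UNIV. matrix (flip_axis r) $ i $ i)"
    by (rule det_diagonal) (auto simp: matrix_def flip_axis_def axis_def)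
  also have "\<dots> = (\<Prod>i\<in>UNIV. if i = r then -1 else 1)"
    by (intro prod.cong) (auto simp: matrix_def flip_axis_def axis_def)
  finally show "det (matrix (flip_axis r)) = -1" by (simp add: prod.delta)
qed

text \<open>Here \<rho> and \<sigma> are the lengths of two corresponding pivots turned onto the
  same axis, and a and b are the coordinates of another pair of vectors along it. From \<rho>(a - b)
  = (\<rho>a - \<sigma>b) + (\<sigma> - \<rho>)b and a second multiplication by \<rho> the error is
  3\<delta>; dividing by \<rho> twice, with \<rho> > \<tau>/4, gives 3 * 16 = 48.\<close>

lemma first_coordinate_close:
  fixes \<tau> :: real
  assumes "\<tau> / 4 < \<rho>" "0 < \<tau>" "\<rho> \<le> 1" "0 \<le> \<sigma>" "\<bar>\<rho>\<^sup>2 - \<sigma>\<^sup>2\<bar> \<le> \<delta>"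
    "\<bar>\<rho> * a - \<sigma> * b\<bar> \<le> \<delta>" "\<bar>b\<bar> \<le> 2"
  shows "\<bar>a - b\<bar> \<le> 48 * \<delta> / \<tau>\<^sup>2"
proof -
  have \<rho>: "0 < \<rho>" and \<delta>: "0 \<le> \<delta>" using assms by linarith+
  have "\<bar>\<sigma> - \<rho>\<bar> * \<rho> \<le> \<bar>\<sigma> - \<rho>\<bar> * \<bar>\<sigma> + \<rho>\<bar>"
    using assms \<rho> by (intro mult_left_mono) auto
  also have "\<dots> = \<bar>\<rho>\<^sup>2 - \<sigma>\<^sup>2\<bar>"
    by (simp add: abs_mult [symmetric] algebra_simps power2_eq_square)
  finally have 1: "\<rho> * \<bar>\<sigma> - \<rho>\<bar> \<le> \<delta>" using assms by (simp add: mult.commute)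
  have "\<rho> * (a - b) = (\<rho> * a - \<sigma> * b) + (\<sigma> - \<rho>) * b"
    by (simp add: algebra_simps)
  then have "\<rho> * \<bar>a - b\<bar> = \<bar>(\<rho> * a - \<sigma> * b) + (\<sigma> - \<rho>) * b\<bar>"
    using \<rho> by (metis abs_mult abs_of_pos)
  also have "\<dots> \<le> \<delta> + \<bar>\<sigma> - \<rho>\<bar> * \<bar>b\<bar>"
    using assms(6) by (intro order_trans[OF abs_triangle_ineq] add_mono) (auto simp: abs_mult)
  also have "\<dots> \<le> \<delta> + \<bar>\<sigma> - \<rho>\<bar> * 2"
    using assms by (intro add_mono mult_left_mono) auto
  finally have "\<rho> * (\<rho> * \<bar>a - b\<bar>) \<le> \<rho> * (\<delta> + \<bar>\<sigma> - \<rho>\<bar> * 2)"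
    using \<rho> by (intro mult_left_mono) auto
  also have "\<dots> \<le> 1 * \<delta> + 2 * \<delta>"
    using 1 mult_right_mono[OF assms(3) \<delta>] by (simp add: algebra_simps)
  finally have 2: "\<rho> * \<rho> * \<bar>a - b\<bar> \<le> 3 * \<delta>" by (simp add: mult_ac)
  have "\<tau> / 4 * (\<tau> / 4) * \<bar>a - b\<bar> \<le> \<rho> * \<rho> * \<bar>a - b\<bar>"
    using assms by (intro mult_right_mono mult_mono) auto
  then have "\<tau>\<^sup>2 * \<bar>a - b\<bar> \<le> 48 * \<delta>" using 2 by (simp add: power2_eq_square)
  then show ?thesis using assms by (simp add: field_simps)
qed

lemma almost_gram_equal_imp_close:
  fixes u w :: "'a \<Rightarrow> real^'n" and \<tau> \<delta> :: real
  assumes "finite R" and \<tau>: "0 < \<tau>" "\<tau> \<le> 1/16"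
    and "0 \<le> \<delta>" "\<delta> \<le> \<tau> ^ (5 * card R)"
    and "\<And>i j. i \<in> I \<Longrightarrow> j \<notin> R \<Longrightarrow> u i $ j = 0"
    and "\<And>i j. i \<in> I \<Longrightarrow> j \<notin> R \<Longrightarrow> w i $ j = 0"
    and "\<And>i. i \<in> I \<Longrightarrow> norm (u i) \<le> 1"
    and "\<And>i j. i \<in> I \<Longrightarrow> j \<in> I \<Longrightarrow> \<bar>u i \<bullet> u j - w i \<bullet> w j\<bar> \<le> \<delta>"
  shows "(\<forall>s\<in>{1,-1}. \<exists>f. orthogonal_transformation f \<and> (\<forall>x j. j \<notin> R \<longrightarrow> f x $ j = x $ j) \<and>
            det (matrix f) = s \<and> (\<forall>i\<in>I. norm (w i - f (u i)) \<le> card R * \<tau>)) \<or>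
         (\<exists>f J. orthogonal_transformation f \<and> (\<forall>x j. j \<notin> R \<longrightarrow> f x $ j = x $ j) \<and>
            (\<forall>i\<in>I. norm (w i - f (u i)) \<le> \<delta> / \<tau> ^ (5 * card R)) \<and>
            J \<subseteq> I \<and> finite J \<and> card J \<le> card R \<and>
            (\<forall>v t. (\<forall>j. j \<notin> R \<longrightarrow> v $ j = 0) \<longrightarrow> 0 \<le> t \<longrightarrow> (\<forall>i\<in>J. \<bar>v \<bullet> u i\<bar> \<le> t) \<longrightarrow>
               norm v * \<tau> ^ (5 * card R) \<le> t))"
  using assms(1,4-)
proof (induction R arbitrary: u w \<delta> rule: finite_induct)
  case empty
  have z: "x = 0" if "\<And>j. j \<notin> {} \<Longrightarrow> x $ j = 0" for x :: "real^'n"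
    using that by (simp add: vec_eq_iff)
  have uw: "u i = 0" "w i = 0" if "i \<in> I" for i
    using empty(3,4) that z by auto
  have v: "norm v * \<tau> ^ (5 * card {}) \<le> t" if "\<forall>j. j \<notin> {} \<longrightarrow> v $ j = 0" "0 \<le> t"
    for v :: "real^'n" and t
    using z[of v] that by simp
  have "norm (w i - u i) \<le> \<delta> / \<tau> ^ (5 * card {})" if "i \<in> I" for i
    using uw[OF that] empty(1) by simp
  then show ?case
    using v by (intro disjI2 exI[of _ "\<lambda>x. x"] exI[of _ "{}"] conjI) simp_all
next
  case (insert r R)
  note u0 = insert.prems(3) and w0 = insert.prems(4) and u1 = insert.prems(5) and gram = insert.prems(6)
  have \<delta>0: "0 \<le> \<delta>" by fact
  define q where "q = \<tau> ^ (5 * card R)"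
  have q: "0 < q" "q \<le> 1" using \<tau> by (auto simp: q_def power_le_one)
  have cardR: "\<tau> ^ (5 * card (insert r R)) = \<tau> ^ 5 * q"
    using insert.hyps by (simp add: q_def power_add [symmetric])
  have \<delta>: "\<delta> \<le> \<tau> ^ 5 * q" using insert.prems(2) cardR by simp
  have t: "0 < \<tau> ^ n" for n using \<tau> by simp
  have \<delta>5: "\<delta> \<le> \<tau> ^ 5"
    using \<delta> q t[of 5] by (meson mult_left_le order_trans less_imp_le)
  have \<delta>1: "\<delta> \<le> 1" using \<delta>5 power_le_one[of \<tau> 5] \<tau> by simp
  have small48: "48 * \<tau> ^ 3 \<le> 1/2"
    using \<tau> power_mono[of \<tau> "1/16" 3] by (simp add: power3_eq_cube)
  show ?case
  proof (cases "\<forall>i\<in>I. norm (u i) \<le> \<tau> / 4")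
    \<comment> \<open>All vectors are short, so every orthogonal map is accurate enough; the
      identity and the flip of axis \<open>r\<close> supply the two determinants.\<close>
    case True
    have nw: "norm (w i) \<le> \<tau> / 2" if "i \<in> I" for i
    proof -
      have "(norm (w i))\<^sup>2 \<le> (norm (u i))\<^sup>2 + \<delta>"
        using gram[OF that that] by (simp add: power2_norm_eq_inner)
      also have "\<dots> \<le> (\<tau> / 4)\<^sup>2 + \<tau> ^ 5"
        using True that \<delta>5 by (intro add_mono power_mono) auto
      also have "\<dots> = (\<tau> / 4)\<^sup>2 + \<tau>\<^sup>2 * \<tau> ^ 3" by (simp add: power_add [symmetric])
      also have "\<dots> \<le> (\<tau> / 4)\<^sup>2 + \<tau>\<^sup>2 * (1/96)"
        using small48 by (intro add_left_mono mult_left_mono) auto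
      finally have "(norm (w i))\<^sup>2 \<le> (\<tau> / 2)\<^sup>2"
      proof -
        have "(\<tau> / 4)\<^sup>2 = \<tau>\<^sup>2 / 16" "(\<tau> / 2)\<^sup>2 = \<tau>\<^sup>2 / 4"
          by (simp_all add: power_divide)
        then show "y \<le> (\<tau> / 2)\<^sup>2" if "y \<le> (\<tau> / 4)\<^sup>2 + \<tau>\<^sup>2 * (1/96)" for y
          using that zero_le_power2[of \<tau>] by linarith
      qed
      then show ?thesis using \<tau> by (simp add: power2_le_iff_abs_le)
    qed
    have close: "norm (w i - f (u i)) \<le> card (insert r R) * \<tau>"
      if "orthogonal_transformation f" "i \<in> I" for f :: "real^'n \<Rightarrow> real^'n" and i
    proof -
      have "norm (w i - f (u i)) \<le> norm (w i) + norm (f (u i))" by (rule norm_triangle_ineq4)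
      also have "\<dots> \<le> \<tau> / 2 + \<tau> / 4"
        using nw[OF that(2)] True that by (intro add_mono) (auto simp: orthogonal_transformation_norm)
      also have "\<dots> \<le> 1 * \<tau>" using \<tau> by simp
      also have "\<dots> \<le> card (insert r R) * \<tau>"
        using insert.hyps \<tau> by (intro mult_right_mono) auto
      finally show ?thesis .
    qed
    have "\<exists>f. orthogonal_transformation f \<and> (\<forall>x j. j \<notin> insert r R \<longrightarrow> f x $ j = x $ j) \<and>
            det (matrix f) = s \<and> (\<forall>i\<in>I. norm (w i - f (u i)) \<le> card (insert r R) * \<tau>)"
      if "s \<in> {1, -1}" for s :: real
    proof (cases "s = 1")
      case True
      then show ?thesis
        using close[of "\<lambda>x. x"]
        by (intro exI[of _ "\<lambda>x. x"]) (auto simp: matrix_id_mat_1[unfolded id_def])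
    next
      case False
      then show ?thesis
        using that close[OF flip_axis(1)] flip_axis[of r]
        by (intro exI[of _ "flip_axis r"] conjI) (auto simp: flip_axis_def)
    qed
    then show ?thesis by blast
  next
    case False
    then obtain k where k: "k \<in> I" "\<tau> / 4 < norm (u k)" by force
    define \<rho> where "\<rho> = norm (u k)"
    define \<sigma> where "\<sigma> = norm (w k)"
    define e :: "real^'n" where "e = axis r 1"
    have ne: "norm e = 1" by (simp add: e_def)
    have xe: "x \<bullet> e = x $ r" "e \<bullet> x = x $ r" for x
      by (auto simp: e_def cart_eq_inner_axis inner_commute)
    have e0: "e $ j = 0" if "j \<noteq> r" for j using that by (simp add: e_def axis_def)
    have er: "e $ r = 1" by (simp add: e_def)
    \<comment> \<open>Both vectors with the pivot index \<open>k\<close> are turned onto the axis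
      \<open>r\<close>, by reflections that leave the coordinates outside \<open>insert r R\<close>
      alone.\<close>
    obtain h1 where h1: "orthogonal_transformation h1" "h1 (u k) = \<rho> *\<^sub>R e"
      "\<And>i x. u k $ i = 0 \<Longrightarrow> (\<rho> *\<^sub>R e) $ i = 0 \<Longrightarrow> h1 x $ i = x $ i"
      using orthogonal_transformation_swap[of "u k" "\<rho> *\<^sub>R e", unfolded norm_scaleR ne]
      unfolding \<rho>_def by (metis abs_norm_cancel mult.right_neutral)
    obtain h2 where h2: "orthogonal_transformation h2" "h2 (w k) = \<sigma> *\<^sub>R e" "\<And>x. h2 (h2 x) = x"
      "\<And>i x. w k $ i = 0 \<Longrightarrow> (\<sigma> *\<^sub>R e) $ i = 0 \<Longrightarrow> h2 x $ i = x $ i"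
      using orthogonal_transformation_swap[of "w k" "\<sigma> *\<^sub>R e", unfolded norm_scaleR ne]
      unfolding \<sigma>_def by (metis abs_norm_cancel mult.right_neutral)
    have h1R: "h1 x $ j = x $ j" if "j \<notin> insert r R" for x j
      using that h1(3) u0[OF k(1)] e0 by simp
    have h2R: "h2 x $ j = x $ j" if "j \<notin> insert r R" for x j
      using that h2(4) w0[OF k(1)] e0 by simp
    have ih1: "h1 x \<bullet> h1 y = x \<bullet> y" and ih2: "h2 x \<bullet> h2 y = x \<bullet> y" for x y
      using h1(1) h2(1) by (auto simp: orthogonal_transformation_def)
    have n1: "norm (h1 x) = norm x" and n2: "norm (h2 x) = norm x" for x
      using h1(1) h2(1) by (auto simp: orthogonal_transformation_norm)
    define a where "a i = h1 (u i) $ r" for i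
    define b where "b i = h2 (w i) $ r" for i
    define u' where "u' i = h1 (u i) - a i *\<^sub>R e" for i
    define w' where "w' i = h2 (w i) - b i *\<^sub>R e" for i
    have ab1: "\<bar>a i\<bar> \<le> 1" "\<bar>b i\<bar> \<le> 2" if "i \<in> I" for i
    proof -
      show "\<bar>a i\<bar> \<le> 1"
        using u1[OF that] component_le_norm_cart[of "h1 (u i)" r] by (simp add: a_def n1)
      have "(norm (w i))\<^sup>2 \<le> (norm (u i))\<^sup>2 + \<delta>"
        using gram[OF that that] by (simp add: power2_norm_eq_inner)
      also have "\<dots> \<le> 1\<^sup>2 + 1"
        using u1[OF that] \<delta>1 by (intro add_mono power_mono) auto
      finally have "(norm (w i))\<^sup>2 \<le> 2\<^sup>2" by simp
      then have "norm (w i) \<le> 2" by (rule power2_le_imp_le) simp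
      then show "\<bar>b i\<bar> \<le> 2"
        using component_le_norm_cart[of "h2 (w i)" r] by (simp add: b_def n2)
    qed
    have ab: "\<bar>a i - b i\<bar> \<le> 48 * \<delta> / \<tau>\<^sup>2" if "i \<in> I" for i
    proof (rule first_coordinate_close)
      show "\<tau> / 4 < \<rho>" "\<rho> \<le> 1" using k u1 by (auto simp: \<rho>_def)
      show "\<bar>\<rho>\<^sup>2 - \<sigma>\<^sup>2\<bar> \<le> \<delta>"
        using gram[OF k(1) k(1)] by (simp add: \<rho>_def \<sigma>_def power2_norm_eq_inner)
      have "u k \<bullet> u i = \<rho> * a i" "w k \<bullet> w i = \<sigma> * b i"
        using ih1[of "u k" "u i"] ih2[of "w k" "w i"]
        by (simp_all add: h1(2) h2(2) xe a_def b_def)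
      then show "\<bar>\<rho> * a i - \<sigma> * b i\<bar> \<le> \<delta>" using gram[OF k(1) that] by simp
    qed (use \<tau> ab1[OF that] in \<open>auto simp: \<sigma>_def\<close>)
    have inner': "u' i \<bullet> u' j = u i \<bullet> u j - a i * a j" "w' i \<bullet> w' j = w i \<bullet> w j - b i * b j" for i j
      by (simp_all add: u'_def w'_def inner_diff_left inner_diff_right xe er ih1 ih2 a_def b_def)
    \<comment> \<open>Splitting off the pivot coordinate turns the Gram error \<delta> into at most
      \<delta> + 144\<delta>/\<tau>^2; since \<tau> \<le> 1/16, two more powers of \<tau> absorb the
      factor 144.\<close>
    define \<delta>' where "\<delta>' = \<delta> / \<tau> ^ 4"
    have IH: "(\<forall>s\<in>{1,-1}. \<exists>f. orthogonal_transformation f \<and> (\<forall>x j. j \<notin> R \<longrightarrow> f x $ j = x $ j) \<and>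
            det (matrix f) = s \<and> (\<forall>i\<in>I. norm (w' i - f (u' i)) \<le> card R * \<tau>)) \<or>
         (\<exists>f J. orthogonal_transformation f \<and> (\<forall>x j. j \<notin> R \<longrightarrow> f x $ j = x $ j) \<and>
            (\<forall>i\<in>I. norm (w' i - f (u' i)) \<le> \<delta>' / \<tau> ^ (5 * card R)) \<and>
            J \<subseteq> I \<and> finite J \<and> card J \<le> card R \<and>
            (\<forall>v t. (\<forall>j. j \<notin> R \<longrightarrow> v $ j = 0) \<longrightarrow> 0 \<le> t \<longrightarrow> (\<forall>i\<in>J. \<bar>v \<bullet> u' i\<bar> \<le> t) \<longrightarrow>
               norm v * \<tau> ^ (5 * card R) \<le> t))"
    proof (rule insert.IH)
      show "0 \<le> \<delta>'" using \<tau> \<delta>0 by (simp add: \<delta>'_def)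
      have "\<delta> \<le> \<tau> ^ 4 * q * \<tau>" using \<delta> by (simp add: mult_ac power_numeral_reduce)
      also have "\<dots> \<le> \<tau> ^ 4 * q * 1" using q \<tau> by (intro mult_left_mono) auto
      finally show "\<delta>' \<le> \<tau> ^ (5 * card R)"
        using \<tau> by (simp add: \<delta>'_def q_def field_simps)
      show "u' i $ j = 0" "w' i $ j = 0" if "i \<in> I" "j \<notin> R" for i j
        using that u0 w0 h1R h2R e0 er
        by (cases "j = r"; simp add: u'_def w'_def a_def b_def)+
      show "norm (u' i) \<le> 1" if "i \<in> I" for i
      proof -
        have "(norm (u' i))\<^sup>2 \<le> (norm (u i))\<^sup>2"
          by (simp add: power2_norm_eq_inner inner')
        then show ?thesis using u1[OF that] by (smt (verit) norm_ge_zero power2_le_imp_le)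
      qed
      show "\<bar>u' i \<bullet> u' j - w' i \<bullet> w' j\<bar> \<le> \<delta>'" if ij: "i \<in> I" "j \<in> I" for i j
      proof -
        have "\<bar>u' i \<bullet> u' j - w' i \<bullet> w' j\<bar>
            = \<bar>(u i \<bullet> u j - w i \<bullet> w j) - (a i * (a j - b j) + (a i - b i) * b j)\<bar>"
          by (simp add: inner' algebra_simps)
        also have "\<dots> \<le> \<delta> + (\<bar>a i\<bar> * \<bar>a j - b j\<bar> + \<bar>a i - b i\<bar> * \<bar>b j\<bar>)"
          using gram[OF ij] unfolding abs_mult [symmetric] by linarith
        also have "\<dots> \<le> \<delta> + (1 * (48 * \<delta> / \<tau>\<^sup>2) + 48 * \<delta> / \<tau>\<^sup>2 * 2)"
          using ab ab1 ij \<delta>0 \<tau> by (intro add_mono mult_mono) auto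
        also have "\<dots> = (\<delta> / \<tau> ^ 4) * (\<tau> ^ 4 + 144 * \<tau> ^ 2)"
          using \<tau> by (simp add: field_simps power_numeral_reduce)
        also have "\<dots> \<le> (\<delta> / \<tau> ^ 4) * 1"
        proof (rule mult_left_mono)
          have "\<tau> ^ 2 \<le> (1/16)^2" "\<tau> ^ 4 \<le> (1/16)^4"
            using \<tau> by (intro power_mono; simp)+
          then show "\<tau> ^ 4 + 144 * \<tau> ^ 2 \<le> 1" by (simp add: power_numeral_reduce)
        qed (use \<delta>0 \<tau> in auto)
        finally show ?thesis by (simp add: \<delta>'_def)
      qed
    qed
    have det12: "det (matrix h1) = 1 \<or> det (matrix h1) = -1" "det (matrix h2) = 1 \<or> det (matrix h2) = -1"
      using orthogonal_transformation_matrix_det(2) h1(1) h2(1) by auto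
    \<comment> \<open>The inductive map \<open>f\<close> preserves coordinate \<open>r\<close> and
      hence fixes \<open>e\<close>, so only the difference of the pivot coordinates is added to its
      error. The reflection \<open>h2\<close> is its own inverse and carries the result back to the
      family \<open>w\<close>.\<close>
    have glue: "orthogonal_transformation (h2 \<circ> (f \<circ> h1))"
      "\<forall>x j. j \<notin> insert r R \<longrightarrow> (h2 \<circ> (f \<circ> h1)) x $ j = x $ j"
      "det (matrix (h2 \<circ> (f \<circ> h1))) = det (matrix h2) * det (matrix f) * det (matrix h1)"
      "i \<in> I \<Longrightarrow> norm (w i - (h2 \<circ> (f \<circ> h1)) (u i)) \<le> 48 * \<delta> / \<tau>\<^sup>2 + norm (w' i - f (u' i))"
      if f: "orthogonal_transformation f" "\<forall>x j. j \<notin> R \<longrightarrow> f x $ j = x $ j" for f i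
    proof -
      show "orthogonal_transformation (h2 \<circ> (f \<circ> h1))"
        using f h1(1) h2(1) by (intro orthogonal_transformation_compose) auto
      show "\<forall>x j. j \<notin> insert r R \<longrightarrow> (h2 \<circ> (f \<circ> h1)) x $ j = x $ j"
        using f(2) h1R h2R by simp
      show "det (matrix (h2 \<circ> (f \<circ> h1))) = det (matrix h2) * det (matrix f) * det (matrix h1)"
        using f(1) h1(1) h2(1)
        by (simp add: matrix_det_compose linear_compose orthogonal_transformation_linear)
      assume i: "i \<in> I"
      have "f e = e"
        unfolding e_def using f insert.hyps by (intro orthogonal_transformation_fixes_axis) auto
      then have fe: "f (h1 (u i)) = a i *\<^sub>R e + f (u' i)"
        using f(1) by (simp add: u'_def orthogonal_transformation_def linear_diff linear_scale)
      have "norm (w i - h2 (f (h1 (u i)))) = norm (h2 (w i - h2 (f (h1 (u i)))))"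
        by (simp add: n2)
      also have "h2 (w i - h2 (f (h1 (u i)))) = h2 (w i) - f (h1 (u i))"
        using h2(1,3) by (simp add: orthogonal_transformation_def linear_diff)
      also have "\<dots> = (b i - a i) *\<^sub>R e + (w' i - f (u' i))"
        by (simp add: fe w'_def algebra_simps)
      also have "norm \<dots> \<le> \<bar>a i - b i\<bar> + norm (w' i - f (u' i))"
        using norm_triangle_ineq[of "(b i - a i) *\<^sub>R e"] by (simp add: ne abs_minus_commute)
      also have "\<dots> \<le> 48 * \<delta> / \<tau>\<^sup>2 + norm (w' i - f (u' i))" using ab[OF i] by simp
      finally show "norm (w i - (h2 \<circ> (f \<circ> h1)) (u i)) \<le> 48 * \<delta> / \<tau>\<^sup>2 + norm (w' i - f (u' i))"
        by simp
    qed
    show ?thesis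
      using IH
    proof (elim disjE exE conjE)
      assume A: "\<forall>s\<in>{1,-1}. \<exists>f. orthogonal_transformation f \<and> (\<forall>x j. j \<notin> R \<longrightarrow> f x $ j = x $ j) \<and>
            det (matrix f) = s \<and> (\<forall>i\<in>I. norm (w' i - f (u' i)) \<le> card R * \<tau>)"
      have "\<exists>f. orthogonal_transformation f \<and> (\<forall>x j. j \<notin> insert r R \<longrightarrow> f x $ j = x $ j) \<and>
            det (matrix f) = s \<and> (\<forall>i\<in>I. norm (w i - f (u i)) \<le> card (insert r R) * \<tau>)"
        if "s \<in> {1, -1}" for s :: real
      proof -
        \<comment> \<open>The two reflections may change the determinant, so the inductive
          alternative is invoked with the sign that compensates for them.\<close>
        have "s * det (matrix h1) * det (matrix h2) \<in> {1, -1}" using that det12 by auto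
        then obtain f where f: "orthogonal_transformation f" "\<forall>x j. j \<notin> R \<longrightarrow> f x $ j = x $ j"
          "det (matrix f) = s * det (matrix h1) * det (matrix h2)"
          "\<forall>i\<in>I. norm (w' i - f (u' i)) \<le> card R * \<tau>"
          using A by meson
        have "det (matrix (h2 \<circ> (f \<circ> h1))) = s"
          using glue(3)[OF f(1,2)] f(3) det12 by auto
        moreover have "norm (w i - (h2 \<circ> (f \<circ> h1)) (u i)) \<le> card (insert r R) * \<tau>" if "i \<in> I" for i
        proof -
          have "48 * \<delta> \<le> 48 * \<tau> ^ 5" using \<delta>5 by simp
          also have "\<dots> = (48 * \<tau> ^ 3) * \<tau> ^ 2" by (simp add: power_numeral_reduce)
          also have "\<dots> \<le> (48 * \<tau> ^ 2 * \<tau>) * \<tau> ^ 2" by (simp add: power_numeral_reduce)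
          also have "\<dots> \<le> (1 * \<tau>) * \<tau> ^ 2"
            using \<tau> power_mono[of \<tau> "1/16" 2] by (intro mult_right_mono) (auto simp: power2_eq_square)
          finally have "48 * \<delta> / \<tau>\<^sup>2 \<le> \<tau>" using \<tau> by (simp add: divide_le_eq)
          moreover have "norm (w' i - f (u' i)) \<le> card R * \<tau>" using f(4) that by blast
          ultimately show ?thesis
            using glue(4)[OF f(1,2) that] insert.hyps by (simp add: algebra_simps)
        qed
        ultimately show ?thesis using glue(1,2)[OF f(1,2)] by blast
      qed
      then show ?thesis by blast
    next
      fix f J
      assume f: "orthogonal_transformation f" "\<forall>x j. j \<notin> R \<longrightarrow> f x $ j = x $ j"
        "\<forall>i\<in>I. norm (w' i - f (u' i)) \<le> \<delta>' / \<tau> ^ (5 * card R)"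
        and J: "J \<subseteq> I" "finite J" "card J \<le> card R"
        and low: "\<forall>v t. (\<forall>j. j \<notin> R \<longrightarrow> v $ j = 0) \<longrightarrow> 0 \<le> t \<longrightarrow> (\<forall>i\<in>J. \<bar>v \<bullet> u' i\<bar> \<le> t) \<longrightarrow>
               norm v * \<tau> ^ (5 * card R) \<le> t"
      have "norm (w i - (h2 \<circ> (f \<circ> h1)) (u i)) \<le> \<delta> / \<tau> ^ (5 * card (insert r R))" if "i \<in> I" for i
      proof -
        have "norm (w i - (h2 \<circ> (f \<circ> h1)) (u i)) \<le> 48 * \<delta> / \<tau>\<^sup>2 + \<delta>' / q"
          using glue(4)[OF f(1,2) that] f(3) that by (fastforce simp: q_def)
        also have "\<dots> = (\<delta> / (\<tau> ^ 5 * q)) * (48 * \<tau> ^ 3 * q + \<tau>)"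
          using \<tau> q by (simp add: \<delta>'_def field_simps power_numeral_reduce)
        also have "\<dots> \<le> (\<delta> / (\<tau> ^ 5 * q)) * 1"
        proof (rule mult_left_mono)
          have "48 * \<tau> ^ 3 * q \<le> 48 * \<tau> ^ 3 * 1"
            using q \<tau> by (intro mult_left_mono) auto
          then show "48 * \<tau> ^ 3 * q + \<tau> \<le> 1" using small48 \<tau> by linarith
        qed (use \<delta>0 \<tau> q in auto)
        finally show ?thesis by (simp add: cardR)
      qed
      \<comment> \<open>The pivot is longer than \<tau>/4, so its product with v bounds the
        component of \<open>h1 v\<close> along the axis by 4t/\<tau>. Subtracting this component
        enlarges the products with the other pivots by at most the same amount, and the induction
        hypothesis handles the rest.\<close>
      moreover have "norm v * \<tau> ^ (5 * card (insert r R)) \<le> t"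
        if v: "\<forall>j. j \<notin> insert r R \<longrightarrow> v $ j = 0" and t0: "0 \<le> t" and le: "\<forall>i\<in>insert k J. \<bar>v \<bullet> u i\<bar> \<le> t"
        for v t
      proof -
        define \<alpha> where "\<alpha> = h1 v $ r"
        define v' where "v' = h1 v - \<alpha> *\<^sub>R e"
        have "\<rho> * \<bar>\<alpha>\<bar> = \<bar>h1 v \<bullet> h1 (u k)\<bar>"
          by (simp add: h1(2) xe \<alpha>_def abs_mult \<rho>_def)
        also have "\<dots> \<le> t" using le by (simp add: ih1)
        finally have "\<tau> / 4 * \<bar>\<alpha>\<bar> \<le> t"
          using k(2) mult_right_mono[of "\<tau> / 4" \<rho> "\<bar>\<alpha>\<bar>"] by (simp add: \<rho>_def)
        then have \<alpha>: "\<bar>\<alpha>\<bar> \<le> 4 * t / \<tau>" using \<tau> by (simp add: field_simps)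
        have "\<bar>v' \<bullet> u' i\<bar> \<le> t + 4 * t / \<tau>" if "i \<in> J" for i
        proof -
          have "v' \<bullet> u' i = v \<bullet> u i - \<alpha> * a i"
            by (simp add: v'_def u'_def inner_diff_left inner_diff_right xe er ih1 \<alpha>_def a_def)
          also have "\<bar>\<dots>\<bar> \<le> \<bar>v \<bullet> u i\<bar> + \<bar>\<alpha>\<bar> * \<bar>a i\<bar>"
            using abs_triangle_ineq4[of "v \<bullet> u i" "\<alpha> * a i"] by (simp add: abs_mult)
          also have "\<dots> \<le> t + 4 * t / \<tau> * 1"
            using le that \<alpha> ab1(1)[of i] J(1) t0 \<tau> by (intro add_mono mult_mono) auto
          finally show ?thesis by simp
        qed
        moreover have "\<forall>j. j \<notin> R \<longrightarrow> v' $ j = 0"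
        proof (intro allI impI)
          fix j assume "j \<notin> R"
          then show "v' $ j = 0"
            using v h1R[of j v] e0[of j] er by (cases "j = r") (simp_all add: v'_def \<alpha>_def)
        qed
        ultimately have v': "norm v' * q \<le> t + 4 * t / \<tau>"
          using low t0 \<tau> by (simp add: q_def)
        have "norm v = norm (\<alpha> *\<^sub>R e + v')" by (simp add: v'_def n1)
        also have "\<dots> \<le> \<bar>\<alpha>\<bar> + norm v'"
          using norm_triangle_ineq[of "\<alpha> *\<^sub>R e" v'] by (simp add: ne)
        finally have "norm v * q \<le> (\<bar>\<alpha>\<bar> + norm v') * q" using q by (intro mult_right_mono) auto
        also have "\<dots> \<le> \<bar>\<alpha>\<bar> * 1 + norm v' * q"
          unfolding distrib_right using q by (intro add_mono mult_left_mono) auto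
        also have "\<dots> \<le> 4 * t / \<tau> + (t + 4 * t / \<tau>)" using \<alpha> v' by simp
        finally have "norm v * q * \<tau> ^ 5 \<le> (4 * t / \<tau> + (t + 4 * t / \<tau>)) * \<tau> ^ 5"
          using \<tau> by (intro mult_right_mono) auto
        also have "\<dots> = t * (8 * \<tau> ^ 4 + \<tau> ^ 5)"
          using \<tau> by (simp add: field_simps power_numeral_reduce)
        also have "\<dots> \<le> t * 1"
        proof (rule mult_left_mono)
          have "\<tau> ^ 4 \<le> (1/16)^4" "\<tau> ^ 5 \<le> (1/16)^5"
            using \<tau> by (intro power_mono; simp)+
          then show "8 * \<tau> ^ 4 + \<tau> ^ 5 \<le> 1" by (simp add: power_numeral_reduce)
        qed (use t0 in auto)
        finally show ?thesis unfolding cardR by (simp add: mult_ac)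
      qed
      moreover have "card (insert k J) \<le> card (insert r R)"
        using J insert.hyps by (simp add: card_insert_if)
      ultimately show ?thesis
        using glue(1,2)[OF f(1,2)] J k(1)
        by (intro disjI2 exI[of _ "h2 \<circ> (f \<circ> h1)"] exI[of _ "insert k J"] conjI) blast+
    qed
  qed
qed

section \<open>Approximation of near isometries by proper motions\<close>

text \<open>The simplex contains a cube, whose volume is computed without reference to
  determinants (the formula for the volume of a simplex in the library requires an
  ordered index type).\<close>
lemma simplex_vol_ge:
  fixes z :: "nat \<Rightarrow> real^'n" and u :: "'n \<Rightarrow> real^'n"
  assumes z: "z ` {0..CARD('n)} = insert x0 (range (\<lambda>l. x0 + d *\<^sub>R u l))"
    and d: "d > 0" and \<sigma>: "\<sigma> > 0"
    and low: "\<And>v t. 0 \<le> t \<Longrightarrow> (\<And>l. \<bar>v \<bullet> u l\<bar> \<le> t) \<Longrightarrow> norm v * \<sigma> \<le> t"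
  shows "simplex_vol z \<ge> (d * \<sigma> / (real CARD('n))\<^sup>2) ^ CARD('n)"
proof -
  define D where "D = real CARD('n)"
  have D: "D > 0" "D \<ge> 1" by (auto simp: D_def Suc_leI)
  define U where "U = (\<chi> l. u l)"
  have Uv: "(U *v v) $ l = v \<bullet> u l" for v l
    by (simp add: U_def matrix_vector_mult_def inner_vec_def mult.commute)
  have Uinj: "norm v * \<sigma> \<le> norm (U *v v)" for v
    by (rule low) (auto simp flip: Uv intro: component_le_norm_cart)
  have "invertible U"
    unfolding invertible_left_inverse matrix_left_invertible_ker
  proof safe
    fix v assume "U *v v = 0"
    then show "v = 0" using Uinj[of v] \<sigma> by (simp add: mult_le_0_iff)
  qed
  then obtain U' where U': "U ** U' = mat 1" "U' ** U = mat 1"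
    by (auto simp: invertible_def)
  \<comment> \<open>Duality: \<open>low\<close> bounds the inverse of \<open>U\<close>, hence the
    inverse of its transpose, and the latter computes the coefficients of h with respect to the
    vectors \<open>u l\<close>.\<close>
  have solve: "\<exists>s. h = (\<Sum>l\<in>UNIV. s $ l *\<^sub>R u l) \<and> norm s \<le> norm h / \<sigma>" for h
  proof -
    define s where "s = transpose U' *v h"
    define x where "x = U' *v s"
    have "transpose U *v s = h"
      unfolding s_def matrix_vector_mul_assoc matrix_transpose_mul [symmetric] U'
      by (simp add: transpose_mat)
    moreover have "transpose U *v s = (\<Sum>l\<in>UNIV. s $ l *\<^sub>R u l)"
      unfolding U_def
      by (simp add: vec_eq_iff matrix_vector_mult_def transpose_def sum_component mult.commute)
    ultimately have h: "h = (\<Sum>l\<in>UNIV. s $ l *\<^sub>R u l)" by simp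
    have Ux: "U *v x = s" by (simp add: x_def matrix_vector_mul_assoc U')
    have "(norm s)\<^sup>2 = (\<Sum>l\<in>UNIV. s $ l * (x \<bullet> u l))"
      unfolding power2_norm_eq_inner by (subst (2) Ux [symmetric]) (simp add: inner_vec_def Uv)
    also have "\<dots> = h \<bullet> x"
      by (simp add: h inner_sum_left inner_sum_right inner_commute)
    also have "\<dots> \<le> norm h * norm x" by (rule norm_cauchy_schwarz)
    also have "\<dots> \<le> norm h * (norm s / \<sigma>)"
      using Uinj[of x] \<sigma> by (intro mult_left_mono) (auto simp: Ux field_simps)
    finally have "norm s * norm s \<le> (norm h / \<sigma>) * norm s" by (simp add: power2_eq_square)
    then have "norm s \<le> norm h / \<sigma>"
      using \<sigma> mult_right_le_imp_le[of "norm s" "norm s" "norm h / \<sigma>"] by (cases "s = 0") auto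
    then show ?thesis using h by blast
  qed
  define \<rho> where "\<rho> = d * \<sigma> / (2 * D\<^sup>2)"
  have \<rho>: "\<rho> > 0" using d \<sigma> D by (simp add: \<rho>_def)
  \<comment> \<open>The centre of the cube has weight 1/2 at \<open>x0\<close> and 1/(2D) at every
    other vertex. On the cube each of the latter weights changes by at most 1/(2D), so all weights
    remain nonnegative.\<close>
  define y0 where "y0 = x0 + d *\<^sub>R (\<Sum>l\<in>UNIV. (1 / (2 * D)) *\<^sub>R u l)"
  define one :: "real^'n" where "one = (\<chi> i. \<rho>)"
  let ?H = "convex hull (z ` {0..CARD('n)})"
  have "cbox (y0 - one) (y0 + one) \<subseteq> ?H"
  proof
    fix y assume y: "y \<in> cbox (y0 - one) (y0 + one)"
    define h where "h = (1/d) *\<^sub>R (y - y0)"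
    have "\<bar>(y - y0) $ i\<bar> \<le> \<rho>" for i
      using y by (auto simp: mem_box_cart one_def abs_le_iff algebra_simps)
    then have "norm (y - y0) \<le> (\<Sum>i::'n\<in>UNIV. \<rho>)"
      by (intro order_trans[OF norm_le_l1_cart] sum_mono)
    then have "norm (y - y0) \<le> D * \<rho>" by (simp add: D_def)
    then have hn: "norm h / \<sigma> \<le> 1 / (2 * D)"
    proof -
      have "norm h = norm (y - y0) / d" using d by (simp add: h_def)
      also have "\<dots> \<le> D * \<rho> / d" using \<open>norm (y - y0) \<le> D * \<rho>\<close> d by (intro divide_right_mono) auto
      finally have "norm h / \<sigma> \<le> D * \<rho> / d / \<sigma>" using \<sigma> by (intro divide_right_mono) auto
      then show ?thesis using d \<sigma> D by (simp add: \<rho>_def field_simps power2_eq_square)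
    qed
    obtain s where s: "h = (\<Sum>l\<in>UNIV. s $ l *\<^sub>R u l)" "norm s \<le> norm h / \<sigma>"
      using solve by blast
    have sl: "\<bar>s $ l\<bar> \<le> 1 / (2 * D)" for l
      using component_le_norm_cart[of s l] s(2) hn by linarith
    define c where "c l = 1 / (2 * D) + s $ l" for l
    have c: "0 \<le> c l" "c l \<le> 1 / D" for l
      using sl[of l] D by (auto simp: c_def abs_le_iff field_simps)
    have "(\<Sum>l\<in>UNIV. c l) \<le> (\<Sum>l::'n\<in>UNIV. 1 / D)" by (intro sum_mono c)
    then have c1: "(\<Sum>l\<in>UNIV. c l) \<le> 1" using D by (simp add: D_def)
    have "y = y0 + d *\<^sub>R h" using d by (simp add: h_def)
    also have "\<dots> = x0 + d *\<^sub>R (\<Sum>l\<in>UNIV. c l *\<^sub>R u l)"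
      by (simp add: y0_def s(1) c_def scaleR_add_left sum.distrib scaleR_add_right)
    also have "\<dots> = (1 - (\<Sum>l\<in>UNIV. c l)) *\<^sub>R x0 + (\<Sum>l\<in>UNIV. c l *\<^sub>R (x0 + d *\<^sub>R u l))"
      by (simp add: scaleR_add_right sum.distrib scaleR_sum_left scaleR_sum_right algebra_simps)
    also have "\<dots> \<in> ?H"
    proof -
      have "(\<Sum>l\<in>UNIV. c l *\<^sub>R (x0 + d *\<^sub>R u l)) + (1 - (\<Sum>l\<in>UNIV. c l)) *\<^sub>R x0
          = (\<Sum>l\<in>insert None (range Some). (case l of None \<Rightarrow> 1 - (\<Sum>l\<in>UNIV. c l) | Some l \<Rightarrow> c l) *\<^sub>R
               (case l of None \<Rightarrow> x0 | Some l \<Rightarrow> x0 + d *\<^sub>R u l))"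
        by (subst sum.insert) (auto simp: sum.reindex)
      also have "\<dots> \<in> ?H"
      proof (rule convex_sum)
        show "(\<Sum>l\<in>insert None (range Some). case l of None \<Rightarrow> 1 - (\<Sum>l\<in>UNIV. c l) | Some l \<Rightarrow> c l) = 1"
          by (subst sum.insert) (auto simp: sum.reindex)
        show "(case l of None \<Rightarrow> x0 | Some l \<Rightarrow> x0 + d *\<^sub>R u l) \<in> ?H" for l
          unfolding z by (cases l) (auto intro: hull_inc)
      qed (use c c1 in \<open>auto split: option.split\<close>)
      finally show ?thesis by (simp add: add.commute)
    qed
    finally show "y \<in> ?H" .
  qed
  moreover have "compact ?H" by (intro finite_imp_compact_convex_hull) auto
  ultimately have "measure lebesgue (cbox (y0 - one) (y0 + one)) \<le> simplex_vol z"
    unfolding simplex_vol_def by (intro measure_mono_fmeasurable lmeasurable_compact) auto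
  moreover have "measure lebesgue (cbox (y0 - one) (y0 + one)) = (2 * \<rho>) ^ CARD('n)"
    using \<rho> by (simp add: content_cbox_cart one_def interval_ne_empty_cart measure_completion)
  moreover have "2 * \<rho> = d * \<sigma> / D\<^sup>2" using D by (simp add: \<rho>_def)
  ultimately show ?thesis by (simp add: D_def)
qed

text \<open>The hypothesis \<open>low\<close> tests a vector against the \<open>u l\<close>, whereas
  closeness is known for the images of the \<open>u l\<close>. Passing to the transpose of
  \<open>M\<close> moves the estimate to the tested side: it shows that this transpose is closer
  than 1 to the identity.\<close>

lemma det_nearby_orthogonal:
  fixes L T :: "real^'n^'n" and u :: "'n \<Rightarrow> real^'n"
  assumes T: "orthogonal_matrix T" and "0 \<le> e" "e < \<sigma>"
    and low: "\<And>v t. 0 \<le> t \<Longrightarrow> (\<And>l. \<bar>v \<bullet> u l\<bar> \<le> t) \<Longrightarrow> norm v * \<sigma> \<le> t"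
    and close: "\<And>l. norm (L *v u l - T *v u l) \<le> e"
  shows "det T * det L > 0"
proof -
  define M where "M = transpose T ** L"
  have "det (transpose M) > 0"
  proof (rule det_pos_near_id)
    fix y :: "real^'n" assume y: "y \<noteq> 0"
    have "\<bar>(transpose M *v y - y) \<bullet> u l\<bar> \<le> norm y * e" for l
    proof -
      have "(transpose M *v y - y) \<bullet> u l = y \<bullet> (M *v u l - u l)"
        by (simp add: inner_diff_left inner_diff_right dot_lmul_matrix)
      also have "M *v u l - u l = transpose T *v (L *v u l - T *v u l)"
        using T by (simp add: M_def matrix_vector_mult_diff_distrib matrix_vector_mul_assoc
            orthogonal_matrix del: transpose_matrix_vector)
      also have "\<bar>y \<bullet> \<dots>\<bar> \<le> norm y * norm (transpose T *v (L *v u l - T *v u l))"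
        by (rule Cauchy_Schwarz_ineq2)
      also have "norm (transpose T *v (L *v u l - T *v u l)) = norm (L *v u l - T *v u l)"
        using T by (intro orthogonal_transformation_norm)
          (simp only: orthogonal_transformation_matrix matrix_of_matrix_vector_mul
             matrix_vector_mul_linear orthogonal_matrix_transpose)
      also have "norm y * \<dots> \<le> norm y * e" by (intro mult_left_mono close) auto
      finally show ?thesis .
    qed
    then have "norm (transpose M *v y - y) * \<sigma> \<le> norm y * e"
      using \<open>0 \<le> e\<close> by (intro low) auto
    also have "\<dots> < norm y * \<sigma>" using y assms by simp
    finally show "norm (transpose M *v y - y) < norm y"
      using assms by (simp add: mult_less_cancel_right)
  qed
  then show ?thesis by (simp add: M_def det_mul)
qed

text \<open>Polarization: the inner product is half of a combination of three squared lengths. Each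
  of these is off by at most 3\<delta>, so the total error is at most 4.5\<delta>.\<close>

lemma near_isometry_gram:
  fixes p q p' q' :: "'a::real_inner"
  assumes "0 \<le> \<delta>" "\<delta> \<le> 1"
    and "norm p \<le> 1" "norm q \<le> 1" "norm (p - q) \<le> 1"
    and "inverse (1 + \<delta>) * norm p \<le> norm p'" "norm p' \<le> (1 + \<delta>) * norm p"
    and "inverse (1 + \<delta>) * norm q \<le> norm q'" "norm q' \<le> (1 + \<delta>) * norm q"
    and "inverse (1 + \<delta>) * norm (p - q) \<le> norm (p' - q')" "norm (p' - q') \<le> (1 + \<delta>) * norm (p - q)"
  shows "\<bar>p \<bullet> q - p' \<bullet> q'\<bar> \<le> 5 * \<delta>"
proof -
  have sq: "\<bar>y\<^sup>2 - x\<^sup>2\<bar> \<le> 3 * \<delta>"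
    if "0 \<le> x" "x \<le> 1" "inverse (1 + \<delta>) * x \<le> y" "y \<le> (1 + \<delta>) * x" for x y :: real
  proof -
    have xy: "x \<le> (1 + \<delta>) * y" using that(3) assms(1) by (simp add: field_simps)
    have "0 \<le> inverse (1 + \<delta>) * x" using that(1) assms(1) by simp
    then have y0: "0 \<le> y" using that(3) by linarith
    have "y\<^sup>2 \<le> ((1 + \<delta>) * x)\<^sup>2" "x\<^sup>2 \<le> ((1 + \<delta>) * y)\<^sup>2"
      using that xy y0 by (auto intro: power_mono)
    moreover have "\<delta> * \<delta> \<le> \<delta>" "x\<^sup>2 \<le> 1"
      using assms(1,2) that by (auto simp: mult_left_le power_le_one)
    ultimately have 1: "y\<^sup>2 \<le> x\<^sup>2 + (2 * \<delta> + \<delta> * \<delta>) * x\<^sup>2" "x\<^sup>2 \<le> y\<^sup>2 + (2 * \<delta> + \<delta> * \<delta>) * y\<^sup>2"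
      by (simp_all add: power_mult_distrib algebra_simps power2_eq_square)
    have 2: "(2 * \<delta> + \<delta> * \<delta>) * w \<le> 3 * \<delta>" if "0 \<le> w" "w \<le> 1" for w
    proof -
      have "(2 * \<delta> + \<delta> * \<delta>) * w \<le> (3 * \<delta>) * 1"
        using that \<open>\<delta> * \<delta> \<le> \<delta>\<close> assms(1) by (intro mult_mono) auto
      then show ?thesis by simp
    qed
    show ?thesis
    proof (cases "y\<^sup>2 \<le> x\<^sup>2")
      case True
      then have "y\<^sup>2 \<le> 1" using \<open>x\<^sup>2 \<le> 1\<close> by linarith
      then show ?thesis using True 1(2) 2[of "y\<^sup>2"] by simp
    next
      case False
      then show ?thesis using 1(1) 2[of "x\<^sup>2"] \<open>x\<^sup>2 \<le> 1\<close> by simp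
    qed
  qed
  have pol: "2 * (p \<bullet> q) = (norm p)\<^sup>2 + (norm q)\<^sup>2 - (norm (p - q))\<^sup>2" for p q :: 'a
    by (simp add: power2_norm_eq_inner algebra_simps inner_commute)
  have "\<bar>2 * (p \<bullet> q) - 2 * (p' \<bullet> q')\<bar> \<le> 9 * \<delta>"
    unfolding pol using sq[of "norm p" "norm p'"] sq[of "norm q" "norm q'"]
      sq[of "norm (p - q)" "norm (p' - q')"] assms by (simp add: abs_le_iff)
  then show ?thesis using assms(1) by linarith
qed

text \<open>Elements may be repeated, so a set of at most D pivots can be indexed by coordinates
  without first showing that it has exactly D elements.\<close>

lemma ex_fun_onto_index:
  fixes J :: "'a set"
  assumes "finite J" "J \<noteq> {}" "card J \<le> CARD('n::finite)"
  obtains g :: "'n::finite \<Rightarrow> 'a" where "range g = J"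
proof -
  obtain A :: "'n set" where A: "card A = card J"
    using assms(3) by (metis obtain_subset_with_card_n)
  then obtain h where h: "bij_betw h A J"
    using assms(1) finite_same_card_bij by (metis finite_code)
  obtain j where j: "j \<in> J" using assms(2) by blast
  have "range (\<lambda>x. if x \<in> A then h x else j) = J"
    using h j by (auto simp: bij_betw_def split: if_splits)
  then show ?thesis using that by blast
qed

text \<open>After scaling to diameter 1, the Gram--Schmidt dichotomy applies to the difference
  vectors from one point of \<open>E\<close>. If both determinants are available, 1 is chosen.
  Otherwise the pivots span a fat simplex, and on it the interpolating affine map is so close to the
  approximating motion that both have the same orientation; the absence of a negative block then
  makes the motion proper.\<close>

lemma near_isometry_close_to_proper_motion:
  fixes E :: "(real^'n) set" and \<phi> :: "real^'n \<Rightarrow> real^'n"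
  defines "D \<equiv> CARD('n)"
  assumes bE: "bounded E" and d: "diameter E > 0"
    and \<tau>: "0 < \<tau>" "\<tau> \<le> 1/16" "real D ^ 2 * \<tau> \<le> 1"
    and \<delta>: "0 \<le> \<delta>" "\<delta> \<le> \<tau> ^ (10 * D + 2)" and \<eta>: "0 < \<eta>" "\<eta> \<le> \<tau> ^ (10 * D + 2)"
    and iso: "\<And>x y. x \<in> E \<Longrightarrow> y \<in> E \<Longrightarrow> inverse (1 + \<delta>) * dist x y \<le> dist (\<phi> x) (\<phi> y)
                \<and> dist (\<phi> x) (\<phi> y) \<le> (1 + \<delta>) * dist x y"
    and noblock: "\<not> (\<exists>z. neg_block \<eta> E \<phi> z)"
  obtains T :: "real^'n^'n" and b where "orthogonal_matrix T" "det T = 1"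
    "\<And>x. x \<in> E \<Longrightarrow> norm (\<phi> x - (T *v x + b)) \<le> D * \<tau> * diameter E"
proof -
  note main = that
  define d where "d = diameter E"
  have d0: "d > 0" using assms by (simp add: d_def)
  have "E \<noteq> {}" using d0 by (auto simp: d_def)
  then obtain x0 where x0: "x0 \<in> E" by blast
  define u where "u x = (1/d) *\<^sub>R (x - x0)" for x
  define w where "w x = (1/d) *\<^sub>R (\<phi> x - \<phi> x0)" for x
  have ux: "x = x0 + d *\<^sub>R u x" and wx: "\<phi> x = \<phi> x0 + d *\<^sub>R w x" for x
    using d0 by (auto simp: u_def w_def)
  have nu: "norm (u x - u y) = dist x y / d" "norm (w x - w y) = dist (\<phi> x) (\<phi> y) / d" for x y
    using d0 by (simp_all add: u_def w_def dist_norm flip: scaleR_diff_right)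
  have u00: "u x0 = 0" "w x0 = 0" by (auto simp: u_def w_def)
  have u1: "norm (u x - u y) \<le> 1" if "x \<in> E" "y \<in> E" for x y
    using diameter_bounded_bound[OF bE that] d0 by (simp add: nu d_def)
  have u1': "norm (u x) \<le> 1" if "x \<in> E" for x
    using u1[OF that x0] by (simp add: u00)
  define q where "q = \<tau> ^ (5 * D)"
  have q: "0 < q" "q \<le> 1" using \<tau> by (auto simp: q_def power_le_one)
  \<comment> \<open>One factor \<open>q\<close> is lost in the accuracy \<delta>/q of the motion;
    the other is the independence constant of the pivots, which this accuracy has to beat. The
    factor \<tau>^2 absorbs the 5 from the Gram error and the D^2 from the volume.\<close>
  have q2: "\<tau> ^ (10 * D + 2) = q * q * \<tau>\<^sup>2"
    by (simp add: q_def power_add power_mult_distrib flip: power_add mult_2)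
  have \<tau>2: "5 * \<tau>\<^sup>2 < 1" using \<tau> power_mono[of \<tau> "1/16" 2] by (simp add: power2_eq_square)
  have \<delta>q: "5 * \<delta> < q * q"
  proof -
    have "5 * \<delta> \<le> (q * q) * (5 * \<tau>\<^sup>2)" using \<delta>(2) unfolding q2 by (simp add: mult_ac)
    also have "\<dots> < (q * q) * 1" using \<tau>2 q by (intro mult_strict_left_mono) auto
    finally show ?thesis by simp
  qed
  have qq: "q * q \<le> q" using q by (simp add: mult_left_le)
  have \<delta>1: "\<delta> \<le> 1" using \<delta>q qq q \<delta>(1) by linarith
  have gram: "\<bar>u x \<bullet> u y - w x \<bullet> w y\<bar> \<le> 5 * \<delta>" if xy: "x \<in> E" "y \<in> E" for x y
  proof -
    have iso': "inverse (1 + \<delta>) * norm (u x - u y) \<le> norm (w x - w y) \<and>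
        norm (w x - w y) \<le> (1 + \<delta>) * norm (u x - u y)" if "x \<in> E" "y \<in> E" for x y
      unfolding nu using iso[OF that] d0
        divide_right_mono[of "inverse (1 + \<delta>) * dist x y" "dist (\<phi> x) (\<phi> y)" d]
        divide_right_mono[of "dist (\<phi> x) (\<phi> y)" "(1 + \<delta>) * dist x y" d]
      by simp
    show ?thesis
      using near_isometry_gram[OF \<delta>(1) \<delta>1, of "u x" "u y" "w x" "w y"]
        u1[OF xy] u1' iso'[OF xy] iso'[OF xy(1) x0] iso'[OF xy(2) x0] xy by (simp add: u00)
  qed
  have fin: thesis if f: "orthogonal_transformation f" "det (matrix f) = 1"
      and cl: "\<And>x. x \<in> E \<Longrightarrow> norm (w x - f (u x)) \<le> D * \<tau>" for f
  proof (rule main)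
    show "orthogonal_matrix (matrix f)" using orthogonal_transformation_matrix_det(1)[OF f(1)] .
    show "det (matrix f) = 1" by fact
    fix x assume x: "x \<in> E"
    have "matrix f *v x = f x0 + d *\<^sub>R f (u x)"
      using f(1) by (subst ux) (simp add: orthogonal_transformation_def linear_add linear_scale matrix_works)
    then have "\<phi> x - (matrix f *v x + (\<phi> x0 - f x0)) = d *\<^sub>R (w x - f (u x))"
      by (simp add: wx[of x] scaleR_diff_right)
    then have "norm (\<phi> x - (matrix f *v x + (\<phi> x0 - f x0))) = d * norm (w x - f (u x))"
      using d0 by simp
    also have "\<dots> \<le> d * (D * \<tau>)" using cl[OF x] d0 by (intro mult_left_mono) auto
    finally show "norm (\<phi> x - (matrix f *v x + (\<phi> x0 - f x0))) \<le> D * \<tau> * diameter E"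
      by (simp add: d_def mult_ac)
  qed
  have "5 * \<delta> \<le> \<tau> ^ (5 * card (UNIV :: 'n set))"
    using \<delta>q qq by (simp add: q_def D_def)
  then consider
    (both) "\<forall>s\<in>{1,-1}. \<exists>f. orthogonal_transformation f \<and>
            det (matrix f) = s \<and> (\<forall>x\<in>E. norm (w x - f (u x)) \<le> D * \<tau>)"
  | (block) f J where "orthogonal_transformation f" "\<forall>x\<in>E. norm (w x - f (u x)) \<le> 5 * \<delta> / q"
            "J \<subseteq> E" "finite J" "card J \<le> D"
            "\<And>v t. 0 \<le> t \<Longrightarrow> (\<forall>x\<in>J. \<bar>v \<bullet> u x\<bar> \<le> t) \<Longrightarrow> norm v * q \<le> t"
    using almost_gram_equal_imp_close[of UNIV \<tau> "5 * \<delta>" E u w] \<tau> \<delta>(1) u1' gram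
    unfolding q_def D_def by auto
  then show thesis
  proof cases
    case both
    then show thesis using fin by blast
  next
    case (block f J)
    define T where "T = matrix f"
    have T: "orthogonal_matrix T" "det T = 1 \<or> det T = -1" "f x = T *v x" for x
      using orthogonal_transformation_matrix_det[OF block(1)] by (auto simp: T_def)
    have "J \<noteq> {}"
      using block(6)[of 0 "axis undefined 1"] q by auto
    then obtain g :: "'n \<Rightarrow> real^'n" where g: "range g = J"
      by (rule ex_fun_onto_index[OF block(4) _ block(5)[unfolded D_def]])
    have gE: "g l \<in> E" for l using g block(3) by auto
    have low: "norm v * q \<le> t" if "0 \<le> t" "\<And>l. \<bar>v \<bullet> u (g l)\<bar> \<le> t" for v t
      using block(6) that g by auto
    have e: "5 * \<delta> / q < q" using \<delta>q q by (simp add: divide_less_eq)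
    define U where "U = (\<chi> l. u (g l))"
    have Uv: "(U *v v) $ l = v \<bullet> u (g l)" for v l
      by (simp add: U_def matrix_vector_mult_def inner_vec_def mult.commute)
    have "invertible U"
      unfolding invertible_left_inverse matrix_left_invertible_ker
    proof safe
      fix v assume "U *v v = 0"
      then have "v \<bullet> u (g l) = 0" for l using Uv[of v l] by simp
      then show "v = 0" using low[of 0 v] q by (simp add: mult_le_0_iff)
    qed
    then obtain U' where U': "U' ** U = mat 1" "U ** U' = mat 1"
      by (auto simp: invertible_def)
    \<comment> \<open>This is the linear part of the affine map that interpolates \<phi> at
      \<open>x0\<close> and the points \<open>g l\<close>; the scaling by 1/d is common to
      \<open>u\<close> and \<open>w\<close> and cancels.\<close>
    define L where "L = transpose (\<chi> l. w (g l)) ** transpose U'"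
    have Lu: "L *v u (g l) = w (g l)" for l
    proof -
      have "u (g l) = transpose U *v axis l 1"
        by (simp add: matrix_vector_mult_basis U_def column_def transpose_def vec_eq_iff
            del: transpose_matrix_vector)
      then have "L *v u (g l) = (transpose (\<chi> l. w (g l)) ** (transpose U' ** transpose U)) *v axis l 1"
        by (simp add: L_def matrix_vector_mul_assoc matrix_mul_assoc del: transpose_matrix_vector)
      also have "\<dots> = transpose (\<chi> l. w (g l)) *v axis l 1"
        by (simp add: U' transpose_mat flip: matrix_transpose_mul del: transpose_matrix_vector)
      also have "\<dots> = w (g l)"
        by (simp add: matrix_vector_mult_basis column_def transpose_def vec_eq_iff
            del: transpose_matrix_vector)
      finally show ?thesis .
    qed
    have "det T * det L > 0"
    proof (rule det_nearby_orthogonal[OF T(1) _ e, where u = "\<lambda>l. u (g l)"])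
      show "norm (L *v u (g l) - T *v u (g l)) \<le> 5 * \<delta> / q" for l
        using block(2) gE[of l] by (simp add: Lu T(3) [symmetric])
    qed (use low \<delta>(1) q in auto)
    \<comment> \<open>Otherwise \<open>x0\<close> and the points \<open>g l\<close> form a negative
      block: their simplex has volume at least (dq/D^2)^D, and \<eta> \<le> q/D^2.\<close>
    moreover have "\<not> det L < 0"
    proof
      assume L: "det L < 0"
      obtain h where h: "bij_betw h {1..CARD('n)} (UNIV :: 'n set)"
        using finite_same_card_bij[of "{1..CARD('n)}" "UNIV :: 'n set"] by auto
      define z where "z m = (if m = 0 then x0 else g (h m))" for m
      have "z ` {0..CARD('n)} = insert x0 (z ` {1..CARD('n)})"
        by (simp add: z_def atLeast0AtMost flip: atLeastSucAtMost_greaterThanAtMost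
            image_insert) (auto simp: z_def image_iff)
      also have "z ` {1..CARD('n)} = g ` (h ` {1..CARD('n)})" by (force simp: z_def)
      also have "\<dots> = range (\<lambda>l. x0 + d *\<^sub>R u (g l))"
        using h unfolding bij_betw_def by (simp flip: ux)
      finally have zi: "z ` {0..CARD('n)} = insert x0 (range (\<lambda>l. x0 + d *\<^sub>R u (g l)))" .
      then have zE: "z ` {0..CARD('n)} \<subseteq> E" using x0 gE by (simp add: ux [symmetric]) auto
      have vol: "simplex_vol z \<ge> (d * q / (real D)\<^sup>2) ^ D"
        unfolding D_def by (rule simplex_vol_ge[OF zi d0 q(1) low])
      have D0: "real D > 0" by (simp add: D_def)
      have "\<eta> \<le> q * (q * \<tau>\<^sup>2)" using \<eta>(2) unfolding q2 by (simp add: mult_ac)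
      also have "\<dots> \<le> q * (1 * \<tau>)"
        using q \<tau> by (intro mult_left_mono mult_mono) (auto simp: power2_eq_square mult_left_le)
      also have "\<dots> \<le> q * (1 / (real D)\<^sup>2)"
        using \<tau>(3) D0 q by (intro mult_left_mono) (auto simp: field_simps)
      finally have \<eta>q: "\<eta> \<le> q / (real D)\<^sup>2" by simp
      have "\<eta> ^ D * diameter (z ` {0..CARD('n)}) ^ D \<le> \<eta> ^ D * d ^ D"
        unfolding d_def using \<eta> bE zE
        by (intro mult_left_mono power_mono diameter_subset diameter_ge_0)
           (auto intro: bounded_subset)
      also have "\<dots> \<le> (q / (real D)\<^sup>2) ^ D * d ^ D"
        using \<eta>q \<eta> d0 by (intro mult_right_mono power_mono) auto
      also have "\<dots> = (d * q / (real D)\<^sup>2) ^ D" by (simp add: mult_ac flip: power_mult_distrib)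
      finally have "simplex_vol z \<ge> \<eta> ^ D * diameter (z ` {0..CARD('n)}) ^ D" using vol by simp
      moreover have "0 < (d * q / (real D)\<^sup>2) ^ D" using d0 q D0 by simp
      then have "simplex_vol z > 0" using vol by linarith
      moreover have "L *v z m + (\<phi> x0 - L *v x0) = \<phi> (z m)" for m
      proof (cases "m = 0")
        case False
        then have "\<phi> (z m) = \<phi> x0 + d *\<^sub>R (L *v u (z m))"
          by (simp add: z_def Lu wx [symmetric])
        also have "d *\<^sub>R (L *v u (z m)) = L *v (d *\<^sub>R u (z m))" by (simp add: matrix_vector_mult_scaleR)
        also have "d *\<^sub>R u (z m) = z m - x0" using ux[of "z m"] by (simp add: algebra_simps)
        finally show ?thesis by (simp add: matrix_vector_mult_diff_distrib)
      qed (simp add: z_def)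
      ultimately have "neg_block \<eta> E \<phi> z"
        unfolding neg_block_def
        by (intro conjI exI[of _ L] exI[of _ "\<phi> x0 - L *v x0"])
          (use L zE in \<open>auto simp: D_def\<close>)
      then show False using noblock by blast
    qed
    ultimately have "det T = 1" using T(2) by auto
    moreover have "5 * \<delta> / q \<le> real D * \<tau>"
    proof -
      have "5 * \<delta> \<le> q * (q * (5 * \<tau> * \<tau>))" using \<delta>(2) unfolding q2 by (simp add: mult_ac power2_eq_square)
      also have "\<dots> \<le> q * (1 * (1 * \<tau>))"
        using q \<tau> by (intro mult_left_mono mult_mono) auto
      finally have "5 * \<delta> / q \<le> 1 * \<tau>" using q by (simp add: field_simps)
      also have "\<dots> \<le> real D * \<tau>" using \<tau> by (intro mult_right_mono) (auto simp: D_def Suc_leI)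
      finally show ?thesis .
    qed
    ultimately show thesis
      using block(1,2) unfolding T_def by (intro fin[of f]) fastforce+
  qed
qed

section \<open>Slides and slow twists\<close>

lemma has_derivative_max_0_square:
  "((\<lambda>t::real. (max 0 t)\<^sup>2) has_real_derivative 2 * max 0 t) (at t)"
proof -
  consider "t > 0" | "t < 0" | "t = 0" by linarith
  then show ?thesis
  proof cases
    case 1
    have "((\<lambda>t::real. t\<^sup>2) has_real_derivative 2 * max 0 t) (at t)"
      using 1 by (auto intro!: derivative_eq_intros)
    then show ?thesis
      by (rule has_field_derivative_transform_within_open[of _ _ _ "{0<..}"]) (use 1 in auto)
  next
    case 2
    have "((\<lambda>t::real. 0) has_real_derivative 2 * max 0 t) (at t)"
      using 2 by simp
    then show ?thesis
      by (rule has_field_derivative_transform_within_open[of _ _ _ "{..<0}"]) (use 2 in auto)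
  next
    case 3
    have "((\<lambda>h::real. max 0 h) \<longlongrightarrow> max 0 0) (at 0)"
      by (intro tendsto_intros)
    moreover have "(max 0 h)\<^sup>2 / h = max 0 h" if "h \<noteq> 0" for h :: real
      using that by (simp add: max_def power2_eq_square)
    ultimately have "((\<lambda>h::real. (max 0 h)\<^sup>2 / h) \<longlongrightarrow> 0) (at 0)"
      by (simp cong: LIM_cong)
    then show ?thesis by (simp add: 3 DERIV_def)
  qed
qed

text \<open>A quadratic spline that rises from 0 to 1 on the unit interval; C1 is all the smoothness
  that \<open>diffeo\<close> asks for. Its derivative is a tent with peak 2 at 1/2.\<close>

definition step :: "real \<Rightarrow> real" where
  "step t = 2 * ((max 0 t)\<^sup>2 - 2 * (max 0 (t - 1/2))\<^sup>2 + (max 0 (t - 1))\<^sup>2)"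

definition step' :: "real \<Rightarrow> real" where
  "step' t = 4 * (max 0 t - 2 * max 0 (t - 1/2) + max 0 (t - 1))"

lemma has_derivative_step: "(step has_real_derivative step' t) (at t)"
proof -
  have "((\<lambda>t. (max 0 (t - c))\<^sup>2) has_real_derivative 2 * max 0 (t - c)) (at t)" for c
  proof -
    have "((\<lambda>t. t - c) has_real_derivative 1) (at t)"
      by (auto intro!: derivative_eq_intros)
    from DERIV_chain2[OF has_derivative_max_0_square this] show ?thesis by simp
  qed
  note this [derivative_intros] has_derivative_max_0_square [derivative_intros]
  show ?thesis unfolding step_def step'_def by (auto intro!: derivative_eq_intros)
qed

lemma step_simps: "t \<le> 0 \<Longrightarrow> step t = 0" "1 \<le> t \<Longrightarrow> step t = 1"
  by (auto simp: step_def max_def power2_eq_square algebra_simps)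

lemma step'_zero: "t \<le> 0 \<or> 1 \<le> t \<Longrightarrow> step' t = 0"
  by (auto simp: step'_def max_def)

lemma step'_bound: "\<bar>step' t\<bar> \<le> 2"
  by (auto simp: step'_def max_def)

lemma continuous_on_step' [continuous_intros]:
  "continuous_on S f \<Longrightarrow> continuous_on S (\<lambda>x. step' (f x))"
  unfolding step'_def by (intro continuous_intros)

lemma has_derivative_step_compose:
  assumes "(g has_derivative G) (at x)"
  shows "((\<lambda>x. step (g x)) has_derivative (\<lambda>v. step' (g x) * G v)) (at x)"
  using has_derivative_compose[OF assms, of step "(*) (step' (g x))"] has_derivative_step[of "g x"]
  by (simp add: has_field_derivative_def)

text \<open>The step function is applied to ((|x - p|/s)^2 - 1)/3, which runs from 0 at radius s to
  1 at radius 2s. The squared distance keeps the centre differentiable; the gradient is at most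
  8/(3s), rounded up to 3/s.\<close>

lemma bump_exists:
  fixes p :: "real^'n"
  assumes s: "s > 0"
  obtains \<beta> G where "\<And>x. (\<beta> has_derivative G x) (at x)" "\<And>v. continuous_on UNIV (\<lambda>x. G x v)"
    "\<And>x v. \<bar>G x v\<bar> \<le> 3 / s * norm v"
    "\<And>x. dist x p \<le> s \<Longrightarrow> \<beta> x = 1" "\<And>x. 2 * s \<le> dist x p \<Longrightarrow> \<beta> x = (0::real)"
proof -
  define c where "c = 1 / (3 * s\<^sup>2)"
  define g where "g x = c * ((x - p) \<bullet> (x - p)) - 1/3" for x
  define G where "G x v = - (step' (g x) * (c * (2 * ((x - p) \<bullet> v))))" for x v
  have g: "g x = ((dist x p / s)\<^sup>2 - 1) / 3" for x
    by (simp add: g_def c_def dist_norm power2_norm_eq_inner power_divide diff_divide_distrib)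
  show thesis
  proof (rule that[of "\<lambda>x. 1 - step (g x)" G])
    show "((\<lambda>x. 1 - step (g x)) has_derivative G x) (at x)" for x
    proof -
      have "(g has_derivative (\<lambda>v. c * (2 * ((x - p) \<bullet> v)))) (at x)"
        unfolding g_def by (auto intro!: derivative_eq_intros simp: inner_commute)
      from has_derivative_step_compose[OF this] show ?thesis
        unfolding G_def by (auto intro!: derivative_eq_intros)
    qed
    show "continuous_on UNIV (\<lambda>x. G x v)" for v
      unfolding G_def g_def by (intro continuous_intros)
    show "\<bar>G x v\<bar> \<le> 3 / s * norm v" for x v
    proof (cases "dist x p \<le> 2 * s")
      case True
      have "\<bar>G x v\<bar> = \<bar>step' (g x)\<bar> * (2 * \<bar>(x - p) \<bullet> v\<bar> / (3 * s\<^sup>2))"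
        by (simp add: G_def abs_mult c_def)
      also have "\<dots> \<le> 2 * (2 * (2 * s * norm v) / (3 * s\<^sup>2))"
      proof (intro mult_mono divide_right_mono step'_bound)
        have "\<bar>(x - p) \<bullet> v\<bar> \<le> norm (x - p) * norm v" by (rule Cauchy_Schwarz_ineq2)
        also have "\<dots> \<le> 2 * s * norm v"
          using True by (intro mult_right_mono) (auto simp: dist_norm)
        finally show "\<bar>(x - p) \<bullet> v\<bar> \<le> 2 * s * norm v" .
      qed auto
      also have "\<dots> = (8/3) / s * norm v"
        using s by (simp add: power2_eq_square field_simps)
      also have "\<dots> \<le> 3 / s * norm v"
        using s by (intro mult_right_mono divide_right_mono) auto
      finally show ?thesis .
    next
      case False
      then have "2\<^sup>2 \<le> (dist x p / s)\<^sup>2" using s by (intro power_mono) (auto simp: field_simps)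
      then have "step' (g x) = 0" by (intro step'_zero) (simp add: g)
      then show ?thesis using s by (simp add: G_def)
    qed
    show "1 - step (g x) = 1" if "dist x p \<le> s" for x
    proof -
      have "(dist x p / s)\<^sup>2 \<le> 1\<^sup>2" using s that by (intro power_mono) auto
      then show ?thesis by (simp add: g step_simps)
    qed
    show "1 - step (g x) = 0" if "2 * s \<le> dist x p" for x
    proof -
      have "2\<^sup>2 \<le> (dist x p / s)\<^sup>2" using s that by (intro power_mono) (auto simp: field_simps)
      then show ?thesis by (simp add: g step_simps)
    qed
  qed
qed

lemma slide_outwards:
  fixes p b :: "real^'n"
  assumes "s > 0" "0 \<le> \<epsilon>" "\<epsilon> \<le> 1/2" "3 / s * norm b \<le> \<epsilon>"
  obtains S where "quasi_isometry (1 + 2 * \<epsilon>) S" "\<And>x. dist x p \<le> s \<Longrightarrow> S x = x"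
    "\<And>x. 2 * s \<le> dist x p \<Longrightarrow> S x = x + b"
proof -
  obtain \<beta> G where \<beta>: "\<And>x. (\<beta> has_derivative G x) (at x)" "\<And>v. continuous_on UNIV (\<lambda>x. G x v)"
    "\<And>x v. \<bar>G x v\<bar> \<le> 3 / s * norm v"
    "\<And>x. dist x p \<le> s \<Longrightarrow> \<beta> x = 1" "\<And>x. 2 * s \<le> dist x p \<Longrightarrow> \<beta> x = (0::real)"
    using bump_exists[OF assms(1)] by metis
  have "quasi_isometry (1 + 2 * \<epsilon>) (\<lambda>x. x + (1 - \<beta> x) *\<^sub>R b)"
  proof (rule quasi_isometry_perturbation)
    show "((\<lambda>x. (1 - \<beta> x) *\<^sub>R b) has_derivative (\<lambda>v. (- G x v) *\<^sub>R b)) (at x)" for x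
      by (auto intro!: derivative_eq_intros \<beta>)
    show "continuous_on UNIV (\<lambda>x. (- G x v) *\<^sub>R b)" for v
      by (intro continuous_intros \<beta>)
    show "norm ((- G x v) *\<^sub>R b) \<le> \<epsilon> * norm v" for x v
    proof -
      have "norm ((- G x v) *\<^sub>R b) \<le> 3 / s * norm v * norm b"
        using mult_right_mono[OF \<beta>(3)[of x v] norm_ge_zero[of b]] by simp
      also have "\<dots> \<le> \<epsilon> * norm v"
        using mult_right_mono[OF assms(4), of "norm v"] by (simp add: mult_ac)
      finally show ?thesis .
    qed
  qed (use assms in auto)
  then show thesis
    by (rule that) (use \<beta>(4,5) in auto)
qed

text \<open>The gradients of the bumps are simply added up, so the distortion estimate holds for any
  position of the centres; separation enters only when the values of \<open>S\<close> near a cluster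
  are computed.\<close>

lemma slide_clusters:
  fixes p v :: "'q \<Rightarrow> real^'n"
  assumes "finite Q" "s > 0" "0 \<le> \<epsilon>" "\<epsilon> \<le> 1/2" "(\<Sum>q\<in>Q. 3 / s * norm (v q)) \<le> \<epsilon>"
  obtains S where "quasi_isometry (1 + 2 * \<epsilon>) S"
    "\<And>x. (\<And>q. q \<in> Q \<Longrightarrow> 2 * s \<le> dist x (p q)) \<Longrightarrow> S x = x"
    "\<And>q x. q \<in> Q \<Longrightarrow> dist x (p q) \<le> s \<Longrightarrow>
        (\<And>q'. q' \<in> Q \<Longrightarrow> q' \<noteq> q \<Longrightarrow> 2 * s \<le> dist x (p q')) \<Longrightarrow> S x = x + v q"
proof -
  have "\<exists>\<beta> G. (\<forall>x. (\<beta> has_derivative G x) (at x)) \<and> (\<forall>v. continuous_on UNIV (\<lambda>x. G x v)) \<and>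
    (\<forall>x v. \<bar>G x v\<bar> \<le> 3 / s * norm v) \<and>
    (\<forall>x. dist x (p q) \<le> s \<longrightarrow> \<beta> x = 1) \<and> (\<forall>x. 2 * s \<le> dist x (p q) \<longrightarrow> \<beta> x = (0::real))" for q
    using bump_exists[OF assms(2), of "p q"] by metis
  then obtain \<beta> G where \<beta>: "\<And>q x. (\<beta> q has_derivative G q x) (at x)"
    "\<And>q v. continuous_on UNIV (\<lambda>x. G q x v)"
    "\<And>q x v. \<bar>G q x v\<bar> \<le> 3 / s * norm v"
    "\<And>q x. dist x (p q) \<le> s \<Longrightarrow> \<beta> q x = 1" "\<And>q x. 2 * s \<le> dist x (p q) \<Longrightarrow> \<beta> q x = (0::real)"
    by metis
  define S where "S x = x + (\<Sum>q\<in>Q. \<beta> q x *\<^sub>R v q)" for x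
  have "quasi_isometry (1 + 2 * \<epsilon>) S"
    unfolding S_def
  proof (rule quasi_isometry_perturbation)
    show "((\<lambda>x. \<Sum>q\<in>Q. \<beta> q x *\<^sub>R v q) has_derivative (\<lambda>h. \<Sum>q\<in>Q. G q x h *\<^sub>R v q)) (at x)" for x
      by (auto intro!: derivative_eq_intros \<beta>)
    show "continuous_on UNIV (\<lambda>x. \<Sum>q\<in>Q. G q x h *\<^sub>R v q)" for h
      by (intro continuous_intros \<beta>)
    show "norm (\<Sum>q\<in>Q. G q x h *\<^sub>R v q) \<le> \<epsilon> * norm h" for x h
    proof -
      have "norm (\<Sum>q\<in>Q. G q x h *\<^sub>R v q) \<le> (\<Sum>q\<in>Q. 3 / s * norm h * norm (v q))"
        by (intro sum_norm_le) (use mult_right_mono[OF \<beta>(3) norm_ge_zero] in simp)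
      also have "\<dots> = (\<Sum>q\<in>Q. 3 / s * norm (v q)) * norm h"
        unfolding sum_distrib_right by (intro sum.cong) (auto simp: mult_ac)
      also have "\<dots> \<le> \<epsilon> * norm h" by (intro mult_right_mono assms) auto
      finally show ?thesis .
    qed
  qed (use assms in auto)
  moreover have "S x = x" if "\<And>q. q \<in> Q \<Longrightarrow> 2 * s \<le> dist x (p q)" for x
    using that by (simp add: S_def \<beta>(5))
  moreover have "S x = x + v q" if "q \<in> Q" "dist x (p q) \<le> s"
        "\<And>q'. q' \<in> Q \<Longrightarrow> q' \<noteq> q \<Longrightarrow> 2 * s \<le> dist x (p q')" for q x
  proof -
    have "(\<Sum>q'\<in>Q. \<beta> q' x *\<^sub>R v q') = (\<Sum>q'\<in>Q. if q' = q then v q else 0)"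
      using that by (intro sum.cong) (auto simp: \<beta>(4,5))
    then show ?thesis using that(1) assms(1) by (simp add: S_def)
  qed
  ultimately show thesis by (rule that)
qed

section \<open>Rotations of planes and slow twists\<close>

definition plane_rotation :: "'a::real_inner \<Rightarrow> 'a \<Rightarrow> real \<Rightarrow> 'a \<Rightarrow> 'a" where
  "plane_rotation e w t x = x + (cos t - 1) *\<^sub>R ((x \<bullet> e) *\<^sub>R e + (x \<bullet> w) *\<^sub>R w)
     + sin t *\<^sub>R ((x \<bullet> e) *\<^sub>R w - (x \<bullet> w) *\<^sub>R e)"

lemma plane_rotation_inner:
  assumes "e \<bullet> e = 1" "w \<bullet> w = 1" "e \<bullet> w = 0"
  shows "plane_rotation e w t x \<bullet> e = cos t * (x \<bullet> e) - sin t * (x \<bullet> w)"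
    "plane_rotation e w t x \<bullet> w = sin t * (x \<bullet> e) + cos t * (x \<bullet> w)"
  using assms by (auto simp: plane_rotation_def inner_add_left inner_diff_left
      inner_commute[of w e] algebra_simps)

lemma plane_rotation_add:
  assumes "e \<bullet> e = 1" "w \<bullet> w = 1" "e \<bullet> w = 0"
  shows "plane_rotation e w s (plane_rotation e w t x) = plane_rotation e w (s + t) x"
  unfolding plane_rotation_def[of e w s] plane_rotation_inner[OF assms]
  by (simp add: plane_rotation_def cos_add sin_add algebra_simps)

lemma plane_rotation_0 [simp]: "plane_rotation e w 0 x = x"
  by (simp add: plane_rotation_def)

lemma orthogonal_plane_rotation:
  assumes "e \<bullet> e = 1" "w \<bullet> w = 1" "e \<bullet> w = 0"
  shows "orthogonal_transformation (plane_rotation e w t)"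
proof -
  have lin: "linear (plane_rotation e w s)" for s
    by (rule linearI) (auto simp: plane_rotation_def algebra_simps)
  have adj: "plane_rotation e w s x \<bullet> y = x \<bullet> plane_rotation e w (- s) y" for s x y
    by (simp add: plane_rotation_def algebra_simps inner_commute)
  have "plane_rotation e w t x \<bullet> plane_rotation e w t y = x \<bullet> y" for x y
    by (simp add: adj plane_rotation_add[OF assms])
  with lin show ?thesis by (simp add: orthogonal_transformation_def)
qed

text \<open>A rotation is the square of the rotation by half the angle, and the determinant of the
  latter is 1 or -1.\<close>

lemma det_plane_rotation:
  fixes e w :: "real^'n"
  assumes "e \<bullet> e = 1" "w \<bullet> w = 1" "e \<bullet> w = 0"
  shows "det (matrix (plane_rotation e w t)) = 1"
proof -
  note o = orthogonal_plane_rotation[OF assms]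
  have "plane_rotation e w t = plane_rotation e w (t/2) \<circ> plane_rotation e w (t/2)"
    by (simp add: fun_eq_iff plane_rotation_add[OF assms])
  then have "det (matrix (plane_rotation e w t)) = det (matrix (plane_rotation e w (t/2))) * det (matrix (plane_rotation e w (t/2)))"
    by (metis matrix_det_compose o orthogonal_transformation_linear)
  also have "\<dots> = 1"
    using orthogonal_transformation_matrix_det(2)[OF o, of "t/2"] by auto
  finally show ?thesis .
qed

text \<open>The rotation angle is a fixed function of \<open>ln |x| / l\<close>, so that its gradient is of order
  \<open>1 / (l |x|)\<close>. The junk value \<open>ln 0 = 0\<close> makes the profile vanish at the origin.\<close>
lemma log_profile:
  fixes a l :: real
  assumes "a > 0" "l > 0"
  obtains P :: "real^'n \<Rightarrow> real" and G where "\<And>x. (P has_derivative G x) (at x)"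
    "\<And>v. continuous_on UNIV (\<lambda>x. G x v)" "\<And>x v. \<bar>G x v\<bar> * norm x \<le> 2 / l * norm v"
    "\<And>x. norm x \<le> a \<Longrightarrow> P x = 0" "\<And>x. a * exp l \<le> norm x \<Longrightarrow> P x = 1"
    "\<And>x y. norm x = norm y \<Longrightarrow> P x = P y"
proof -
  define g where "g x = ln (x \<bullet> x / a\<^sup>2) / (2 * l)" for x :: "real^'n"
  define G where "G x v = step' (g x) * (2 * (x \<bullet> v) / (x \<bullet> x) / (2 * l))" for x v :: "real^'n"
  have g: "g x = (ln (norm x) - ln a) / l" if "x \<noteq> 0" for x
  proof -
    have "x \<bullet> x / a\<^sup>2 = (norm x / a)\<^sup>2" by (simp add: power2_norm_eq_inner power_divide)
    then have "ln (x \<bullet> x / a\<^sup>2) = 2 * (ln (norm x) - ln a)"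
      using that assms by (simp add: ln_realpow ln_div)
    then show ?thesis unfolding g_def by (simp only: nonzero_mult_divide_mult_cancel_left)
  qed
  have g_le: "g x \<le> 0" if "norm x \<le> a" for x
  proof (cases "x = 0")
    case True
    then show ?thesis by (simp add: g_def)
  next
    case False
    then show ?thesis using that assms by (simp add: g divide_nonpos_pos)
  qed
  have P0: "step (g x) = 0" if "norm x \<le> a" for x using g_le[OF that] by (rule step_simps)
  have G0: "G x v = 0" if "norm x \<le> a" for x v
    using step'_zero[of "g x"] g_le[OF that] by (simp add: G_def)
  have P_deriv: "((\<lambda>x. step (g x)) has_derivative G x) (at x)" for x
  proof (cases "x = 0")
    case True
    have "((\<lambda>x. 0) has_derivative G x) (at x)"
    proof -
      have "G x = (\<lambda>v. 0)" using G0[of x] assms True by (simp add: fun_eq_iff)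
      then show ?thesis by simp
    qed
    then show ?thesis
      by (rule has_derivative_transform_within_open[of _ _ _ _ "ball 0 a"])
        (use True assms P0 in auto)
  next
    case False
    have "x \<bullet> x > 0" using False by simp
    then have "(g has_derivative (\<lambda>v. 2 * (x \<bullet> v) / (x \<bullet> x) / (2 * l))) (at x)"
      unfolding g_def using assms
      by (auto intro!: derivative_eq_intros simp: inner_commute field_simps)
    from has_derivative_step_compose[OF this] show ?thesis unfolding G_def[abs_def] .
  qed
  have "continuous_on (- {0} \<union> ball 0 a) (\<lambda>x. G x v)" for v
  proof (rule continuous_on_open_Un)
    show "continuous_on (- {0}) (\<lambda>x. G x v)"
      unfolding G_def g_def using assms by (intro continuous_intros) auto
    show "continuous_on (ball 0 a) (\<lambda>x. G x v)"
      using G0 by (subst continuous_on_cong[OF refl, of _ _ "\<lambda>_. 0"]) auto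
  qed auto
  moreover have "- {0} \<union> ball 0 a = (UNIV :: (real^'n) set)" using assms by auto
  ultimately have G_cont: "continuous_on UNIV (\<lambda>x. G x v)" for v by simp
  have G_bound: "\<bar>G x v\<bar> * norm x \<le> 2 / l * norm v" for x v
  proof (cases "x = 0")
    case False
    have "\<bar>G x v\<bar> * norm x = \<bar>step' (g x)\<bar> * (\<bar>x \<bullet> v\<bar> / norm x / l)"
      using assms False by (simp add: G_def abs_mult power2_norm_eq_inner [symmetric] power2_eq_square)
    also have "\<dots> \<le> 2 * (norm x * norm v / norm x / l)"
      using assms by (intro mult_mono step'_bound divide_right_mono Cauchy_Schwarz_ineq2) auto
    finally show ?thesis using False by simp
  qed (use assms in simp)
  have P1: "step (g x) = 1" if "a * exp l \<le> norm x" for x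
  proof (rule step_simps)
    have x: "0 < norm x" using that assms by (smt (verit) exp_gt_zero mult_pos_pos)
    then have "ln (a * exp l) \<le> ln (norm x)" using that assms by (subst ln_le_cancel_iff) auto
    then have "ln a + l \<le> ln (norm x)" using assms by (simp add: ln_mult)
    then show "1 \<le> g x" using assms x by (simp add: g)
  qed
  show thesis
    by (rule that[of "\<lambda>x. step (g x)" G])
      (use P_deriv G_cont G_bound P0 P1 in \<open>auto simp: g_def norm_eq\<close>)
qed

text \<open>The derivative differs from a rotation only by \<theta> times the gradient of the
  profile times a vector of length at most |x|, hence by at most 7 * 2/l \<le> \<epsilon>; the 7 is
  an upper bound for 2 pi. The angle depends on the norm alone and rotations preserve the norm, so
  turning back by the same angle inverts the map.\<close>

lemma slow_plane_twist:
  fixes e w :: "real^'n"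
  assumes ew: "e \<bullet> e = 1" "w \<bullet> w = 1" "e \<bullet> w = 0" and \<theta>: "\<bar>\<theta>\<bar> \<le> 7"
    and "a > 0" and \<epsilon>: "0 < \<epsilon>" "\<epsilon> \<le> 1/2" and l: "14 / \<epsilon> \<le> l"
  obtains W where "quasi_isometry (1 + 2 * \<epsilon>) W" "\<And>x. norm (W x) = norm x"
    "\<And>x. norm x \<le> a \<Longrightarrow> W x = x" "\<And>x. a * exp l \<le> norm x \<Longrightarrow> W x = plane_rotation e w \<theta> x"
proof -
  have l0: "l > 0" using l \<epsilon> by (smt (verit) divide_pos_pos)
  obtain P :: "real^'n \<Rightarrow> real" and G where P: "\<And>x. (P has_derivative G x) (at x)"
    "\<And>v. continuous_on UNIV (\<lambda>x. G x v)" "\<And>x v. \<bar>G x v\<bar> * norm x \<le> 2 / l * norm v"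
    "\<And>x. norm x \<le> a \<Longrightarrow> P x = 0" "\<And>x. a * exp l \<le> norm x \<Longrightarrow> P x = 1"
    "\<And>x y. norm x = norm y \<Longrightarrow> P x = P y"
    by (rule log_profile[OF \<open>a > 0\<close> l0]) blast
  define rot where "rot = plane_rotation e w"
  have ot: "orthogonal_transformation (rot t)" for t
    unfolding rot_def by (rule orthogonal_plane_rotation[OF ew])
  have nr: "norm (rot t x) = norm x" for t x using ot by (rule orthogonal_transformation_norm)
  define W where "W x = rot (\<theta> * P x) x" for x
  \<comment> \<open>The derivative of the rotation with respect to its angle; geometrically, the
    projection of x to the plane turned by t plus a right angle.\<close>
  define K where "K t x = (- sin t) *\<^sub>R ((x \<bullet> e) *\<^sub>R e + (x \<bullet> w) *\<^sub>R w)
     + cos t *\<^sub>R ((x \<bullet> e) *\<^sub>R w - (x \<bullet> w) *\<^sub>R e)" for t x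
  define D where "D x v = rot (\<theta> * P x) v + (\<theta> * G x v) *\<^sub>R K (\<theta> * P x) x" for x v
  have nK: "norm (K t x) \<le> norm x" for t x
  proof -
    define \<alpha> \<beta> where "\<alpha> = x \<bullet> e" and "\<beta> = x \<bullet> w"
    have "((- S) *\<^sub>R (\<alpha> *\<^sub>R e + \<beta> *\<^sub>R w) + C *\<^sub>R (\<alpha> *\<^sub>R w - \<beta> *\<^sub>R e)) \<bullet>
        ((- S) *\<^sub>R (\<alpha> *\<^sub>R e + \<beta> *\<^sub>R w) + C *\<^sub>R (\<alpha> *\<^sub>R w - \<beta> *\<^sub>R e)) =
        (S\<^sup>2 + C\<^sup>2) * (\<alpha>\<^sup>2 + \<beta>\<^sup>2)" for S C :: real
      using ew
      by (simp add: inner_add_left inner_diff_left inner_add_right inner_diff_right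
          inner_commute[of w e] algebra_simps power2_eq_square)
    from this[of "sin t" "cos t"] have "K t x \<bullet> K t x = \<alpha>\<^sup>2 + \<beta>\<^sup>2"
      by (simp add: K_def \<alpha>_def \<beta>_def)
    moreover have "0 \<le> (x - \<alpha> *\<^sub>R e - \<beta> *\<^sub>R w) \<bullet> (x - \<alpha> *\<^sub>R e - \<beta> *\<^sub>R w)" by simp
    then have "\<alpha>\<^sup>2 + \<beta>\<^sup>2 \<le> x \<bullet> x"
      using ew by (simp add: inner_diff_left inner_diff_right inner_commute[of w e]
          inner_commute[of e x] inner_commute[of w x] \<alpha>_def [symmetric] \<beta>_def [symmetric]
          algebra_simps power2_eq_square)
    ultimately show ?thesis by (simp add: norm_le)
  qed
  have "quasi_isometry (1 + 2 * \<epsilon>) W"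
  proof (rule quasi_isometryI[where D = D and R = "\<lambda>x. rot (\<theta> * P x)"])
    have "rot (- \<theta> * P (W x)) (W x) = x" for x
      using P(6)[of "W x" x] nr by (simp add: W_def rot_def plane_rotation_add[OF ew])
    moreover have "W (rot (- \<theta> * P x) x) = x" for x
      using P(6)[of "rot (- \<theta> * P x) x" x] nr by (simp add: W_def rot_def plane_rotation_add[OF ew])
    ultimately show "bij W" by (intro o_bij[of "\<lambda>x. rot (- \<theta> * P x) x"]) (auto simp: fun_eq_iff)
    show "(W has_derivative D x) (at x)" for x
      unfolding W_def D_def rot_def plane_rotation_def K_def
      by (rule derivative_eq_intros P refl ext | simp add: algebra_simps)+
    show "continuous_on UNIV (\<lambda>x. D x v)" for v
    proof -
      have "continuous_on UNIV P"
        using P(1) by (meson continuous_at_imp_continuous_on has_derivative_continuous)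
      then show ?thesis
        unfolding D_def rot_def plane_rotation_def K_def by (intro continuous_intros P(2))
    qed
    show "det (matrix (rot (\<theta> * P x))) = 1" for x
      unfolding rot_def by (rule det_plane_rotation[OF ew])
    show "norm (D x v - rot (\<theta> * P x) v) \<le> \<epsilon> * norm v" for x v
    proof -
      have "norm (D x v - rot (\<theta> * P x) v) = \<bar>\<theta>\<bar> * (\<bar>G x v\<bar> * norm (K (\<theta> * P x) x))"
        by (simp add: D_def abs_mult)
      also have "\<dots> \<le> 7 * (\<bar>G x v\<bar> * norm x)"
        using \<theta> nK by (intro mult_mono) auto
      also have "\<dots> \<le> 7 * (2 / l * norm v)" by (intro mult_left_mono P) auto
      also have "\<dots> = 14 / l * norm v" by simp
      also have "\<dots> \<le> \<epsilon> * norm v"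
        using l l0 \<epsilon> by (intro mult_right_mono) (auto simp: field_simps)
      finally show ?thesis .
    qed
  qed (use \<epsilon> ot in auto)
  then show thesis
    using nr P(4,5) by (intro that[of W]) (auto simp: W_def rot_def)
qed

text \<open>The delicate case is T e = -e, where the plane of rotation is not determined. A second
  coordinate from \<open>R\<close> provides one; if there is none, T is the flip of a single axis,
  which det T = 1 excludes.\<close>

lemma rotate_axis_to:
  fixes T :: "real^'n \<Rightarrow> real^'n"
  assumes T: "orthogonal_transformation T" "det (matrix T) = 1"
    and fixR: "\<And>x i. i \<notin> insert r R \<Longrightarrow> T x $ i = x $ i" and "r \<notin> R"
  obtains w \<theta> where "\<bar>\<theta>\<bar> \<le> 7" "w \<bullet> w = 1" "axis r 1 \<bullet> w = 0" "\<And>i. i \<notin> insert r R \<Longrightarrow> w $ i = 0"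
    "plane_rotation (axis r 1) w \<theta> (axis r 1) = T (axis r 1)"
  | "T (axis r 1) = axis r 1"
proof -
  define e :: "real^'n" where "e = axis r 1"
  have ee: "e \<bullet> e = 1" by (simp add: e_def inner_axis)
  have xe: "x \<bullet> e = x $ r" "e \<bullet> x = x $ r" for x
    by (auto simp: e_def cart_eq_inner_axis inner_commute)
  define f where "f = T e"
  have iT: "T x \<bullet> T y = x \<bullet> y" for x y using T(1) by (simp add: orthogonal_transformation_def)
  have ff: "f \<bullet> f = 1" by (simp add: f_def iT ee)
  have f0: "f $ i = 0" if "i \<notin> insert r R" for i
    using that fixR[of i e] by (auto simp: f_def e_def axis_def)
  define \<alpha> where "\<alpha> = f $ r"
  define g where "g = f - \<alpha> *\<^sub>R e"
  have ge: "e \<bullet> g = 0" by (simp add: g_def inner_diff_right xe \<alpha>_def) (simp add: e_def)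
  have gg: "\<alpha>\<^sup>2 + (norm g)\<^sup>2 = 1"
  proof -
    have "g \<bullet> g = f \<bullet> f - 2 * \<alpha> * (f \<bullet> e) + \<alpha> * \<alpha> * (e \<bullet> e)"
      by (simp add: g_def inner_diff_left inner_diff_right inner_commute[of e f] algebra_simps)
    also have "\<dots> = 1 - \<alpha>\<^sup>2" using ff ee by (simp add: xe(1) \<alpha>_def power2_eq_square)
    finally show ?thesis by (simp add: power2_norm_eq_inner)
  qed
  have rot: "plane_rotation e w t e = cos t *\<^sub>R e + sin t *\<^sub>R w" if "e \<bullet> w = 0" for w t
    using that ee by (simp add: plane_rotation_def algebra_simps)
  show thesis
  proof (cases "g = 0")
    case False
    define w where "w = (1 / norm g) *\<^sub>R g"
    obtain \<theta> where \<theta>: "0 \<le> \<theta>" "\<theta> < 2 * pi" "\<alpha> = cos \<theta>" "norm g = sin \<theta>"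
      using sincos_total_2pi[OF gg] by blast
    have "2 * pi \<le> 7" using pi_approx by simp
    then have "\<bar>\<theta>\<bar> \<le> 7" using \<theta> by linarith
    moreover have "w \<bullet> w = 1" using False by (simp add: w_def flip: power2_norm_eq_inner power2_eq_square)
    moreover have "e \<bullet> w = 0" by (simp add: w_def ge)
    moreover have "w $ i = 0" if "i \<notin> insert r R" for i
      using that f0[OF that] by (simp add: w_def g_def e_def axis_def)
    moreover have "plane_rotation e w \<theta> e = f"
    proof -
      have "norm g *\<^sub>R w = g" using False by (simp add: w_def)
      then have "cos \<theta> *\<^sub>R e + sin \<theta> *\<^sub>R w = \<alpha> *\<^sub>R e + g" by (simp add: \<theta>(3,4))
      then show ?thesis by (simp add: rot[OF \<open>e \<bullet> w = 0\<close>]) (simp add: g_def)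
    qed
    ultimately show thesis using that(1) by (simp add: e_def f_def)
  next
    case True
    then have "\<alpha> = 1 \<or> \<alpha> = -1" using gg by (simp add: power2_eq_1_iff)
    then show thesis
    proof
      assume "\<alpha> = 1"
      then show thesis using True that(2) by (simp add: g_def f_def e_def)
    next
      assume "\<alpha> = -1"
      have "T e = \<alpha> *\<^sub>R e" using True by (simp add: g_def f_def)
      then have fe: "T e = - e" using \<open>\<alpha> = -1\<close> by simp
      show thesis
      proof (cases "R = {}")
        case Rempty: True
        have "T x $ i = flip_axis r x $ i" for x i
        proof (cases "i = r")
          case True
          have "- (T x $ r) = T x \<bullet> T e" by (simp add: fe xe)
          then show ?thesis using True by (simp add: iT xe flip_axis_def)
        qed (use fixR Rempty in \<open>auto simp: flip_axis_def\<close>)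
        then have "T = flip_axis r" by (simp add: fun_eq_iff vec_eq_iff)
        then show thesis using T(2) flip_axis(2)[of r] by simp
      next
        case False
        then obtain j where j: "j \<in> R" by blast
        define w :: "real^'n" where "w = axis j 1"
        have "j \<noteq> r" using j \<open>r \<notin> R\<close> by blast
        then have "w \<bullet> w = 1" "e \<bullet> w = 0" by (simp_all add: w_def e_def inner_axis_axis)
        moreover have "plane_rotation e w pi e = T e" by (simp add: rot[OF \<open>e \<bullet> w = 0\<close>] fe)
        moreover have "\<bar>pi\<bar> \<le> 7" using pi_approx by simp
        moreover have "w $ i = 0" if "i \<notin> insert r R" for i
          using that j by (auto simp: w_def axis_def)
        ultimately show thesis by (intro that(1)[of pi w]) (auto simp: e_def)
      qed
    qed
  qed
qed

text \<open>T is factored into plane rotations, one for each coordinate in \<open>R\<close> at most,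
  and each factor gets its own shell with radii of ratio exp l. The twist for the next factor starts
  where the previous ones are complete and is the identity further inside, so no two factors
  interact and \<open>card R\<close> counts shells as well as distortion factors.\<close>

lemma slow_twist:
  fixes T :: "real^'n \<Rightarrow> real^'n"
  assumes "finite R" and T: "orthogonal_transformation T" "det (matrix T) = 1"
    and fixR: "\<And>x i. i \<notin> R \<Longrightarrow> T x $ i = x $ i"
    and a: "a > 0" and \<epsilon>: "0 < \<epsilon>" "\<epsilon> \<le> 1/2" and l: "14 / \<epsilon> \<le> l"
  shows "\<exists>W. quasi_isometry ((1 + 2 * \<epsilon>) ^ card R) W \<and> (\<forall>x. norm (W x) = norm x) \<and>
    (\<forall>x. norm x \<le> a \<longrightarrow> W x = x) \<and> (\<forall>x. a * exp (l * card R) \<le> norm x \<longrightarrow> W x = T x)"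
  using assms(1) T fixR
proof (induction R arbitrary: T rule: finite_induct)
  case empty
  have "T x = x" for x using empty(3) by (simp add: vec_eq_iff)
  moreover have "quasi_isometry 1 (\<lambda>x::real^'n. x)"
    using quasi_isometry_motion[of "mat 1 :: real^'n^'n" 0] by (simp add: orthogonal_matrix_id)
  ultimately show ?case by (intro exI[of _ "\<lambda>x. x"]) auto
next
  case (insert r R)
  note T = insert.prems(1,2) and fixR = insert.prems(3)
  define e :: "real^'n" where "e = axis r 1"
  have ee: "e \<bullet> e = 1" by (simp add: e_def inner_axis)
  have l0: "l > 0" using l \<epsilon> by (smt (verit) divide_pos_pos)
  have card: "card (insert r R) = Suc (card R)" using insert.hyps by simp
  have fix_r: "T x $ r = x $ r" if "orthogonal_transformation T" "T e = e" for T :: "real^'n \<Rightarrow> real^'n" and x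
  proof -
    have "T x \<bullet> T e = x \<bullet> e" using that(1) by (simp add: orthogonal_transformation_def)
    then show ?thesis using that(2) by (simp add: e_def cart_eq_inner_axis)
  qed
  show ?case
  proof (rule rotate_axis_to[OF T fixR insert.hyps(2)])
    assume "T (axis r 1) = axis r 1"
    then have Te: "T e = e" by (simp add: e_def)
    have "T x $ i = x $ i" if "i \<notin> R" for x i
      using that fixR fix_r[OF T(1) Te] by (cases "i = r") auto
    then obtain W where W: "quasi_isometry ((1 + 2 * \<epsilon>) ^ card R) W" "\<forall>x. norm (W x) = norm x"
      "\<forall>x. norm x \<le> a \<longrightarrow> W x = x" "\<forall>x. a * exp (l * card R) \<le> norm x \<longrightarrow> W x = T x"
      using insert.IH[OF T] by blast
    have "quasi_isometry ((1 + 2 * \<epsilon>) ^ card (insert r R)) W"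
      using W(1) \<epsilon> by (rule_tac quasi_isometry_mono) (auto simp: card intro: power_increasing)
    moreover have "a * exp (l * card R) \<le> a * exp (l * card (insert r R))"
      using a l0 by (simp add: card)
    then have "\<forall>x. a * exp (l * card (insert r R)) \<le> norm x \<longrightarrow> W x = T x"
      using W(4) by (meson order_trans)
    ultimately show ?thesis using W(2,3) by blast
  next
    fix w \<theta>
    assume \<theta>: "\<bar>\<theta>\<bar> \<le> 7" and w: "w \<bullet> w = 1" "axis r 1 \<bullet> w = 0" "\<And>i. i \<notin> insert r R \<Longrightarrow> w $ i = 0"
      and rot: "plane_rotation (axis r 1) w \<theta> (axis r 1) = T (axis r 1)"
    have ew: "e \<bullet> e = 1" "w \<bullet> w = 1" "e \<bullet> w = 0" using w ee by (auto simp: e_def)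
    define T' where "T' = plane_rotation e w (- \<theta>) \<circ> T"
    have TT': "plane_rotation e w \<theta> (T' x) = T x" for x
      by (simp add: T'_def plane_rotation_add[OF ew])
    have oT': "orthogonal_transformation T'"
      unfolding T'_def using orthogonal_plane_rotation[OF ew] T(1)
      by (intro orthogonal_transformation_compose)
    have dT': "det (matrix T') = 1"
      unfolding T'_def using orthogonal_plane_rotation[OF ew] T det_plane_rotation[OF ew]
      by (simp add: matrix_det_compose orthogonal_transformation_linear)
    have "T' e = e"
      using rot [symmetric] by (simp add: T'_def e_def [symmetric] plane_rotation_add[OF ew])
    have "T' x $ i = x $ i" if "i \<notin> R" for x i
    proof (cases "i = r")
      case True
      then show ?thesis using fix_r[OF oT' \<open>T' e = e\<close>] by simp
    next
      case False
      then have "e $ i = 0" "w $ i = 0" using that w(3)[of i] by (auto simp: e_def axis_def)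
      then show ?thesis using fixR[of i x] that False by (simp add: T'_def plane_rotation_def)
    qed
    then obtain W where W: "quasi_isometry ((1 + 2 * \<epsilon>) ^ card R) W" "\<forall>x. norm (W x) = norm x"
      "\<forall>x. norm x \<le> a \<longrightarrow> W x = x" "\<forall>x. a * exp (l * card R) \<le> norm x \<longrightarrow> W x = T' x"
      using insert.IH[OF oT' dT'] by blast
    define a' where "a' = a * exp (l * card R)"
    have a': "a' > 0" "a \<le> a'" using a l0 by (auto simp: a'_def)
    obtain V where V: "quasi_isometry (1 + 2 * \<epsilon>) V" "\<And>x. norm (V x) = norm x"
      "\<And>x. norm x \<le> a' \<Longrightarrow> V x = x" "\<And>x. a' * exp l \<le> norm x \<Longrightarrow> V x = plane_rotation e w \<theta> x"
      using slow_plane_twist[OF ew \<theta> a'(1) \<epsilon> l] by metis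
    have a'l: "a * exp (l * card (insert r R)) = a' * exp l"
      by (simp add: a'_def card algebra_simps exp_add)
    have "quasi_isometry ((1 + 2 * \<epsilon>) ^ card (insert r R)) (V \<circ> W)"
      using quasi_isometry_compose[OF V(1) W(1)] \<epsilon> by (simp add: card)
    moreover have "(V \<circ> W) x = x" if "norm x \<le> a" for x
      using that W(3) V(3)[of x] a' by simp
    moreover have "(V \<circ> W) x = T x" if "a' * exp l \<le> norm x" for x
    proof -
      have "a' \<le> a' * exp l" using a' l0 by simp
      then have "a' \<le> norm x" using that by linarith
      then have "W x = T' x" using W(4) by (simp add: a'_def)
      moreover have "norm (T' x) = norm x" using orthogonal_transformation_norm[OF oT'] .
      ultimately show ?thesis using V(4)[of "T' x"] that TT' by simp
    qed
    ultimately show ?thesis unfolding a'l using W(2) V(2)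
      by (intro exI[of _ "V \<circ> W"] conjI) (auto simp del: o_apply, auto)
  qed auto
qed

section \<open>Clusters and the induction on the number of points\<close>

definition near_isometric :: "real \<Rightarrow> 'a::metric_space set \<Rightarrow> ('a \<Rightarrow> 'b::metric_space) \<Rightarrow> bool" where
  "near_isometric \<delta> E \<phi> \<longleftrightarrow> (\<forall>x\<in>E. \<forall>y\<in>E. inverse (1 + \<delta>) * dist x y \<le> dist (\<phi> x) (\<phi> y)
     \<and> dist (\<phi> x) (\<phi> y) \<le> (1 + \<delta>) * dist x y)"

lemma near_isometric_mono:
  assumes "near_isometric \<delta> E \<phi>" "0 \<le> \<delta>" "\<delta> \<le> \<delta>'"
  shows "near_isometric \<delta>' E \<phi>"
proof -
  have "inverse (1 + \<delta>') * t \<le> inverse (1 + \<delta>) * t" "(1 + \<delta>) * t \<le> (1 + \<delta>') * t" if "0 \<le> t" for t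
    using assms(2,3) that by (auto intro!: mult_right_mono le_imp_inverse_le)
  then show ?thesis
    using assms(1) unfolding near_isometric_def by (meson order_trans zero_le_dist)
qed

lemma neg_block_mono:
  fixes E :: "(real^'n) set"
  assumes "neg_block \<eta>' E \<phi> z" "0 \<le> \<eta>" "\<eta> \<le> \<eta>'"
  shows "neg_block \<eta> E \<phi> z"
proof -
  have "\<eta> ^ CARD('n) * diameter (z ` {0..CARD('n)}) ^ CARD('n)
      \<le> \<eta>' ^ CARD('n) * diameter (z ` {0..CARD('n)}) ^ CARD('n)"
    using assms diameter_ge_0[OF finite_imp_bounded[of "z ` {0..CARD('n)}"]]
    by (intro mult_right_mono power_mono zero_le_power) auto
  from order_trans[OF this] show ?thesis using assms(1) unfolding neg_block_def by blast
qed

text \<open>Undoing a proper motion multiplies the linear part of the interpolating map by a matrix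
  of determinant 1, so the sign of a block is unchanged. In this way the absence of negative blocks
  passes to the normalized map on a cluster.\<close>

lemma neg_block_motion:
  fixes T :: "real^'n^'n"
  assumes z: "neg_block \<eta> F (\<lambda>x. transpose T *v (\<phi> x - b) - v) z"
    and "F \<subseteq> E" and T: "orthogonal_matrix T" "det T = 1"
  shows "neg_block \<eta> E \<phi> z"
proof -
  obtain L :: "real^'n^'n" and a where L: "det L < 0"
    "\<And>i. i \<le> CARD('n) \<Longrightarrow> L *v z i + a = transpose T *v (\<phi> (z i) - b) - v"
    using z unfolding neg_block_def by blast
  have "(T ** L) *v z i + (T *v (a + v) + b) = \<phi> (z i)" if "i \<le> CARD('n)" for i
  proof -
    have "T *v (L *v z i + a + v) = T *v (transpose T *v (\<phi> (z i) - b))"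
      using L(2)[OF that] by simp
    also have "\<dots> = \<phi> (z i) - b"
      using T(1) by (simp only: orthogonal_matrix_def matrix_vector_mul_assoc matrix_vector_mul_lid)
    finally show ?thesis
      by (simp add: matrix_vector_right_distrib matrix_vector_mul_assoc algebra_simps)
  qed
  moreover have "det (T ** L) < 0" using L(1) T(2) by (simp add: det_mul)
  ultimately show ?thesis
    using z \<open>F \<subseteq> E\<close> unfolding neg_block_def by blast
qed

text \<open>Pigeonhole: if every one of the (card E)^2 + 1 open intervals between consecutive scales
  contained a distance, these distances would be distinct, but there are only (card E)^2
  pairs.\<close>

lemma finite_distances_gap:
  fixes E :: "'a::metric_space set" and r :: "nat \<Rightarrow> real"
  assumes "finite E" and dec: "\<And>i j. i \<le> j \<Longrightarrow> r j \<le> r i"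
  obtains j where "j \<le> (card E)\<^sup>2"
    "\<And>x y. x \<in> E \<Longrightarrow> y \<in> E \<Longrightarrow> dist x y \<le> r (Suc j) \<or> r j \<le> dist x y"
proof (rule ccontr)
  assume "\<not> thesis"
  then have "\<forall>j. \<exists>t. j \<le> (card E)\<^sup>2 \<longrightarrow>
      t \<in> (\<lambda>(x, y). dist x y) ` (E \<times> E) \<and> r (Suc j) < t \<and> t < r j"
    using that by (fastforce simp: image_iff not_le)
  then obtain t where t: "\<And>j. j \<le> (card E)\<^sup>2 \<Longrightarrow> t j \<in> (\<lambda>(x, y). dist x y) ` (E \<times> E)"
    "\<And>j. j \<le> (card E)\<^sup>2 \<Longrightarrow> r (Suc j) < t j" "\<And>j. j \<le> (card E)\<^sup>2 \<Longrightarrow> t j < r j"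
    by metis
  have "t j < t i" if "i < j" "j \<le> (card E)\<^sup>2" for i j
    using t(2)[of i] t(3)[of j] dec[of "Suc i" j] that by simp
  then have "inj_on t {..(card E)\<^sup>2}"
    by (intro linorder_inj_onI) (auto simp: less_imp_neq[THEN not_sym])
  then have "Suc ((card E)\<^sup>2) = card (t ` {..(card E)\<^sup>2})" by (simp add: card_image)
  also have "\<dots> \<le> card ((\<lambda>(x, y). dist x y) ` (E \<times> E))"
    using t(1) assms(1) by (intro card_mono) auto
  also have "\<dots> \<le> card (E \<times> E)" using assms(1) by (intro card_image_le) auto
  also have "\<dots> = (card E)\<^sup>2" by (simp add: card_cartesian_product power2_eq_square)
  finally show False by simp
qed

text \<open>Greedy choice: a point farther than \<rho> from all centres chosen so far is at distance
  at least r from them, because no distance falls in between, and so it can become a centre.\<close>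

lemma cluster_centres:
  fixes E :: "'a::metric_space set"
  assumes "finite E" "\<rho> < r" "0 \<le> \<rho>"
    and "\<And>x y. x \<in> E \<Longrightarrow> y \<in> E \<Longrightarrow> dist x y \<le> \<rho> \<or> r \<le> dist x y"
  obtains Q where "Q \<subseteq> E" "\<And>x. x \<in> E \<Longrightarrow> \<exists>q\<in>Q. dist x q \<le> \<rho>"
    "\<And>q q'. q \<in> Q \<Longrightarrow> q' \<in> Q \<Longrightarrow> q \<noteq> q' \<Longrightarrow> r \<le> dist q q'"
proof -
  have "\<exists>Q\<subseteq>E. (\<forall>x\<in>E. \<exists>q\<in>Q. dist x q \<le> \<rho>) \<and> (\<forall>q\<in>Q. \<forall>q'\<in>Q. q \<noteq> q' \<longrightarrow> r \<le> dist q q')"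
    using assms(1,4)
  proof (induction E rule: finite_induct)
    case (insert x E)
    have "\<exists>Q\<subseteq>E. (\<forall>x\<in>E. \<exists>q\<in>Q. dist x q \<le> \<rho>) \<and> (\<forall>q\<in>Q. \<forall>q'\<in>Q. q \<noteq> q' \<longrightarrow> r \<le> dist q q')"
      by (rule insert.IH) (use insert.prems in auto)
    then obtain Q where Q: "Q \<subseteq> E" "\<forall>x\<in>E. \<exists>q\<in>Q. dist x q \<le> \<rho>"
      "\<forall>q\<in>Q. \<forall>q'\<in>Q. q \<noteq> q' \<longrightarrow> r \<le> dist q q'"
      by (elim exE conjE) (rule that; assumption)
    show ?case
    proof (cases "\<exists>q\<in>Q. dist x q \<le> \<rho>")
      case True
      then show ?thesis using Q by (intro exI[of _ Q]) auto
    next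
      case False
      then have "r \<le> dist x q" if "q \<in> Q" for q
        using insert.prems[of x q] Q(1) that by blast
      then show ?thesis
        using Q assms(3) by (intro exI[of _ "insert x Q"]) (auto simp: dist_commute)
    qed
  qed auto
  then obtain Q where "Q \<subseteq> E" "\<forall>x\<in>E. \<exists>q\<in>Q. dist x q \<le> \<rho>"
    "\<forall>q\<in>Q. \<forall>q'\<in>Q. q \<noteq> q' \<longrightarrow> r \<le> dist q q'"
    by (elim exE conjE)
  then show thesis by (intro that[of Q]) simp_all
qed

lemma quasi_isometry_translate:
  fixes W :: "real^'n \<Rightarrow> real^'n"
  assumes "quasi_isometry c W" "0 \<le> c"
  shows "quasi_isometry c (\<lambda>x. p + W (x - p))"
proof -
  have tr: "quasi_isometry 1 (\<lambda>x::real^'n. x + b)" for b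
    using quasi_isometry_motion[of "mat 1 :: real^'n^'n" b] by (simp add: orthogonal_matrix_id)
  have "quasi_isometry (1 * (c * 1)) ((\<lambda>x. x + p) \<circ> (W \<circ> (\<lambda>x. x + (- p))))"
    using assms by (intro quasi_isometry_compose tr) auto
  then show ?thesis by (simp add: o_def add.commute)
qed

text \<open>Undoing the motion that a cluster extension performs far away, by twisting and
  sliding in the shell between the cluster and the sphere of radius \<open>R\<close>.\<close>
lemma localize_cluster_extension:
  fixes F :: "(real^'n) set" and T :: "real^'n^'n"
  assumes \<Phi>: "quasi_isometry c \<Phi>" "0 \<le> c" and T: "orthogonal_matrix T" "det T = 1"
    and p: "p \<in> F" "F \<subseteq> cball p \<rho>" and "\<rho> > 0"
    and Tp: "norm (T *v p + b - p) \<le> 2 * \<rho>"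
    and far: "\<And>x. diameter F \<le> infdist x F \<Longrightarrow> \<Phi> x = T *v x + b"
    and \<epsilon>: "0 < \<epsilon>" "\<epsilon> \<le> 1" and R: "5 * \<rho> \<le> R" "24 * \<rho> \<le> \<epsilon> * R"
      "\<rho> * exp (28 / \<epsilon> * CARD('n)) \<le> R"
  obtains G where "quasi_isometry (c * (1 + \<epsilon>) ^ (CARD('n) + 1)) G" "\<And>x. x \<in> F \<Longrightarrow> G x = \<Phi> x"
    "\<And>x. R \<le> dist x p \<Longrightarrow> G x = x"
proof -
  have R0: "R > 0" using R(1) \<open>\<rho> > 0\<close> by linarith
  define T' where "T' = transpose T"
  have T': "orthogonal_matrix T'" "det T' = 1" using T by (auto simp: T'_def)
  have TT': "T *v (T' *v x) = x" for x
    unfolding T'_def using T(1)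
    by (simp only: matrix_vector_mul_assoc orthogonal_matrix_def matrix_vector_mul_lid)
  have ot': "orthogonal_transformation ((*v) T')"
    using T'(1) by (simp add: orthogonal_transformation_matrix)
  have nT': "norm (T' *v x) = norm x" for x by (rule orthogonal_transformation_norm[OF ot'])
  \<comment> \<open>With this vector, p + T'(x - p) + b' = T'(x - b): a twist about p followed by a
    slide is the inverse motion. The vector is short because the motion moves p by at most
    2\<rho>.\<close>
  define b' where "b' = T' *v (p - b) - p"
  have nb': "norm b' \<le> 2 * \<rho>"
  proof -
    have "T' *v (T *v x) = x" for x
      unfolding T'_def using T(1)
      by (simp only: matrix_vector_mul_assoc orthogonal_matrix_def matrix_vector_mul_lid)
    then have "b' = T' *v (p - b - T *v p)"
      by (simp add: b'_def matrix_vector_mult_diff_distrib)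
    then have "norm b' = norm (p - b - T *v p)" by (simp add: nT')
    also have "\<dots> = norm (T *v p + b - p)"
      by (metis (no_types, lifting) add_diff_eq diff_diff_eq norm_minus_commute add.commute)
    finally show ?thesis using Tp by simp
  qed
  obtain W where W: "quasi_isometry ((1 + \<epsilon>) ^ CARD('n)) W" "\<And>x. norm (W x) = norm x"
    "\<And>x. norm x \<le> \<rho> \<Longrightarrow> W x = x" "\<And>x. R \<le> norm x \<Longrightarrow> W x = T' *v x"
  proof -
    \<comment> \<open>The twist is used with \<epsilon>/2, which turns 14/\<epsilon> into
      28/\<epsilon>.\<close>
    have "\<exists>W. quasi_isometry ((1 + 2 * (\<epsilon> / 2)) ^ card (UNIV :: 'n set)) W \<and> (\<forall>x. norm (W x) = norm x) \<and>
      (\<forall>x. norm x \<le> \<rho> \<longrightarrow> W x = x) \<and>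
      (\<forall>x. \<rho> * exp (28 / \<epsilon> * card (UNIV :: 'n set)) \<le> norm x \<longrightarrow> W x = T' *v x)"
      using \<epsilon> T' ot' \<open>\<rho> > 0\<close> by (intro slow_twist) auto
    then show thesis using that R(3) by (metis (no_types, lifting) order_trans mult_2 field_sum_of_halves)
  qed
  obtain S where S: "quasi_isometry (1 + 2 * (\<epsilon> / 2)) S" "\<And>x. dist x p \<le> R / 2 \<Longrightarrow> S x = x"
    "\<And>x. 2 * (R / 2) \<le> dist x p \<Longrightarrow> S x = x + b'"
  proof (rule slide_outwards[of "R / 2" "\<epsilon> / 2" b' p])
    have "3 / (R / 2) * norm b' \<le> 3 / (R / 2) * (2 * \<rho>)"
      using nb' R0 by (intro mult_left_mono) auto
    also have "\<dots> \<le> \<epsilon> / 2" using R(2) R0 by (simp add: field_simps)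
    finally show "3 / (R / 2) * norm b' \<le> \<epsilon> / 2" .
  qed (use R0 \<epsilon> in auto)
  define G where "G = \<Phi> \<circ> (S \<circ> (\<lambda>x. p + W (x - p)))"
  have "quasi_isometry (c * ((1 + 2 * (\<epsilon> / 2)) * (1 + \<epsilon>) ^ CARD('n))) G"
    unfolding G_def using \<epsilon> \<Phi> W(1) S(1)
    by (intro quasi_isometry_compose quasi_isometry_translate) auto
  then have "quasi_isometry (c * (1 + \<epsilon>) ^ (CARD('n) + 1)) G" by simp
  moreover have "G x = \<Phi> x" if "x \<in> F" for x
  proof -
    have "dist x p \<le> \<rho>" using p(2) that by (auto simp: dist_commute)
    then show ?thesis
      using W(3)[of "x - p"] S(2)[of x] R(1) \<open>\<rho> > 0\<close> by (simp add: G_def dist_norm)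
  qed
  moreover have "G x = x" if x: "R \<le> dist x p" for x
  proof -
    have Wx: "W (x - p) = T' *v (x - p)" using W(4) x by (simp add: dist_norm)
    define y where "y = p + T' *v (x - p) + b'"
    have "S (p + W (x - p)) = y"
      using S(3)[of "p + W (x - p)"] x W(2) by (simp add: Wx y_def dist_norm nT')
    then have Gx: "G x = \<Phi> y" by (simp add: G_def)
    have y: "y = T' *v (x - b)"
      by (simp add: y_def b'_def matrix_vector_mult_diff_distrib)
    \<comment> \<open>The point must land where \<Phi> already is the motion. Its distance to
      \<open>F\<close> is at least R - 3\<rho> \<ge> 2\<rho>, which bounds the diameter of
      \<open>F\<close>.\<close>
    have "dist y p \<ge> R - 2 * \<rho>"
    proof -
      have "R \<le> norm (W (x - p))" using x W(2) by (simp add: dist_norm)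
      also have "W (x - p) = (y - p) - b'" by (simp add: Wx y_def)
      also have "norm \<dots> \<le> norm (y - p) + norm b'" by (rule norm_triangle_ineq4)
      finally show ?thesis using nb' by (simp add: dist_norm)
    qed
    then have "2 * \<rho> \<le> dist y q" if "q \<in> F" for q
    proof -
      have "dist y p \<le> dist y q + dist q p" by (rule dist_triangle)
      moreover have "dist q p \<le> \<rho>" using p(2) that by (auto simp: dist_commute)
      ultimately show ?thesis using \<open>dist y p \<ge> R - 2 * \<rho>\<close> R(1) by linarith
    qed
    then have "2 * \<rho> \<le> infdist y F"
      using p(1) unfolding infdist_def by (auto intro!: cINF_greatest)
    moreover have "diameter F \<le> 2 * \<rho>"
      using p diameter_subset[OF p(2)] \<open>\<rho> > 0\<close> by simp
    ultimately have "\<Phi> y = T *v y + b" by (intro far) linarith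
    then show ?thesis by (simp add: Gx y TT')
  qed
  ultimately show thesis by (rule that)
qed

text \<open>Each map fixes all points outside its ball and is injective, so it sends the ball into
  itself. The balls are disjoint, hence on each of them only one factor of the composition
  acts.\<close>

lemma compose_disjoint_supports:
  fixes p :: "'q \<Rightarrow> real^'n" and f :: "'q \<Rightarrow> real^'n \<Rightarrow> real^'n"
  assumes "finite Q" "1 \<le> c"
    and "\<And>q. q \<in> Q \<Longrightarrow> quasi_isometry c (f q)"
    and "\<And>q x. q \<in> Q \<Longrightarrow> R \<le> dist x (p q) \<Longrightarrow> f q x = x"
    and "\<And>q q'. q \<in> Q \<Longrightarrow> q' \<in> Q \<Longrightarrow> q \<noteq> q' \<Longrightarrow> 2 * R \<le> dist (p q) (p q')"
  shows "\<exists>G. quasi_isometry (c ^ card Q) G \<and>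
    (\<forall>q\<in>Q. \<forall>x. dist x (p q) < R \<longrightarrow> G x = f q x) \<and>
    (\<forall>x. (\<forall>q\<in>Q. R \<le> dist x (p q)) \<longrightarrow> G x = x)"
  using assms(1,3-)
proof (induction Q rule: finite_induct)
  case empty
  have "quasi_isometry 1 (\<lambda>x::real^'n. x)"
    using quasi_isometry_motion[of "mat 1 :: real^'n^'n" 0] by (simp add: orthogonal_matrix_id)
  then show ?case by (intro exI[of _ "\<lambda>x. x"]) auto
next
  case (insert q0 Q)
  have "\<exists>G. quasi_isometry (c ^ card Q) G \<and>
    (\<forall>q\<in>Q. \<forall>x. dist x (p q) < R \<longrightarrow> G x = f q x) \<and>
    (\<forall>x. (\<forall>q\<in>Q. R \<le> dist x (p q)) \<longrightarrow> G x = x)"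
    by (rule insert.IH) (use insert.prems in auto)
  then obtain G where G: "quasi_isometry (c ^ card Q) G"
    "\<And>q x. q \<in> Q \<Longrightarrow> dist x (p q) < R \<Longrightarrow> G x = f q x"
    "\<And>x. (\<And>q. q \<in> Q \<Longrightarrow> R \<le> dist x (p q)) \<Longrightarrow> G x = x"
    by metis
  have far: "R \<le> dist x (p q)" if "q \<in> insert q0 Q" "q' \<in> insert q0 Q" "q \<noteq> q'" "dist x (p q') < R" for x q q'
    using insert.prems(3)[OF that(1-3)] dist_triangle[of "p q" "p q'" x] that(4)
    by (simp add: dist_commute)
  have ball: "dist (f q0 x) (p q0) < R" if "dist x (p q0) < R" for x
  proof (rule ccontr)
    assume "\<not> dist (f q0 x) (p q0) < R"
    then have "f q0 (f q0 x) = f q0 x" using insert.prems(2)[of q0] by simp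
    moreover have "inj (f q0)"
      using insert.prems(1)[of q0] by (simp add: quasi_isometry_def bij_def)
    ultimately have "f q0 x = x" by (simp add: inj_eq)
    then show False using that \<open>\<not> dist (f q0 x) (p q0) < R\<close> by simp
  qed
  have card: "c ^ card (insert q0 Q) = c ^ card Q * c" using insert.hyps by simp
  have "quasi_isometry (c ^ card Q * c) (G \<circ> f q0)"
    using insert.prems(1)[of q0] G(1) assms(2) by (intro quasi_isometry_compose) auto
  moreover have "(G \<circ> f q0) x = f q x" if q: "q \<in> insert q0 Q" "dist x (p q) < R" for q x
  proof (cases "q = q0")
    case True
    have "R \<le> dist (f q0 x) (p q')" if "q' \<in> Q" for q'
      using far[of q' q0 "f q0 x"] ball q that True insert.hyps by auto
    then show ?thesis using G(3)[of "f q0 x"] True by simp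
  next
    case False
    then have "f q0 x = x" using far[of q0 q x] q insert.prems(2)[of q0 x] by auto
    then show ?thesis using G(2)[of q x] q False by simp
  qed
  moreover have "(G \<circ> f q0) x = x" if "\<forall>q\<in>insert q0 Q. R \<le> dist x (p q)" for x
    using that insert.prems(2)[of q0 x] G(3)[of x] by auto
  ultimately show ?case
    using card insert.hyps by (intro exI[of _ "G \<circ> f q0"] conjI) (simp only: card, blast+)
qed

text \<open>The induction invariant is stronger than the theorem. The extension is a motion already
  from distance \<open>diameter E\<close> on, and that motion stays within \<open>diameter E\<close>
  of \<phi> on \<open>E\<close>; the latter bounds the slide that later undoes the motion around a
  cluster.\<close>

definition motion_extension ::
    "real \<Rightarrow> (real^'n) set \<Rightarrow> (real^'n \<Rightarrow> real^'n) \<Rightarrow> (real^'n \<Rightarrow> real^'n) \<Rightarrow> real^'n^'n \<Rightarrow> real^'n \<Rightarrow> bool" where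
  "motion_extension c E \<phi> \<Phi> T b \<longleftrightarrow> quasi_isometry c \<Phi> \<and> (\<forall>x\<in>E. \<Phi> x = \<phi> x) \<and>
     orthogonal_matrix T \<and> det T = 1 \<and> (\<forall>x\<in>E. norm (\<phi> x - (T *v x + b)) \<le> diameter E) \<and>
     (\<forall>x. diameter E \<le> infdist x E \<longrightarrow> \<Phi> x = T *v x + b)"

text \<open>Dividing \<phi> by the global motion leaves a map \<psi> that moves each centre q by a
  short vector \<open>v q\<close>. Subtracting \<open>v q\<close> makes the cluster map fix q, so
  its extension can be confined to a ball about q; the vectors \<open>v q\<close> are restored by
  one slide, and the motion is applied last. The exponent counts distortion factors: one for the
  final slide, and per cluster one for the extension, D for the twist and one for the slide of the
  localization.\<close>

lemma motion_extension_of_clusters: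
  fixes E :: "(real^'n) set" and T :: "real^'n^'n" and \<delta> \<eta> \<epsilon> \<rho> r t :: real
  assumes E: "finite E" and d: "diameter E > 0"
    and iso: "near_isometric \<delta> E \<phi>" "0 \<le> \<delta>" "\<delta> \<le> 1"
    and noblock: "\<not> (\<exists>z. neg_block \<eta> E \<phi> z)"
    and T: "orthogonal_matrix T" "det T = 1"
      "\<And>x. x \<in> E \<Longrightarrow> norm (\<phi> x - (T *v x + b)) \<le> t" "t \<le> diameter E"
    and \<rho>: "0 < \<rho>" "r \<le> diameter E"
      "\<And>x y. x \<in> E \<Longrightarrow> y \<in> E \<Longrightarrow> dist x y \<le> \<rho> \<or> r \<le> dist x y"
    and \<epsilon>: "0 < \<epsilon>" "\<epsilon> \<le> 1" and r: "20 * \<rho> \<le> r" "96 * \<rho> \<le> \<epsilon> * r"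
      "\<rho> * exp (28 / \<epsilon> * CARD('n)) \<le> r / 4" "24 * real (card E) * t \<le> \<epsilon> * r"
    and IH: "\<And>F \<psi>. F \<subseteq> E \<Longrightarrow> card F < card E \<Longrightarrow> near_isometric \<delta> F \<psi> \<Longrightarrow>
       \<not> (\<exists>z. neg_block \<eta> F \<psi> z) \<Longrightarrow> \<exists>\<Phi> T b. motion_extension (1 + \<epsilon>) F \<psi> \<Phi> T b"
  shows "\<exists>\<Phi>. motion_extension ((1 + \<epsilon>) ^ (1 + card E * (CARD('n) + 2))) E \<phi> \<Phi> T b"
proof -
  \<comment> \<open>Centres are 4R apart, so a point within R of one centre lies at least 3R from
    the others, beyond the radius 2R of their slides.\<close>
  define R where "R = r / 4"
  have r0: "r > 0" using \<rho>(1) r(1) by linarith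
  have R0: "R > 0" using r0 by (simp add: R_def)
  obtain Q where Q: "Q \<subseteq> E" "\<And>x. x \<in> E \<Longrightarrow> \<exists>q\<in>Q. dist x q \<le> \<rho>"
    "\<And>q q'. q \<in> Q \<Longrightarrow> q' \<in> Q \<Longrightarrow> q \<noteq> q' \<Longrightarrow> r \<le> dist q q'"
    by (rule cluster_centres[OF E _ _ \<rho>(3)]) (use \<rho>(1) r(1) in auto)
  have finQ: "finite Q" "card Q \<le> card E" using Q(1) E by (auto intro: finite_subset card_mono)
  define \<psi> where "\<psi> x = transpose T *v (\<phi> x - b)" for x
  have T\<psi>: "T *v \<psi> x + b = \<phi> x" for x
    unfolding \<psi>_def using T(1)
    by (simp only: matrix_vector_mul_assoc orthogonal_matrix_def matrix_vector_mul_lid) simp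
  have ot: "orthogonal_transformation ((*v) T)"
    using T(1) by (simp add: orthogonal_transformation_matrix)
  have nT: "norm (T *v x) = norm x" for x by (rule orthogonal_transformation_norm[OF ot])
  have \<psi>_dist: "dist (\<psi> x) (\<psi> y) = dist (\<phi> x) (\<phi> y)" for x y
  proof -
    have "\<phi> x - \<phi> y = T *v (\<psi> x - \<psi> y)"
      by (simp add: T\<psi> [symmetric] matrix_vector_mult_diff_distrib)
    then show ?thesis by (simp add: dist_norm nT)
  qed
  define v where "v q = \<psi> q - q" for q
  have v: "norm (v q) \<le> t" if "q \<in> E" for q
  proof -
    have "\<phi> q - (T *v q + b) = T *v v q"
      by (simp add: T\<psi> [symmetric] v_def matrix_vector_mult_diff_distrib)
    then show ?thesis using T(3)[OF that] by (simp add: nT)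
  qed
  have piece: "\<exists>G. quasi_isometry ((1 + \<epsilon>) ^ (CARD('n) + 2)) G \<and>
      (\<forall>x\<in>E. dist x q \<le> \<rho> \<longrightarrow> G x = \<psi> x - v q) \<and> (\<forall>x. R \<le> dist x q \<longrightarrow> G x = x)" if q: "q \<in> Q" for q
  proof -
    define F where "F = {x\<in>E. dist x q \<le> \<rho>}"
    have qF: "q \<in> F" "F \<subseteq> cball q \<rho>" "F \<subseteq> E" using q Q(1) \<rho>(1) by (auto simp: F_def dist_commute)
    have "card F < card E"
    proof (rule psubset_card_mono[OF E])
      \<comment> \<open>The diameter of \<open>E\<close> is attained and is at least r \<ge>
        20\<rho>, while a cluster has diameter at most 2\<rho>.\<close>
      obtain x y where xy: "x \<in> E" "y \<in> E" "dist x y = diameter E"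
        using diameter_compact_attained[of E] finite_imp_compact[OF E] q Q(1) by blast
      have "F \<noteq> E"
      proof
        assume "F = E"
        then have "dist x q \<le> \<rho>" "dist y q \<le> \<rho>" using xy by (auto simp: F_def)
        then have "dist x y \<le> 2 * \<rho>" using dist_triangle2[of x y q] by linarith
        then show False using xy \<rho> r(1) by linarith
      qed
      then show "F \<subset> E" using qF by blast
    qed
    \<comment> \<open>Since this map fixes q, the motion produced by the induction hypothesis moves
      q by at most the diameter of the cluster, however far its rotation is from the
      identity.\<close>
    define \<psi>' where "\<psi>' x = \<psi> x - v q" for x
    have \<psi>'_dist: "dist (\<psi>' x) (\<psi>' y) = dist (\<phi> x) (\<phi> y)" for x y
      using \<psi>_dist[of x y] by (simp add: \<psi>'_def dist_norm)
    have "near_isometric \<delta> F \<psi>'"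
      unfolding near_isometric_def
    proof (intro ballI)
      fix x y assume "x \<in> F" "y \<in> F"
      then have "x \<in> E" "y \<in> E" using qF(3) by auto
      then show "inverse (1 + \<delta>) * dist x y \<le> dist (\<psi>' x) (\<psi>' y) \<and>
          dist (\<psi>' x) (\<psi>' y) \<le> (1 + \<delta>) * dist x y"
        using iso(1) unfolding near_isometric_def \<psi>'_dist by blast
    qed
    moreover have "\<not> (\<exists>z. neg_block \<eta> F \<psi>' z)"
      using noblock neg_block_motion[OF _ qF(3) T(1,2)] unfolding \<psi>'_def \<psi>_def by blast
    ultimately obtain \<Phi> U a where \<Phi>: "motion_extension (1 + \<epsilon>) F \<psi>' \<Phi> U a"
      using IH[OF qF(3) \<open>card F < card E\<close>] by blast
    have bF: "diameter F \<le> 2 * \<rho>"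
      using qF diameter_subset[OF qF(2)] \<rho>(1) by simp
    have "norm (\<psi>' q - (U *v q + a)) \<le> 2 * \<rho>"
      using \<Phi> qF(1) bF unfolding motion_extension_def by fastforce
    moreover have "\<psi>' q = q" by (simp add: \<psi>'_def v_def)
    ultimately have Uq: "norm (U *v q + a - q) \<le> 2 * \<rho>" by (simp add: norm_minus_commute)
    obtain G where G: "quasi_isometry ((1 + \<epsilon>) * (1 + \<epsilon>) ^ (CARD('n) + 1)) G"
      "\<And>x. x \<in> F \<Longrightarrow> G x = \<Phi> x" "\<And>x. R \<le> dist x q \<Longrightarrow> G x = x"
    proof (rule localize_cluster_extension[of "1 + \<epsilon>" \<Phi> U q F \<rho> a \<epsilon> R])
      show "5 * \<rho> \<le> R" "24 * \<rho> \<le> \<epsilon> * R" "\<rho> * exp (28 / \<epsilon> * CARD('n)) \<le> R"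
        using r by (auto simp: R_def)
    qed (use \<Phi> qF \<rho>(1) Uq \<epsilon> in \<open>auto simp: motion_extension_def\<close>)
    then show ?thesis using \<Phi> by (intro exI[of _ G]) (auto simp: motion_extension_def F_def \<psi>'_def)
  qed
  then obtain g where g: "\<And>q. q \<in> Q \<Longrightarrow> quasi_isometry ((1 + \<epsilon>) ^ (CARD('n) + 2)) (g q)"
    "\<And>q x. q \<in> Q \<Longrightarrow> x \<in> E \<Longrightarrow> dist x q \<le> \<rho> \<Longrightarrow> g q x = \<psi> x - v q"
    "\<And>q x. q \<in> Q \<Longrightarrow> R \<le> dist x q \<Longrightarrow> g q x = x"
    by metis
  have "\<exists>G. quasi_isometry (((1 + \<epsilon>) ^ (CARD('n) + 2)) ^ card Q) G \<and>
    (\<forall>q\<in>Q. \<forall>x. dist x q < R \<longrightarrow> G x = g q x) \<and>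
    (\<forall>x. (\<forall>q\<in>Q. R \<le> dist x q) \<longrightarrow> G x = x)"
  proof (rule compose_disjoint_supports)
    show "1 \<le> (1 + \<epsilon>) ^ (CARD('n) + 2)" using \<epsilon> by (intro one_le_power) auto
    show "2 * R \<le> dist q q'" if "q \<in> Q" "q' \<in> Q" "q \<noteq> q'" for q q'
      using Q(3)[OF that] r0 by (simp add: R_def)
  qed (use finQ g in auto)
  then obtain G where G: "quasi_isometry (((1 + \<epsilon>) ^ (CARD('n) + 2)) ^ card Q) G"
    "\<And>q x. q \<in> Q \<Longrightarrow> dist x q < R \<Longrightarrow> G x = g q x"
    "\<And>x. (\<And>q. q \<in> Q \<Longrightarrow> R \<le> dist x q) \<Longrightarrow> G x = x"
    by metis
  obtain S where S: "quasi_isometry (1 + 2 * (\<epsilon> / 2)) S"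
    "\<And>x. (\<And>q. q \<in> Q \<Longrightarrow> 2 * R \<le> dist x q) \<Longrightarrow> S x = x"
    "\<And>q x. q \<in> Q \<Longrightarrow> dist x q \<le> R \<Longrightarrow>
        (\<And>q'. q' \<in> Q \<Longrightarrow> q' \<noteq> q \<Longrightarrow> 2 * R \<le> dist x q') \<Longrightarrow> S x = x + v q"
  proof (rule slide_clusters[of Q R "\<epsilon> / 2" v "\<lambda>q. q"])
    have "E \<noteq> {}" using d by auto
    then obtain x where "x \<in> E" by blast
    then have t0: "0 \<le> t" using T(3)[of x] norm_ge_zero order_trans by blast
    \<comment> \<open>With R = r/4 each cluster contributes at most 12t/r, which explains the 24 in
      the hypothesis on t.\<close>
    have "(\<Sum>q\<in>Q. 3 / R * norm (v q)) \<le> (\<Sum>q\<in>Q. 3 / R * t)"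
      using v Q(1) R0 by (intro sum_mono mult_left_mono) auto
    also have "\<dots> = card Q * (3 / R * t)" by simp
    also have "\<dots> \<le> card E * (3 / R * t)"
      using finQ t0 R0 by (intro mult_right_mono) auto
    also have "\<dots> = 12 * card E * t / r" by (simp add: R_def)
    also have "\<dots> \<le> \<epsilon> / 2" using r(4) r0 by (simp add: field_simps)
    finally show "(\<Sum>q\<in>Q. 3 / R * norm (v q)) \<le> \<epsilon> / 2" .
  qed (use finQ R0 \<epsilon> in auto)
  define \<Phi> where "\<Phi> = (\<lambda>x. T *v x + b) \<circ> (S \<circ> G)"
  have "quasi_isometry (1 * ((1 + 2 * (\<epsilon> / 2)) * ((1 + \<epsilon>) ^ (CARD('n) + 2)) ^ card Q)) \<Phi>"
    unfolding \<Phi>_def using \<epsilon> G(1) S(1) T(1,2)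
    by (intro quasi_isometry_compose quasi_isometry_motion) auto
  moreover have "1 * ((1 + 2 * (\<epsilon> / 2)) * ((1 + \<epsilon>) ^ k) ^ l) = (1 + \<epsilon>) ^ (1 + l * k)" for k l :: nat
    by (simp add: power_mult mult.commute[of l k])
  ultimately have "quasi_isometry ((1 + \<epsilon>) ^ (1 + card Q * (CARD('n) + 2))) \<Phi>" by metis
  moreover have "(1 + \<epsilon>) ^ (1 + card Q * (CARD('n) + 2)) \<le> (1 + \<epsilon>) ^ (1 + card E * (CARD('n) + 2))"
    using \<epsilon> finQ(2) by (intro power_increasing add_left_mono mult_le_mono1) auto
  ultimately have "quasi_isometry ((1 + \<epsilon>) ^ (1 + card E * (CARD('n) + 2))) \<Phi>"
    by (rule quasi_isometry_mono)
  moreover have "\<Phi> x = \<phi> x" if x: "x \<in> E" for x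
  proof -
    obtain q where q: "q \<in> Q" "dist x q \<le> \<rho>" using Q(2)[OF x] by blast
    have qE: "q \<in> E" using q Q by blast
    define y where "y = \<psi> x - v q"
    have "dist x q < R" using q(2) r(1) \<rho>(1) by (simp add: R_def)
    then have Gx: "G x = y" using G(2)[OF q(1)] g(2)[OF q(1) x q(2)] by (simp add: y_def)
    \<comment> \<open>The slide acts after the localized maps, so the image y, and not x, has to lie
      in the region where the slide is a pure translation.\<close>
    have "dist y q = dist (\<psi> x) (\<psi> q)" by (simp add: y_def v_def dist_norm)
    also have "\<dots> \<le> (1 + \<delta>) * dist x q"
      unfolding \<psi>_dist using iso(1) x qE by (simp add: near_isometric_def)
    also have "\<dots> \<le> 2 * \<rho>" using iso q(2) by (intro mult_mono) auto
    finally have yq: "dist y q \<le> R" using r(1) \<rho>(1) by (simp add: R_def)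
    have "2 * R \<le> dist y q'" if "q' \<in> Q" "q' \<noteq> q" for q'
      using Q(3)[OF q(1) that(1)] that(2) dist_triangle[of q q' y] yq r0
      by (simp add: R_def dist_commute)
    then have "S y = y + v q" using S(3)[OF q(1) yq] by blast
    then have "(S \<circ> G) x = \<psi> x" by (simp add: Gx y_def)
    then show ?thesis using T\<psi>[of x] by (simp add: \<Phi>_def)
  qed
  moreover have "\<Phi> x = T *v x + b" if "diameter E \<le> infdist x E" for x
  proof -
    have "r \<le> dist x q" if "q \<in> Q" for q
      using infdist_le[of q E x] that Q(1) \<rho>(2) \<open>diameter E \<le> infdist x E\<close> by (meson order_trans subsetD)
    then have "G x = x" "S x = x"
      using G(3)[of x] S(2)[of x] r0 by (fastforce simp: R_def)+
    then show ?thesis by (simp add: \<Phi>_def)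
  qed
  moreover have "norm (\<phi> x - (T *v x + b)) \<le> diameter E" if "x \<in> E" for x
    using T(3)[OF that] T(4) by linarith
  ultimately show ?thesis using T(1,2) unfolding motion_extension_def by blast
qed

section \<open>Choice of the constants and the induction\<close>

lemma power_one_plus_le:
  fixes \<epsilon> :: real
  assumes "0 \<le> \<epsilon>" "\<epsilon> \<le> 1" "m > 0"
  shows "(1 + \<epsilon> / (2 * real m)) ^ m \<le> 1 + \<epsilon>"
proof -
  have "(1 + \<epsilon> / (2 * real m)) ^ m \<le> exp (\<epsilon> / (2 * real m)) ^ m"
    using assms by (intro power_mono) (auto simp: add.commute exp_ge_add_one_self)
  also have "\<dots> = exp (\<epsilon> / 2)" using assms by (simp flip: exp_of_nat_mult)
  also have "\<dots> \<le> 1 + \<epsilon> / 2 + (\<epsilon> / 2)\<^sup>2" using assms by (intro exp_bound) auto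
  also have "\<dots> \<le> 1 + \<epsilon>"
    using assms mult_left_mono[of \<epsilon> 1 \<epsilon>] by (simp add: power2_eq_square)
  finally show ?thesis .
qed

text \<open>One constant \<open>C\<close> serves both as C' and as C''. Quantifying over all
  \<epsilon>, \<open>E\<close> and \<phi> inside makes \<open>c\<close> and \<open>C\<close> depend
  on the dimension and the number of points only.\<close>

definition extension_property :: "'n::finite itself \<Rightarrow> nat \<Rightarrow> real \<Rightarrow> real \<Rightarrow> bool" where
  "extension_property _ n c C \<longleftrightarrow> (\<forall>\<epsilon> (E :: (real^'n) set) \<phi>. 0 < \<epsilon> \<longrightarrow> \<epsilon> < c \<longrightarrow> finite E \<longrightarrow> card E \<le> n \<longrightarrow>
     near_isometric (exp (- C / \<epsilon>)) E \<phi> \<longrightarrow> \<not> (\<exists>z. neg_block (exp (- C / \<epsilon>)) E \<phi> z) \<longrightarrow>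
     (\<exists>\<Phi> T b. motion_extension (1 + \<epsilon>) E \<phi> \<Phi> T b))"

lemma motion_extension_trivial:
  fixes E :: "(real^'n) set"
  assumes "finite E" "diameter E \<le> 0" "1 \<le> c"
  shows "\<exists>\<Phi> T b. motion_extension c E \<phi> \<Phi> T b"
proof -
  obtain a where a: "E \<subseteq> {a}"
  proof (cases "E = {}")
    case False
    then obtain a where "a \<in> E" by blast
    then have "x = a" if "x \<in> E" for x
      using diameter_bounded_bound[OF finite_imp_bounded[OF assms(1)], of x a] that assms(2)
      by (smt (verit) dist_le_zero_iff)
    then show thesis using that by blast
  qed (use that in auto)
  define b where "b = \<phi> a - a"
  have "quasi_isometry c (\<lambda>x. mat 1 *v x + b)"
    using assms(3) by (intro quasi_isometry_mono[OF quasi_isometry_motion]) (auto simp: orthogonal_matrix_id)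
  moreover have "0 \<le> diameter E" using assms(1) by (intro diameter_ge_0 finite_imp_bounded)
  ultimately show ?thesis
    using a unfolding motion_extension_def
    by (intro exI[of _ "\<lambda>x. mat 1 *v x + b"] exI[of _ "mat 1"] exI[of _ b])
       (auto simp: orthogonal_matrix_id b_def)
qed

text \<open>The ratio \<open>\<kappa>\<close> of consecutive scales leaves room for a twist, and \<open>\<kappa> \<le> \<epsilon> / B\<close>
  for a large constant \<open>B\<close>. By pigeonhole one of \<open>(n + 1)\<^sup>2 + 1\<close> consecutive scales
  contains no distance of \<open>E\<close>, so the approximation of \<open>\<phi>\<close> by a motion has to be accurate
  to \<open>\<kappa> ^ ((n + 1)\<^sup>2 + 2)\<close>.\<close>
lemma extension_property_Suc:
  assumes "0 < c1" "0 < C1" and IH: "extension_property TYPE('n::finite) n c1 C1"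
  shows "\<exists>c>0. \<exists>C>0. extension_property TYPE('n) (Suc n) c C"
proof -
  define D where "D = CARD('n)"
  have D: "1 \<le> D" "1 \<le> real D" by (auto simp: D_def Suc_leI)
  \<comment> \<open>An upper bound for the number of distortion factors in one induction step;
    running each of them with \<epsilon>/(2m) keeps the product below 1 + \<epsilon>.\<close>
  define m where "m = 1 + Suc n * (D + 2)"
  define M where "M = 2 * real m"
  have M: "2 \<le> M" by (simp add: M_def m_def)
  define B where "B = 192 * M * (real D)\<^sup>2 * Suc n"
  have Mle: "M \<le> M * (real D)\<^sup>2 * Suc n"
    using M D by (simp add: mult_le_cancel_left1 mult.assoc) (simp add: mult_ge1_I)
  \<comment> \<open>The first summand cancels the factor exp(28D/\<epsilon>') of the twist, where
    \<epsilon>' = \<epsilon>/M. The second makes \<kappa> at most \<epsilon>/B, because exp(-x)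
    \<le> 1/x.\<close>
  define A where "A = 28 * M * D + B"
  define N where "N = (Suc n)\<^sup>2"
  define K where "K = 10 * D + 2"
  \<comment> \<open>The first summand gives \<delta> \<le> \<tau>^K, the accuracy that the
    approximation by a motion requires; the second puts \<delta> below the threshold
    exp(-C1/\<epsilon>') of the induction hypothesis.\<close>
  define C where "C = A * (N + 2) * K + C1 * M"
  define c where "c = min 1 (c1 * M)"
  have B: "384 \<le> B" "192 * M \<le> B" "(real D)\<^sup>2 \<le> B" "48 * M * D * Suc n \<le> B"
  proof -
    show "192 * M \<le> B" using Mle by (simp add: B_def)
    then show "384 \<le> B" using M by simp
    have "1 * (real D)\<^sup>2 * 1 \<le> (192 * M) * (real D)\<^sup>2 * Suc n"
      using M by (intro mult_mono) auto
    then show "(real D)\<^sup>2 \<le> B" by (simp add: B_def)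
    have "48 * M * D * Suc n \<le> (192 * M) * (real D)\<^sup>2 * Suc n"
      using M D by (intro mult_mono) (auto simp: power2_eq_square)
    then show "48 * M * D * Suc n \<le> B" by (simp add: B_def)
  qed
  have A: "0 < A" using B(1) M by (simp add: A_def add_nonneg_pos)
  have K: "1 \<le> K" by (simp add: K_def)
  have C: "0 < C" using A assms M by (simp add: C_def add_nonneg_pos)
  have c: "0 < c" using assms M by (simp add: c_def)
  have "extension_property TYPE('n) (Suc n) c C"
    unfolding extension_property_def
  proof (intro allI impI)
    fix \<epsilon> :: real and E :: "(real^'n) set" and \<phi>
    assume \<epsilon>: "0 < \<epsilon>" "\<epsilon> < c" and E: "finite E" "card E \<le> Suc n"
      and iso: "near_isometric (exp (- C / \<epsilon>)) E \<phi>"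
      and nb: "\<not> (\<exists>z. neg_block (exp (- C / \<epsilon>)) E \<phi> z)"
    have \<epsilon>1: "\<epsilon> \<le> 1" "\<epsilon> < c1 * M" using \<epsilon> by (auto simp: c_def)
    show "\<exists>\<Phi> T b. motion_extension (1 + \<epsilon>) E \<phi> \<Phi> T b"
    proof (cases "diameter E \<le> 0")
      case True
      then show ?thesis using \<epsilon> E(1) by (intro motion_extension_trivial) auto
    next
      case False
      define d where "d = diameter E"
      have d: "d > 0" using False by (simp add: d_def)
      define \<epsilon>' where "\<epsilon>' = \<epsilon> / M"
      have \<epsilon>': "0 < \<epsilon>'" "\<epsilon>' \<le> 1" "\<epsilon>' < c1" using \<epsilon> \<epsilon>1 M by (auto simp: \<epsilon>'_def field_simps)
      define \<kappa> where "\<kappa> = exp (- A / \<epsilon>)"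
      define \<tau> where "\<tau> = \<kappa> ^ (N + 2)"
      define \<delta> where "\<delta> = exp (- C / \<epsilon>)"
      have \<kappa>_split: "\<kappa> = exp (- (28 * M * D / \<epsilon>)) * exp (- (B / \<epsilon>))"
        by (simp add: \<kappa>_def A_def add_divide_distrib diff_divide_distrib flip: exp_add)
      have eB: "exp (- (B / \<epsilon>)) \<le> \<epsilon> / B"
      proof -
        have "B / \<epsilon> \<le> exp (B / \<epsilon>)" using exp_ge_add_one_self[of "B / \<epsilon>"] by linarith
        then show ?thesis using B(1) \<epsilon>(1) by (simp add: exp_minus field_simps)
      qed
      have \<kappa>0: "0 < \<kappa>" by (simp add: \<kappa>_def)
      have "\<kappa> \<le> 1 * exp (- (B / \<epsilon>))"
        unfolding \<kappa>_split using M \<epsilon> by (intro mult_right_mono) auto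
      then have \<kappa>B: "\<kappa> \<le> \<epsilon> / B" using eB by simp
      have "\<epsilon> / B \<le> 1 / B" using \<epsilon>1 B(1) by (intro divide_right_mono) auto
      then have \<kappa>1: "\<kappa> * B \<le> 1" using \<kappa>B B(1) by (simp add: field_simps)
      have \<kappa>_small: "b * \<kappa> \<le> \<epsilon>" "b * \<kappa> \<le> 1" if "b \<le> B" for b
      proof -
        have "b * \<kappa> \<le> B * \<kappa>" using that \<kappa>0 by (intro mult_right_mono) auto
        moreover have "B * \<kappa> \<le> \<epsilon>" using \<kappa>B B(1) by (simp add: field_simps)
        ultimately show "b * \<kappa> \<le> \<epsilon>" "b * \<kappa> \<le> 1" using \<epsilon>1 by linarith+
      qed
      have \<kappa>le1: "\<kappa> \<le> 1" using \<kappa>_small(2)[of 1] B(1) by simp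
      have \<tau>0: "0 < \<tau>" using \<kappa>0 by (simp add: \<tau>_def)
      have \<tau>\<kappa>: "\<tau> \<le> \<kappa>"
        unfolding \<tau>_def using power_decreasing[of 1 "N + 2" \<kappa>] \<kappa>0 \<kappa>le1 by simp
      have \<tau>_small: "b * \<tau> \<le> 1" if "b \<le> B" "0 \<le> b" for b
        using \<kappa>_small(2)[OF that(1)] mult_left_mono[OF \<tau>\<kappa> that(2)] by linarith
      have \<delta>\<tau>: "\<delta> \<le> \<tau> ^ (10 * CARD('n) + 2)"
      proof -
        have "\<tau> ^ K = exp (- (A * (N + 2) * K) / \<epsilon>)"
          unfolding \<tau>_def \<kappa>_def power_mult [symmetric] exp_of_nat_mult [symmetric]
          by (rule arg_cong[where f = exp]) (use \<epsilon> in \<open>simp add: field_simps\<close>)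
        moreover have "A * (N + 2) * K \<le> C" using assms M by (simp add: C_def)
        ultimately show ?thesis using \<epsilon> by (simp add: \<delta>_def K_def D_def divide_right_mono)
      qed
      have \<delta>IH: "\<delta> \<le> exp (- C1 / \<epsilon>')"
      proof -
        have "C1 * M \<le> C" using A by (simp add: C_def)
        then show ?thesis using \<epsilon> by (simp add: \<delta>_def \<epsilon>'_def divide_right_mono)
      qed
      have \<delta>1: "0 \<le> \<delta>" "\<delta> \<le> 1" using C \<epsilon> by (auto simp: \<delta>_def)
      obtain T :: "real^'n^'n" and b where T: "orthogonal_matrix T" "det T = 1"
        "\<And>x. x \<in> E \<Longrightarrow> norm (\<phi> x - (T *v x + b)) \<le> CARD('n) * \<tau> * diameter E"
      proof (rule near_isometry_close_to_proper_motion[of E \<tau> \<delta> \<delta> \<phi>])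
        show "\<tau> \<le> 1/16" using \<tau>_small[of 16] B(1) by simp
        show "(real CARD('n))\<^sup>2 * \<tau> \<le> 1" using \<tau>_small[OF B(3)] by (simp add: D_def)
        show "inverse (1 + \<delta>) * dist x y \<le> dist (\<phi> x) (\<phi> y) \<and> dist (\<phi> x) (\<phi> y) \<le> (1 + \<delta>) * dist x y"
          if "x \<in> E" "y \<in> E" for x y
          using iso that by (simp add: near_isometric_def \<delta>_def)
      qed (use False E(1) \<tau>0 \<delta>\<tau> \<delta>1 nb in \<open>auto simp: finite_imp_bounded \<delta>_def\<close>)
      obtain j where j: "j \<le> (card E)\<^sup>2"
        "\<And>x y. x \<in> E \<Longrightarrow> y \<in> E \<Longrightarrow> dist x y \<le> d * \<kappa> ^ Suc j \<or> d * \<kappa> ^ j \<le> dist x y"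
      proof (rule finite_distances_gap[OF E(1), of "\<lambda>j. d * \<kappa> ^ j"])
        show "d * \<kappa> ^ j \<le> d * \<kappa> ^ i" if "i \<le> j" for i j
          using that d \<kappa>0 \<kappa>le1 by (intro mult_left_mono power_decreasing) auto
      qed auto
      define r where "r = d * \<kappa> ^ j"
      have r0: "r > 0" using d \<kappa>0 by (simp add: r_def)
      have rd: "r \<le> d" using d \<kappa>0 \<kappa>le1 by (simp add: r_def mult_left_le power_le_one)
      have "(card E)\<^sup>2 \<le> N" using E(2) by (simp add: N_def power_mono)
      then have jN: "j \<le> N" using j(1) by simp
      \<comment> \<open>The gap may occur at any index j up to N, so \<kappa>^(N + 2) is small
        enough to beat \<kappa> r = d \<kappa>^(j + 1) wherever it occurs.\<close>
      have \<tau>r: "\<tau> * d \<le> \<kappa> * r"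
      proof -
        have "\<kappa> ^ (N + 2) \<le> \<kappa> ^ (j + 1)" using jN \<kappa>0 \<kappa>le1 by (intro power_decreasing) auto
        then have "d * \<kappa> ^ (N + 2) \<le> d * \<kappa> ^ (j + 1)" using d by (intro mult_left_mono) auto
        then show ?thesis by (simp add: \<tau>_def r_def mult_ac)
      qed
      have "\<exists>\<Phi>. motion_extension ((1 + \<epsilon>') ^ (1 + card E * (CARD('n) + 2))) E \<phi> \<Phi> T b"
      proof (rule motion_extension_of_clusters[where \<rho> = "\<kappa> * r" and r = r and t = "CARD('n) * \<tau> * d" and \<delta> = \<delta> and \<eta> = \<delta>])
        show "norm (\<phi> x - (T *v x + b)) \<le> CARD('n) * \<tau> * d" if "x \<in> E" for x
          using T(3)[OF that] by (simp add: d_def)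
        have "real D * \<tau> \<le> 1"
        proof (rule \<tau>_small)
          have "real D \<le> (real D)\<^sup>2" using D by (simp add: power2_eq_square)
          then show "real D \<le> B" using B(3) by linarith
        qed simp
        then show "CARD('n) * \<tau> * d \<le> diameter E"
          using d mult_right_mono[of "real D * \<tau>" 1 d] by (simp add: D_def d_def)
        show "dist x y \<le> \<kappa> * r \<or> r \<le> dist x y" if "x \<in> E" "y \<in> E" for x y
          using j(2)[OF that] by (simp add: r_def mult_ac)
        show "20 * (\<kappa> * r) \<le> r"
          using \<kappa>_small(2)[of 20] B(1) r0 mult_right_mono[of "20 * \<kappa>" 1 r] by simp
        have "96 * M * \<kappa> \<le> \<epsilon>" using \<kappa>_small(1)[of "96 * M"] B(2) M by simp
        then have "96 * \<kappa> \<le> \<epsilon>'" using M by (simp add: \<epsilon>'_def field_simps)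
        then show "96 * (\<kappa> * r) \<le> \<epsilon>' * r" using r0 mult_right_mono[of "96 * \<kappa>" \<epsilon>' r] by simp
        have "\<kappa> * exp (28 / \<epsilon>' * D) = exp (- (B / \<epsilon>))"
          unfolding \<kappa>_split \<epsilon>'_def using \<epsilon> M by (simp add: exp_minus field_simps)
        also have "\<dots> \<le> 1 / 4"
          using eB \<open>\<epsilon> / B \<le> 1 / B\<close> B(1) by (smt (verit) frac_le)
        finally have "\<kappa> * exp (28 / \<epsilon>' * D) * r \<le> 1 / 4 * r" using r0 by (intro mult_right_mono) auto
        then show "\<kappa> * r * exp (28 / \<epsilon>' * CARD('n)) \<le> r / 4" by (simp add: D_def mult_ac)
        have "24 * real (card E) * (CARD('n) * \<tau> * d) = (24 * real (card E) * real D) * (\<tau> * d)"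
          by (simp add: D_def)
        also have "\<dots> \<le> (24 * real (Suc n) * real D) * (\<kappa> * r)"
        proof (rule mult_mono)
          have "real (card E) \<le> real (Suc n)" using E(2) by (simp only: of_nat_le_iff)
          then show "24 * real (card E) * real D \<le> 24 * real (Suc n) * real D"
            by (intro mult_right_mono mult_left_mono) auto
        qed (use \<tau>r \<tau>0 d in auto)
        also have "\<dots> = (24 * real (Suc n) * real D * \<kappa>) * r" by simp
        also have "\<dots> \<le> \<epsilon>' * r"
        proof (rule mult_right_mono)
          have "(24 * M * D * Suc n) * \<kappa> \<le> \<epsilon>"
          proof (rule \<kappa>_small(1))
            show "24 * M * D * Suc n \<le> B" using B(4) M by (smt (verit) mult_right_mono of_nat_0_le_iff mult.assoc)
          qed
          then show "24 * real (Suc n) * real D * \<kappa> \<le> \<epsilon>'" using M by (simp add: \<epsilon>'_def field_simps)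
        qed (use r0 in auto)
        finally show "24 * real (card E) * (CARD('n) * \<tau> * d) \<le> \<epsilon>' * r" .
        \<comment> \<open>Both hypotheses survive the change from \<delta> to the larger threshold
          at \<epsilon>': a near isometry stays one for a larger constant, and a block with a larger
          constant is also a block with \<delta>.\<close>
        show "\<exists>\<Phi> T b. motion_extension (1 + \<epsilon>') F \<psi> \<Phi> T b"
          if F: "F \<subseteq> E" "card F < card E" "near_isometric \<delta> F \<psi>" "\<not> (\<exists>z. neg_block \<delta> F \<psi> z)" for F \<psi>
        proof -
          have "near_isometric (exp (- C1 / \<epsilon>')) F \<psi>"
            using near_isometric_mono[OF F(3) \<delta>1(1) \<delta>IH] .
          moreover have "\<not> (\<exists>z. neg_block (exp (- C1 / \<epsilon>')) F \<psi> z)"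
            using F(4) neg_block_mono[OF _ \<delta>1(1) \<delta>IH] by blast
          moreover have "finite F" "card F \<le> n" using F E by (auto intro: finite_subset)
          ultimately show ?thesis using IH \<epsilon>' unfolding extension_property_def by blast
        qed
      qed (use E d \<delta>1 \<kappa>0 r0 rd \<epsilon>' iso nb T in \<open>auto simp: \<delta>_def d_def\<close>)
      then obtain \<Phi> where \<Phi>: "motion_extension ((1 + \<epsilon>') ^ (1 + card E * (CARD('n) + 2))) E \<phi> \<Phi> T b" ..
      have "(1 + \<epsilon>') ^ (1 + card E * (CARD('n) + 2)) \<le> (1 + \<epsilon>') ^ m"
        unfolding m_def D_def
        using \<epsilon>' E(2) by (intro power_increasing add_left_mono mult_le_mono1) auto
      also have "\<dots> \<le> 1 + \<epsilon>"
        unfolding \<epsilon>'_def M_def using \<epsilon> \<epsilon>1 by (intro power_one_plus_le) (auto simp: m_def)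
      finally have "motion_extension (1 + \<epsilon>) E \<phi> \<Phi> T b"
        using \<Phi> unfolding motion_extension_def by (meson quasi_isometry_mono)
      then show ?thesis by blast
    qed
  qed
  then show ?thesis using c C by blast
qed

lemma extension_property_exists:
  "\<exists>c>0. \<exists>C>0. extension_property TYPE('n::finite) n c C"
proof (induction n)
  case 0
  have "extension_property TYPE('n) 0 1 1"
    unfolding extension_property_def by (auto intro!: motion_extension_trivial)
  then show ?case by (intro exI[of _ "1::real"] conjI) simp_all
next
  case (Suc n)
  then show ?case using extension_property_Suc by blast
qed

section \<open>From the induction invariant to distorted diffeomorphisms\<close>

theorem theorem1p10:
  fixes k :: nat
  assumes "CARD('n) \<ge> 2" and "k \<ge> 1"
  shows "\<exists>c C' C''. c > 0 \<and> C' > 0 \<and> C'' > 0 \<and>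
    (\<forall>(\<epsilon>::real) (E :: (real^'n) set) (\<phi> :: real^'n \<Rightarrow> real^'n).
       0 < \<epsilon> \<longrightarrow> \<epsilon> < c \<longrightarrow> finite E \<longrightarrow> card E \<le> k \<longrightarrow>
       (\<forall>x\<in>E. \<forall>y\<in>E. inverse (1 + exp (- C'' / \<epsilon>)) * dist x y \<le> dist (\<phi> x) (\<phi> y)
                       \<and> dist (\<phi> x) (\<phi> y) \<le> (1 + exp (- C'' / \<epsilon>)) * dist x y) \<longrightarrow>
       \<not> (\<exists>z. neg_block (exp (- C' / \<epsilon>)) E \<phi> z) \<longrightarrow>
       (\<exists>\<Phi>. proper_distorted_diffeo \<epsilon> \<Phi> \<and> (\<forall>x\<in>E. \<Phi> x = \<phi> x) \<and>
          (\<exists>(T::real^'n^'n) x0. orthogonal_matrix T \<and> det T = 1 \<and>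
             (\<forall>x. infdist x E \<ge> 10^4 * diameter E \<longrightarrow> \<Phi> x = T *v x + x0))))"
proof -
  obtain c C where C: "c > 0" "C > 0" "extension_property TYPE('n) k c C"
    using extension_property_exists by blast
  have main: "\<exists>\<Phi>. proper_distorted_diffeo \<epsilon> \<Phi> \<and> (\<forall>x\<in>E. \<Phi> x = \<phi> x) \<and>
          (\<exists>(T::real^'n^'n) x0. orthogonal_matrix T \<and> det T = 1 \<and>
             (\<forall>x. infdist x E \<ge> 10^4 * diameter E \<longrightarrow> \<Phi> x = T *v x + x0))"
    if \<epsilon>: "0 < \<epsilon>" "\<epsilon> < min 1 c" and E: "finite E" "card E \<le> k"
      and iso: "\<forall>x\<in>E. \<forall>y\<in>E. inverse (1 + exp (- (3 * C) / \<epsilon>)) * dist x y \<le> dist (\<phi> x) (\<phi> y)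
                       \<and> dist (\<phi> x) (\<phi> y) \<le> (1 + exp (- (3 * C) / \<epsilon>)) * dist x y"
      and nb: "\<not> (\<exists>z. neg_block (exp (- (3 * C) / \<epsilon>)) E \<phi> z)"
    for \<epsilon> and E :: "(real^'n) set" and \<phi>
  proof -
    \<comment> \<open>The matrix inequalities involve squared lengths, so the invariant is applied
      with \<epsilon>/3, for which (1 + \<epsilon>/3)^2 \<le> 1 + \<epsilon>; this is the source of
      the constant 3C.\<close>
    have eq: "exp (- (3 * C) / \<epsilon>) = exp (- C / (\<epsilon> / 3))" by simp
    have "near_isometric (exp (- C / (\<epsilon> / 3))) E \<phi>"
      using iso unfolding near_isometric_def eq .
    moreover have "0 < \<epsilon> / 3" "\<epsilon> / 3 < c" using \<epsilon> by auto
    ultimately obtain \<Phi> T b where \<Phi>: "motion_extension (1 + \<epsilon> / 3) E \<phi> \<Phi> T b"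
      using C(3) E nb unfolding extension_property_def eq by blast
    have "(1 + \<epsilon> / 3)\<^sup>2 = 1 + 2 / 3 * \<epsilon> + \<epsilon> * \<epsilon> / 9"
      by (simp add: power2_eq_square field_simps)
    also have "\<dots> \<le> 1 + \<epsilon>"
    proof -
      have "\<epsilon> * \<epsilon> \<le> \<epsilon> * 1" using \<epsilon> by (intro mult_left_mono) auto
      then show ?thesis using \<epsilon> by linarith
    qed
    finally have "proper_distorted_diffeo \<epsilon> \<Phi>"
      using \<Phi> \<epsilon> by (intro quasi_isometry_imp_distorted[of "1 + \<epsilon> / 3"]) (auto simp: motion_extension_def)
    moreover have "0 \<le> diameter E" using E(1) by (intro diameter_ge_0 finite_imp_bounded)
    then have "diameter E \<le> infdist x E" if "10^4 * diameter E \<le> infdist x E" for x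
      using that by simp
    ultimately show ?thesis using \<Phi> unfolding motion_extension_def by blast
  qed
  show ?thesis
    by (rule exI[of _ "min 1 c"], rule exI[of _ "3 * C"], rule exI[of _ "3 * C"])
      (use C main in auto)
qed

end
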